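(* (1) Let $\tilde W^!=\tilde W^!_A$ and let $\tilde w\in[(\tilde\lambda,\tilde\emptyset)]$ for some $(\tilde\lambda,\tilde\emptyset)\in\mathcal{DP}$. Then there exists $\tilde w'\in S_n\cdot\tilde w^{st}_{(\tilde\lambda,\tilde\emptyset)}$ (the orbit under conjugation by $S_n$) such that $\tilde w\,\tilde\to\,\tilde w'$. (2) Let $\tilde W^!$ be $\tilde W^!_B$, $\tilde W^!_C$ or $\tilde W^!_D$ and let $\tilde w\in[(\tilde\lambda,\tilde\mu)]'$ for some $(\tilde\lambda,\tilde\mu)\in\mathcal{DP}_{\geq 0}$. Then there exists $\tilde w'\in S_n\cdot\tilde w^{st}_{(\tilde\lambda,\tilde\mu)}$ such that $\tilde w\,\tilde\to\,\tilde w'$.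
   Context: Groups. $S'_n$ is the group of permutations $\sigma$ of $\{\pm1,\dots,\pm n\}$ with $\sigma(-i)=-\sigma(i)$; $S_n\subset S'_n$ is the subgroup with $\sigma(i)>0$ for all $i>0$. $S'_n$ acts on $\mathbb R^n$ by $\sigma\cdot[a_1,\dots,a_n]=[a_{\sigma^{-1}(1)},\dots,a_{\sigma^{-1}(n)}]$ with $a_{-i}:=-a_i$. $e_1,\dots,e_n$ is the standard basis, $\langle e_i,e_j\rangle=\delta_{ij}$. In lattice semidirect products $t^\chi$ denotes translation, $(t^\chi w)(t^{\chi'}w')=t^{\chi+w\chi'}ww'$. Put $\omega=[\frac12,\dots,\frac12]$. The groups of classical type are: Type A: $\tilde W^!_A=\mathbb Z^n\rtimes S_n$, $W=S_n$, $\Phi^+=\{e_i-e_j:i<j\}$. Type B: $\tilde W^!_B=\mathbb Z^n\rtimes S'_n$, $W=S'_n$, $\Phi^+=\{e_i\}\cup\{e_i\pm e_j:i<j\}$. Type C: $\tilde W^!_C=(\mathbb Z^n\sqcup(\mathbb Z^n+\omega))\rtimes S'_n$, $W=S'_n$, $\Phi^+=\{2e_i\}\cup\{e_i\pm e_j:i<j\}$. Type D: $\tilde W^!_D=(\mathbb Z^n\sqcup(\mathbb Z^n+\omega))\rtimes S'_n$, $W=W(D_n)$ the subgroup of $S'_n$ of elements with an even number of sign changes, $\Phi^+=\{e_i\pm e_j:i<j\}$. Length: $l(t^\chi w)=\sum_{\alpha\in\Phi^+,\,w^{-1}\alpha\in\Phi^+}|\langle\chi,\alpha\rangle|+\sum_{\alpha\in\Phi^+,\,w^{-1}\alpha\in\Phi^-}|\langle\chi,\alpha\rangle-1|$.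 $W_a=Q^\vee\rtimes W$ with $Q^\vee$ the coroot lattice; it is a Coxeter group with generators $s_i$, $i\in\tilde S=S\cup\{0\}$, where $s_i$ ($i\in S$) are the simple reflections of $W$ and $s_0=t^{\theta^\vee}s_\theta$, $\theta$ the highest root. $\Omega=\{\tau\in\tilde W^!:l(\tau)=0\}$, and $\tilde W^!=W_a\rtimes\Omega$. Relation. $\tilde w\xrightarrow{s_i}\tilde w'$ means $\tilde w'=s_i\tilde ws_i$ and $l(\tilde w')\le l(\tilde w)$ ($i\in\tilde S$). $\tilde w\,\tilde\to\,\tilde w'$ means there is a finite sequence $\tilde w=\tilde w_0,\dots,\tilde w_m=\tilde w'$ such that for each $k$, either $\tilde w_k=a\tilde w_{k-1}a^{-1}$ for some $a\in\Omega$, or $\tilde w_{k-1}\xrightarrow{s_i}\tilde w_k$ for some $i\in\tilde S$. Double partitions. A double partition is a finite sequence $\tilde\lambda=[(b_1,c_1),\dots,(b_k,c_k)]$ in $\mathbb Z_{\ge1}\times\mathbb Z$, weakly decreasing lexicographically; $\lambda=[b_1,\dots,b_k]$; $\tilde\emptyset$ is the empty one. It is positive if all $c_i\ge0$, special if all $c_i\in\{0,1\}$. $\mathcal{DP}$ is the set of pairs $(\tilde\lambda,\tilde\mu)$ of double partitions with $\tilde\mu$ special and the sum of all first components $b_i$ of entries of $\tilde\lambda$ and $\tilde\mu$ equal to $n$; $\mathcal{DP}_{\ge0}$ is the subset with $\tilde\lambda$ positive. Elements. Let $\tilde\lambda=[(b_1,c_1),\dots,(b_k,c_k)]$, $\tilde\mu=[(b_{k+1},c_{k+1}),\dots,(b_l,c_l)]$,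 $B_j=b_1+\cdots+b_j$. Write $(i_1i_2\cdots i_r)$ for the element of $S'_n$ with $i_1\to i_2\to\cdots\to i_r\to i_1$ (and correspondingly on negatives), and $(i,-i)$ for the sign change at $i$; products are compositions of maps from right to left. Put $$w_{(\lambda,\mu)}=(B_{k+1},-B_{k+1})\cdots(B_l,-B_l)\,\prod_{j=1}^l(B_{j-1}+1,\dots,B_j).$$ $\tilde w_{(\tilde\lambda,\tilde\mu)}=t^{[a_1,\dots,a_n]}w_{(\lambda,\mu)}$ with $a_{B_j}=c_j$ and $a_i=0$ otherwise. For $b\ge1$, $c\in\mathbb Z$ put $x_i=\lceil ic/b\rceil-\lceil(i-1)c/b\rceil$ and $\chi'_{b,c}=(x_b,x_{b-1},\dots,x_1)$. The standard element is $\tilde w^{st}_{(\tilde\lambda,\tilde\mu)}=t^{[\chi'_{b_1,c_1},\dots,\chi'_{b_l,c_l}]}w_{(\lambda,\mu)}$. $[(\tilde\lambda,\tilde\emptyset)]$ is the conjugacy class of $\tilde w_{(\tilde\lambda,\tilde\emptyset)}$ in $\mathbb Z^n\rtimes S_n$, and $[(\tilde\lambda,\tilde\mu)]'$ is the conjugacy class of $\tilde w_{(\tilde\lambda,\tilde\mu)}$ in $\mathbb Z^n\rtimes S'_n$. *)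

theory Defs
  imports
    "HOL-Algebra.Group"
    "HOL-Combinatorics.Combinatorics"
    "HOL-Library.Function_Algebras"
begin

section \<open>Vectors and signed permutations\<close>

text \<open>
  A vector \<open>[a\<^sub>1, \<dots>, a\<^sub>n]\<close> of $n$-dimensional real space is represented by the odd function on the
  integers with these values at \<open>1, \<dots>, n\<close> and the value 0 outside \<open>{\<plusminus>1, \<dots>, \<plusminus>n}\<close>.  This builds in
  the convention \<open>a\<^bsub>-i\<^esub> = - a\<^sub>i\<close>.  Addition, negation and 0 are pointwise.
\<close>

type_synonym vec = "int \<Rightarrow> real"

definition Rn :: "nat \<Rightarrow> vec set" where
  "Rn n = {a. (\<forall>i. a (- i) = - a i) \<and> (\<forall>i. int n < \<bar>i\<bar> \<longrightarrow> a i = 0)}"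

definition vec_of_list :: "real list \<Rightarrow> vec" where
  "vec_of_list as = (\<lambda>i.
     if 1 \<le> i \<and> i \<le> int (length as) then as ! nat (i - 1)
     else if 1 \<le> - i \<and> - i \<le> int (length as) then - (as ! nat (- i - 1))
     else 0)"

definition scale :: "real \<Rightarrow> vec \<Rightarrow> vec" where
  "scale r a = (\<lambda>i. r * a i)"

definition ip :: "nat \<Rightarrow> vec \<Rightarrow> vec \<Rightarrow> real" where
  "ip n a b = (\<Sum>i = 1..int n. a i * b i)"

text \<open>The standard basis vector \<open>e\<^sub>i\<close>; the index \<open>i\<close> is meant to be positive.\<close>

definition basis_vec :: "int \<Rightarrow> vec" where
  "basis_vec i = (\<lambda>j. if j = i then 1 else if j = - i then -1 else 0)"

definition omega :: "nat \<Rightarrow> vec" where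
  "omega n = vec_of_list (replicate n (1/2))"

definition Zn :: "nat \<Rightarrow> vec set" where
  "Zn n = {a \<in> Rn n. \<forall>i. a i \<in> \<int>}"

definition signed_perms :: "nat \<Rightarrow> (int \<Rightarrow> int) set" where
  "signed_perms n =
     {\<sigma>. \<sigma> permutes {i. 1 \<le> \<bar>i\<bar> \<and> \<bar>i\<bar> \<le> int n} \<and> (\<forall>i. \<sigma> (- i) = - \<sigma> i)}"

definition sym_perms :: "nat \<Rightarrow> (int \<Rightarrow> int) set" where
  "sym_perms n = {\<sigma> \<in> signed_perms n. \<forall>i \<in> {1..int n}. \<sigma> i > 0}"

definition act :: "(int \<Rightarrow> int) \<Rightarrow> vec \<Rightarrow> vec" where
  "act \<sigma> a = (\<lambda>i. a (Hilbert_Choice.inv \<sigma> i))"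


section \<open>The groups of classical type\<close>

text \<open>The pair \<open>(\<chi>, w)\<close> stands for \<open>t\<^sup>\<chi> w\<close>.\<close>

type_synonym elt = "vec \<times> (int \<Rightarrow> int)"

definition semidirect :: "vec set \<Rightarrow> (int \<Rightarrow> int) set \<Rightarrow> elt monoid" where
  "semidirect L W =
     \<lparr>carrier = L \<times> W,
      monoid.mult = (\<lambda>(\<chi>, w) (\<chi>', w'). (\<chi> + act w \<chi>', w \<circ> w')),
      one = (0, id)\<rparr>"

datatype classical_type = Type_A | Type_B | Type_C | Type_D

fun ext_group :: "classical_type \<Rightarrow> nat \<Rightarrow> elt monoid" where
  "ext_group Type_A n = semidirect (Zn n) (sym_perms n)"
| "ext_group Type_B n = semidirect (Zn n) (signed_perms n)"
| "ext_group Type_C n =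
     semidirect (Zn n \<union> {a + omega n | a. a \<in> Zn n}) (signed_perms n)"
| "ext_group Type_D n =
     semidirect (Zn n \<union> {a + omega n | a. a \<in> Zn n}) (signed_perms n)"

fun pos_roots :: "classical_type \<Rightarrow> nat \<Rightarrow> vec set" where
  "pos_roots Type_A n =
     {basis_vec i - basis_vec j | i j. 1 \<le> i \<and> i < j \<and> j \<le> int n}"
| "pos_roots Type_B n =
     {basis_vec i | i. 1 \<le> i \<and> i \<le> int n} \<union>
     {basis_vec i - basis_vec j | i j. 1 \<le> i \<and> i < j \<and> j \<le> int n} \<union>
     {basis_vec i + basis_vec j | i j. 1 \<le> i \<and> i < j \<and> j \<le> int n}"
| "pos_roots Type_C n =
     {scale 2 (basis_vec i) | i. 1 \<le> i \<and> i \<le> int n} \<union>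
     {basis_vec i - basis_vec j | i j. 1 \<le> i \<and> i < j \<and> j \<le> int n} \<union>
     {basis_vec i + basis_vec j | i j. 1 \<le> i \<and> i < j \<and> j \<le> int n}"
| "pos_roots Type_D n =
     {basis_vec i - basis_vec j | i j. 1 \<le> i \<and> i < j \<and> j \<le> int n} \<union>
     {basis_vec i + basis_vec j | i j. 1 \<le> i \<and> i < j \<and> j \<le> int n}"

definition neg_roots :: "classical_type \<Rightarrow> nat \<Rightarrow> vec set" where
  "neg_roots T n = uminus ` pos_roots T n"

text \<open>The length takes values in the nonnegative integers on the groups above.\<close>

definition len :: "classical_type \<Rightarrow> nat \<Rightarrow> elt \<Rightarrow> real" where
  "len T n = (\<lambda>(\<chi>, w).
     (\<Sum>\<alpha> \<in> {\<alpha> \<in> pos_roots T n. act (Hilbert_Choice.inv w) \<alpha> \<in> pos_roots T n}. \<bar>ip n \<chi> \<alpha>\<bar>) +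
     (\<Sum>\<alpha> \<in> {\<alpha> \<in> pos_roots T n. act (Hilbert_Choice.inv w) \<alpha> \<in> neg_roots T n}. \<bar>ip n \<chi> \<alpha> - 1\<bar>))"

definition Omega :: "classical_type \<Rightarrow> nat \<Rightarrow> elt set" where
  "Omega T n = {\<tau> \<in> carrier (ext_group T n). len T n \<tau> = 0}"


section \<open>The simple affine reflections\<close>

definition simple_roots :: "classical_type \<Rightarrow> nat \<Rightarrow> vec set" where
  "simple_roots T n =
     {\<alpha> \<in> pos_roots T n. \<not> (\<exists>\<beta> \<in> pos_roots T n. \<exists>\<gamma> \<in> pos_roots T n. \<alpha> = \<beta> + \<gamma>)}"

definition root_le :: "classical_type \<Rightarrow> nat \<Rightarrow> vec \<Rightarrow> vec \<Rightarrow> bool" where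
  "root_le T n \<alpha> \<beta> \<longleftrightarrow>
     (\<exists>m :: vec \<Rightarrow> nat. \<beta> = \<alpha> + (\<Sum>\<gamma> \<in> simple_roots T n. scale (real (m \<gamma>)) \<gamma>))"

text \<open>
  The maximal roots for the root order.  For an irreducible root system this set consists of the
  highest root only.  It has one element for each of the two components of $D_2$ (so that the
  reflections below generate the affine Weyl group in this case, too), and it is empty for the
  empty root systems $A_0$ (type A with \<open>n = 1\<close>) and $D_1$.
\<close>

definition highest_roots :: "classical_type \<Rightarrow> nat \<Rightarrow> vec set" where
  "highest_roots T n =
     {\<theta> \<in> pos_roots T n. \<forall>\<beta> \<in> pos_roots T n. root_le T n \<theta> \<beta> \<longrightarrow> \<beta> = \<theta>}"

definition coroot :: "nat \<Rightarrow> vec \<Rightarrow> vec" where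
  "coroot n \<alpha> = scale (2 / ip n \<alpha> \<alpha>) \<alpha>"

definition is_reflection :: "nat \<Rightarrow> vec \<Rightarrow> (int \<Rightarrow> int) \<Rightarrow> bool" where
  "is_reflection n \<alpha> s \<longleftrightarrow>
     s \<in> signed_perms n \<and> (\<forall>v \<in> Rn n. act s v = v - scale (ip n v (coroot n \<alpha>)) \<alpha>)"

definition simple_affine_reflections :: "classical_type \<Rightarrow> nat \<Rightarrow> elt set" where
  "simple_affine_reflections T n =
     {(0, s) | \<alpha> s. \<alpha> \<in> simple_roots T n \<and> is_reflection n \<alpha> s} \<union>
     {(coroot n \<theta>, s) | \<theta> s. \<theta> \<in> highest_roots T n \<and> is_reflection n \<theta> s}"


section \<open>The relation on the extended group\<close>

definition arrow :: "classical_type \<Rightarrow> nat \<Rightarrow> elt \<Rightarrow> elt \<Rightarrow> elt \<Rightarrow> bool" where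
  "arrow T n s x y \<longleftrightarrow>
     y = s \<otimes>\<^bsub>ext_group T n\<^esub> x \<otimes>\<^bsub>ext_group T n\<^esub> s \<and> len T n y \<le> len T n x"

definition step :: "classical_type \<Rightarrow> nat \<Rightarrow> elt \<Rightarrow> elt \<Rightarrow> bool" where
  "step T n x y \<longleftrightarrow>
     (\<exists>a \<in> Omega T n. y = a \<otimes>\<^bsub>ext_group T n\<^esub> x \<otimes>\<^bsub>ext_group T n\<^esub> inv\<^bsub>ext_group T n\<^esub> a) \<or>
     (\<exists>s \<in> simple_affine_reflections T n. arrow T n s x y)"

definition reaches :: "classical_type \<Rightarrow> nat \<Rightarrow> elt \<Rightarrow> elt \<Rightarrow> bool" where
  "reaches T n = (step T n)\<^sup>*\<^sup>*"

definition conj_orbit :: "elt monoid \<Rightarrow> elt set \<Rightarrow> elt \<Rightarrow> elt set" where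
  "conj_orbit G H x = {h \<otimes>\<^bsub>G\<^esub> x \<otimes>\<^bsub>G\<^esub> inv\<^bsub>G\<^esub> h | h. h \<in> H}"


section \<open>Double partitions\<close>

type_synonym dpart = "(nat \<times> int) list"

definition double_partition :: "dpart \<Rightarrow> bool" where
  "double_partition p \<longleftrightarrow>
     (\<forall>(b, c) \<in> set p. 1 \<le> b) \<and>
     sorted_wrt (\<lambda>(b, c) (b', c'). b' < b \<or> b' = b \<and> c' \<le> c) p"

definition positive :: "dpart \<Rightarrow> bool" where
  "positive p \<longleftrightarrow> (\<forall>(b, c) \<in> set p. 0 \<le> c)"

definition special :: "dpart \<Rightarrow> bool" where
  "special p \<longleftrightarrow> (\<forall>(b, c) \<in> set p. c \<in> {0, 1})"

definition DP :: "nat \<Rightarrow> (dpart \<times> dpart) set" where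
  "DP n = {(p, q). double_partition p \<and> double_partition q \<and> special q \<and>
                   sum_list (map fst p) + sum_list (map fst q) = n}"

definition DP_pos :: "nat \<Rightarrow> (dpart \<times> dpart) set" where
  "DP_pos n = {(p, q) \<in> DP n. positive p}"


section \<open>The elements attached to pairs of double partitions\<close>

definition psum :: "nat list \<Rightarrow> nat \<Rightarrow> nat" where
  "psum bs j = sum_list (take j bs)"

definition signed_cycle :: "int list \<Rightarrow> int \<Rightarrow> int" where
  "signed_cycle cs = cycle_of_list cs \<circ> cycle_of_list (map uminus cs)"

definition sign_change :: "int \<Rightarrow> int \<Rightarrow> int" where
  "sign_change i = transpose i (- i)"

definition compose_all :: "(int \<Rightarrow> int) list \<Rightarrow> int \<Rightarrow> int" where
  "compose_all fs = foldr (\<circ>) fs id"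

definition w_part :: "nat list \<Rightarrow> nat list \<Rightarrow> int \<Rightarrow> int" where
  "w_part lam mu =
     (let B = (\<lambda>j. int (psum (lam @ mu) j)); k = length lam; l = length (lam @ mu) in
      compose_all (map (\<lambda>j. sign_change (B j)) [k + 1..<l + 1]) \<circ>
      compose_all (map (\<lambda>j. signed_cycle [B (j - 1) + 1..B j]) [1..<l + 1]))"

definition w_tilde :: "dpart \<Rightarrow> dpart \<Rightarrow> elt" where
  "w_tilde p q =
     (let r = p @ q in
      (\<Sum>j = 1..length r. scale (of_int (snd (r ! (j - 1)))) (basis_vec (int (psum (map fst r) j))),
       w_part (map fst p) (map fst q)))"

definition chi' :: "nat \<Rightarrow> int \<Rightarrow> real list" where
  "chi' b c =
     (let x = (\<lambda>i :: nat. \<lceil>real i * of_int c / real b\<rceil> - \<lceil>(real i - 1) * of_int c / real b\<rceil>)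
      in map (\<lambda>i. of_int (x i)) (rev [1..<b + 1]))"

definition w_std :: "dpart \<Rightarrow> dpart \<Rightarrow> elt" where
  "w_std p q =
     (vec_of_list (concat (map (\<lambda>(b, c). chi' b c) (p @ q))),
      w_part (map fst p) (map fst q))"

definition class_A :: "nat \<Rightarrow> dpart \<Rightarrow> elt set" where
  "class_A n p =
     (let G = semidirect (Zn n) (sym_perms n) in conj_orbit G (carrier G) (w_tilde p []))"

definition class_B :: "nat \<Rightarrow> dpart \<Rightarrow> dpart \<Rightarrow> elt set" where
  "class_B n p q =
     (let G = semidirect (Zn n) (signed_perms n) in conj_orbit G (carrier G) (w_tilde p q))"

definition Sn_orbit :: "classical_type \<Rightarrow> nat \<Rightarrow> elt \<Rightarrow> elt set" where
  "Sn_orbit T n x = conj_orbit (ext_group T n) ({0} \<times> sym_perms n) x"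

end

theory Submission
  imports "HOL-Analysis.Function_Topology" Defs
begin

text \<open>
  Fix \<open>x\<close> and move the alcove instead: conjugating by a simple reflection means crossing a wall, and
  the length does not increase as soon as the image of a point of the wall under \<open>x\<close> or under its inverse
  lies on the far side.  Hence all walls through a point may be crossed in the
  direction of the negative gradient of the displacement \<open>|x p - p|\<^sup>2\<close>, and a point of minimal
  displacement among all reachable alcoves is one where \<open>x\<close> acts as a translation by some \<open>\<nu>\<close>.

  There the affine coordinate functions along a cycle of \<open>x\<close> form an arithmetic progression with
  step \<open>\<nu>\<close>.  In type A their integer parts give the ceilings in the standard element.  In the
  other types one first contracts the coordinates of positive slope into the first half of
  each unit interval; they meet only coordinates of other slopes, and these crossings are always
  allowed.  The cycles of slope zero at the special points 0 and 1/2 are treated by a greedy sort: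
  the neighbours of a coordinate of maximal modulus along its cycle can be raised next to it, so that every
  cycle ends up with at most one change of sign.
\<close>

text \<open>Types B, C and D are treated together: all conjugations stay in the group
  \<open>grp n\<close>, and the region 1/2 \<ge> p_1 \<ge> ... \<ge> p_n \<ge> 0 serves all three.
  Its end walls p_n = 0 and p_1 = 1/2 are mirrors of simple affine reflections in type C. In type B
  the second, and in type D each, of the two elements has length zero instead and may always be
  applied. In type A the length zero elements rotate the coordinates and take the place of the
  affine reflection. The end of the proof rests on the centraliser of the standard element: once one
  of its elements moves the point into the box (0, 1/2)^n, or [0, 1)^n in type A, the conjugators
  differ by a permutation. On a cycle the centraliser offers powers of x, an integral shift unless
  the cycle closes up with a sign, and a sign change only where x has no translation. So a cycle of
  positive slope must get all its coordinates into the first half of a unit interval at once, which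
  forces the contraction; and a cycle closing up with a sign can only be rotated, which forces its
  changes of sign to be gathered in one place.\<close>

abbreviation iv :: "(int \<Rightarrow> int) \<Rightarrow> int \<Rightarrow> int" where
  "iv \<equiv> Hilbert_Choice.inv"

section \<open>The affine action\<close>

definition idx :: "nat \<Rightarrow> int set" where
  "idx n = {i. 1 \<le> \<bar>i\<bar> \<and> \<bar>i\<bar> \<le> int n}"

definition aff :: "elt \<Rightarrow> vec \<Rightarrow> vec" where
  "aff x v = fst x + act (snd x) v"

text \<open>One product for every \<open>semidirect L W\<close>, freed from its carrier; identities
  then need only bijective linear parts.\<close>

definition gmul :: "elt \<Rightarrow> elt \<Rightarrow> elt" where
  "gmul x y = (fst x + act (snd x) (fst y), snd x \<circ> snd y)"

definition ginv :: "elt \<Rightarrow> elt" where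
  "ginv x = (- act (iv (snd x)) (fst x), iv (snd x))"

text \<open>The group of type B. In types C and D the whole argument stays inside this subgroup of
  the extended group.\<close>

definition grp :: "nat \<Rightarrow> elt set" where
  "grp n = Zn n \<times> signed_perms n"

definition grpA :: "nat \<Rightarrow> elt set" where
  "grpA n = Zn n \<times> sym_perms n"

lemma finite_idx [simp]: "finite (idx n)"
proof -
  have "idx n \<subseteq> {- int n..int n}" by (auto simp: idx_def)
  thus ?thesis by (rule finite_subset) simp
qed

lemma idx_minus [simp]: "- i \<in> idx n \<longleftrightarrow> i \<in> idx n"
  by (simp add: idx_def)

lemma idxI: "1 \<le> i \<Longrightarrow> i \<le> int n \<Longrightarrow> i \<in> idx n"
  by (simp add: idx_def)

lemma idx_cases:
  assumes "i \<in> idx n"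
  obtains "i \<in> {1..int n}" | "- i \<in> {1..int n}"
  using assms by (auto simp: idx_def abs_if split: if_splits)

lemma idx_nonzero: "i \<in> idx n \<Longrightarrow> i \<noteq> 0"
  by (auto simp: idx_def)

section \<open>Signed permutations and ordinary permutations\<close>

lemma signed_perms_iff:
  "w \<in> signed_perms n \<longleftrightarrow> w permutes idx n \<and> (\<forall>i. w (- i) = - w i)"
  by (simp add: signed_perms_def idx_def)

lemma sp_permutes: "w \<in> signed_perms n \<Longrightarrow> w permutes idx n"
  by (simp add: signed_perms_iff)

lemma sp_minus: "w \<in> signed_perms n \<Longrightarrow> w (- i) = - w i"
  by (simp add: signed_perms_iff)

lemma sp_bij: "w \<in> signed_perms n \<Longrightarrow> bij w"
  by (metis sp_permutes permutes_bij)

lemma sp_idx: "w \<in> signed_perms n \<Longrightarrow> w i \<in> idx n \<longleftrightarrow> i \<in> idx n"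
  by (metis sp_permutes permutes_in_image)

lemma sp_outside: "w \<in> signed_perms n \<Longrightarrow> i \<notin> idx n \<Longrightarrow> w i = i"
  by (metis sp_permutes permutes_not_in)

lemma sp_iv_eq: "w \<in> signed_perms n \<Longrightarrow> iv w (w i) = i"
  by (simp add: sp_bij bij_is_inj)

lemma sp_eq_iv: "w \<in> signed_perms n \<Longrightarrow> w (iv w i) = i"
  by (metis sp_bij bij_inv_eq_iff)

lemma sp_iv: "w \<in> signed_perms n \<Longrightarrow> iv w \<in> signed_perms n"
  unfolding signed_perms_iff
  by (metis permutes_inv permutes_inverses(1,2))

lemma sp_comp: "w \<in> signed_perms n \<Longrightarrow> w' \<in> signed_perms n \<Longrightarrow> w \<circ> w' \<in> signed_perms n"
  unfolding signed_perms_iff by (auto intro: permutes_compose)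

lemma sp_id: "id \<in> signed_perms n"
  by (simp add: signed_perms_iff permutes_id)

lemma sp_pow: "w \<in> signed_perms n \<Longrightarrow> w ^^ k \<in> signed_perms n"
  by (induction k) (auto simp: sp_id sp_comp simp del: id_apply)

lemma sp_iv_iv: "w \<in> signed_perms n \<Longrightarrow> iv (iv w) = w"
  by (simp add: inv_inv_eq sp_bij)

lemma finite_signed_perms: "finite (signed_perms n)"
proof -
  have "signed_perms n \<subseteq> {w. w permutes idx n}" by (auto simp: signed_perms_iff)
  thus ?thesis by (rule finite_subset) (simp add: finite_permutations)
qed

lemma sym_perms_signed: "w \<in> sym_perms n \<Longrightarrow> w \<in> signed_perms n"
  by (simp add: sym_perms_def)

lemma sym_perms_pos: "w \<in> sym_perms n \<Longrightarrow> i \<in> {1..int n} \<Longrightarrow> w i \<in> {1..int n}"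
  using sp_idx[of w n i] by (force simp: sym_perms_def idx_def)

lemma sym_perms_bij_betw:
  assumes "w \<in> sym_perms n" shows "bij_betw w {1..int n} {1..int n}"
proof -
  have "inj_on w {1..int n}"
    using sp_bij[OF sym_perms_signed[OF assms]] by (meson bij_is_inj inj_on_subset subset_UNIV)
  moreover have "w ` {1..int n} \<subseteq> {1..int n}" using sym_perms_pos[OF assms] by auto
  ultimately show ?thesis
    by (metis bij_betw_def endo_inj_surj finite_atLeastAtMost_int)
qed

lemma sym_perms_iv:
  assumes "w \<in> sym_perms n" shows "iv w \<in> sym_perms n"
proof -
  have "iv w i > 0" if i: "i \<in> {1..int n}" for i
  proof -
    obtain j where "j \<in> {1..int n}" "w j = i"
      using sym_perms_bij_betw[OF assms] i by (metis bij_betw_iff_bijections)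
    thus ?thesis using sp_iv_eq[OF sym_perms_signed[OF assms]] by force
  qed
  thus ?thesis using sp_iv[OF sym_perms_signed[OF assms]] by (simp add: sym_perms_def)
qed

lemma sym_perms_comp: "w \<in> sym_perms n \<Longrightarrow> w' \<in> sym_perms n \<Longrightarrow> w \<circ> w' \<in> sym_perms n"
  using sym_perms_pos[of w' n] by (auto simp: sym_perms_def sp_comp)

lemma sym_perms_id: "id \<in> sym_perms n"
  by (simp add: sym_perms_def sp_id)

section \<open>Odd vectors, the lattice and the linear action\<close>

lemma Rn_minus: "v \<in> Rn n \<Longrightarrow> v (- i) = - v i"
  by (simp add: Rn_def)

lemma Rn_outside: "v \<in> Rn n \<Longrightarrow> i \<notin> idx n \<Longrightarrow> v i = 0"
proof -
  assume v: "v \<in> Rn n" and i: "i \<notin> idx n"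
  show "v i = 0"
  proof (cases "i = 0")
    case True
    have "v (- 0) = - v 0" using v by (rule Rn_minus)
    thus ?thesis using True by simp
  next
    case False
    thus ?thesis using v i by (auto simp: Rn_def idx_def)
  qed
qed

lemma RnI: "(\<And>i. v (- i) = - v i) \<Longrightarrow> (\<And>i. i \<notin> idx n \<Longrightarrow> v i = 0) \<Longrightarrow> v \<in> Rn n"
  by (auto simp: Rn_def idx_def)

lemma Rn_eqI:
  assumes "u \<in> Rn n" "v \<in> Rn n" "\<And>i. i \<in> {1..int n} \<Longrightarrow> u i = v i"
  shows "u = v"
proof
  fix i
  show "u i = v i"
  proof (cases "i \<in> idx n")
    case True thus ?thesis
      using assms(3)[of i] assms(3)[of "-i"] Rn_minus[OF assms(1), of i] Rn_minus[OF assms(2), of i]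
      by (auto elim!: idx_cases)
  qed (simp add: Rn_outside[OF assms(1)] Rn_outside[OF assms(2)])
qed

lemma Rn_add: "u \<in> Rn n \<Longrightarrow> v \<in> Rn n \<Longrightarrow> u + v \<in> Rn n"
  and Rn_diff: "u \<in> Rn n \<Longrightarrow> v \<in> Rn n \<Longrightarrow> u - v \<in> Rn n"
  and Rn_uminus: "u \<in> Rn n \<Longrightarrow> - u \<in> Rn n"
  and Rn_zero: "0 \<in> Rn n"
  and Rn_scale: "u \<in> Rn n \<Longrightarrow> scale r u \<in> Rn n"
  by (auto simp: Rn_def scale_def)

lemma Zn_Rn: "v \<in> Zn n \<Longrightarrow> v \<in> Rn n"
  by (simp add: Zn_def)

lemma Zn_int: "v \<in> Zn n \<Longrightarrow> v i \<in> \<int>"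
  by (simp add: Zn_def)

lemma Zn_add: "u \<in> Zn n \<Longrightarrow> v \<in> Zn n \<Longrightarrow> u + v \<in> Zn n"
  and Zn_uminus: "u \<in> Zn n \<Longrightarrow> - u \<in> Zn n"
  and Zn_zero: "0 \<in> Zn n"
  by (simp_all add: Zn_def Rn_add Rn_uminus Rn_zero)

lemma act_Rn: "w \<in> signed_perms n \<Longrightarrow> v \<in> Rn n \<Longrightarrow> act w v \<in> Rn n"
  by (intro RnI) (auto simp: act_def sp_minus[OF sp_iv] Rn_minus Rn_outside sp_outside[OF sp_iv])

lemma act_Zn: "w \<in> signed_perms n \<Longrightarrow> v \<in> Zn n \<Longrightarrow> act w v \<in> Zn n"
  by (auto simp: Zn_def act_Rn) (simp add: act_def)

lemma act_add: "act w (u + v) = act w u + act w v"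
  and act_uminus: "act w (- u) = - act w u"
  and act_diff: "act w (u - v) = act w u - act w v"
  and act_zero: "act w 0 = 0"
  and act_scale: "act w (scale r u) = scale r (act w u)"
  by (auto simp: act_def scale_def fun_eq_iff)

lemma act_id: "act id v = v"
  by (simp add: act_def)

lemma act_comp: "bij w \<Longrightarrow> bij w' \<Longrightarrow> act (w \<circ> w') v = act w (act w' v)"
  by (simp add: act_def o_inv_distrib)

section \<open>Affine maps, the group law and conjugation\<close>

lemma aff_apply: "aff x v i = fst x i + v (iv (snd x) i)"
  by (simp add: aff_def act_def)

lemma grpD: "x \<in> grp n \<Longrightarrow> fst x \<in> Zn n" "x \<in> grp n \<Longrightarrow> snd x \<in> signed_perms n"
  by (auto simp: grp_def)

lemma grpI: "fst x \<in> Zn n \<Longrightarrow> snd x \<in> signed_perms n \<Longrightarrow> x \<in> grp n"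
  by (cases x) (auto simp: grp_def)

lemma grpA_grp: "x \<in> grpA n \<Longrightarrow> x \<in> grp n"
  by (auto simp: grp_def grpA_def sym_perms_signed)

lemma aff_Rn: "x \<in> grp n \<Longrightarrow> v \<in> Rn n \<Longrightarrow> aff x v \<in> Rn n"
  unfolding aff_def by (intro Rn_add act_Rn) (auto dest: grpD Zn_Rn)

lemma aff_gmul: "bij (snd x) \<Longrightarrow> bij (snd y) \<Longrightarrow> aff (gmul x y) v = aff x (aff y v)"
  by (simp add: aff_def gmul_def act_comp act_add add.assoc)

lemma grp_bij: "x \<in> grp n \<Longrightarrow> bij (snd x)"
  by (metis grpD(2) sp_bij)

lemma gmul_grp: "x \<in> grp n \<Longrightarrow> y \<in> grp n \<Longrightarrow> gmul x y \<in> grp n"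
  by (auto simp: gmul_def intro!: grpI Zn_add act_Zn sp_comp dest: grpD)

lemma ginv_grp: "x \<in> grp n \<Longrightarrow> ginv x \<in> grp n"
  by (auto simp: ginv_def intro!: grpI Zn_uminus act_Zn sp_iv dest: grpD)

lemma gmul_grpA: "x \<in> grpA n \<Longrightarrow> y \<in> grpA n \<Longrightarrow> gmul x y \<in> grpA n"
  by (auto simp: gmul_def grpA_def intro!: Zn_add act_Zn sym_perms_comp sym_perms_signed)

lemma ginv_grpA: "x \<in> grpA n \<Longrightarrow> ginv x \<in> grpA n"
  by (auto simp: ginv_def grpA_def intro!: Zn_uminus act_Zn sym_perms_iv sym_perms_signed)

lemma gmul_assoc: "bij (snd x) \<Longrightarrow> bij (snd y) \<Longrightarrow> gmul (gmul x y) z = gmul x (gmul y z)"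
  by (simp add: gmul_def act_comp act_add add.assoc comp_assoc)

lemma ginv_left: "bij (snd x) \<Longrightarrow> gmul (ginv x) x = (0, id)"
  by (simp add: gmul_def ginv_def bij_is_inj)

lemma ginv_right: "bij (snd x) \<Longrightarrow> gmul x (ginv x) = (0, id)"
  by (simp add: gmul_def ginv_def act_uminus act_comp[symmetric] bij_imp_bij_inv
      surj_iff[THEN iffD1, OF bij_is_surj] act_id)

lemma gmul_id: "gmul x (0, id) = x" "gmul (0, id) x = x"
  by (simp_all add: gmul_def act_zero act_id)

lemma ginv_bij: "bij (snd x) \<Longrightarrow> bij (snd (ginv x))"
  by (simp add: ginv_def bij_imp_bij_inv)

lemma gmul_bij: "bij (snd x) \<Longrightarrow> bij (snd y) \<Longrightarrow> bij (snd (gmul x y))"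
  by (simp add: gmul_def bij_comp)

lemma aff_ginv: "bij (snd x) \<Longrightarrow> aff (ginv x) (aff x v) = v"
  using aff_gmul[of "ginv x" x v, OF ginv_bij] ginv_left[of x] by (simp add: aff_def act_id)

lemma aff_ginv': "bij (snd x) \<Longrightarrow> aff x (aff (ginv x) v) = v"
  using aff_gmul[of x "ginv x" v] ginv_right[of x] ginv_bij[of x] by (simp add: aff_def act_id)

lemma gmul_inv_unique:
  assumes "bij (snd x)" "bij (snd y)" "gmul y x = (0, id)" shows "y = ginv x"
proof -
  have "y = gmul y (gmul x (ginv x))" using assms(1) by (simp add: ginv_right gmul_id)
  also have "\<dots> = gmul (gmul y x) (ginv x)" using gmul_assoc[OF assms(2,1)] by simp
  finally show ?thesis by (simp add: assms(3) gmul_id)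
qed

lemma ginv_gmul:
  assumes "bij (snd x)" "bij (snd y)" shows "ginv (gmul x y) = gmul (ginv y) (ginv x)"
proof (rule gmul_inv_unique[symmetric])
  have "gmul (gmul (ginv y) (ginv x)) (gmul x y) = gmul (ginv y) (gmul (gmul (ginv x) x) y)"
    using assms by (simp add: gmul_assoc ginv_bij gmul_bij)
  thus "gmul (gmul (ginv y) (ginv x)) (gmul x y) = (0, id)"
    using assms by (simp add: ginv_left gmul_id)
qed (use assms in \<open>auto intro: gmul_bij ginv_bij\<close>)

definition gconj :: "elt \<Rightarrow> elt \<Rightarrow> elt" where
  "gconj y x = gmul (gmul y x) (ginv y)"

lemma gconj_grp: "y \<in> grp n \<Longrightarrow> x \<in> grp n \<Longrightarrow> gconj y x \<in> grp n"
  unfolding gconj_def by (intro gmul_grp ginv_grp)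

lemma gconj_grpA: "y \<in> grpA n \<Longrightarrow> x \<in> grpA n \<Longrightarrow> gconj y x \<in> grpA n"
  unfolding gconj_def by (intro gmul_grpA ginv_grpA)

text \<open>Conjugation transports points together with their images. This is what allows
  \<open>x\<close> to stay fixed while the conjugator varies.\<close>

lemma aff_gconj:
  assumes "y \<in> grp n" "x \<in> grp n" shows "aff (gconj y x) (aff y v) = aff y (aff x v)"
  using assms by (simp add: gconj_def aff_gmul grp_bij gmul_bij ginv_bij aff_ginv)

lemma gconj_gmul:
  assumes "y \<in> grp n" "z \<in> grp n" "x \<in> grp n" shows "gconj (gmul y z) x = gconj y (gconj z x)"
  using assms unfolding gconj_def
  by (simp add: ginv_gmul gmul_assoc grp_bij gmul_bij ginv_bij)

lemma ginv_ginv: "bij (snd y) \<Longrightarrow> ginv (ginv y) = y"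
  by (rule gmul_inv_unique[symmetric]) (auto simp: ginv_right ginv_bij)

lemma ginv_gconj:
  assumes "y \<in> grp n" "x \<in> grp n" shows "ginv (gconj y x) = gconj y (ginv x)"
  using assms unfolding gconj_def
  by (simp add: ginv_gmul gmul_assoc grp_bij gmul_bij ginv_bij ginv_ginv)

lemma aff_gconj_inv:
  assumes "y \<in> grp n" "x \<in> grp n"
  shows "aff (ginv (gconj y x)) (aff y v) = aff y (aff (ginv x) v)"
  using aff_gconj[OF assms(1) ginv_grp[OF assms(2)]] ginv_gconj[OF assms] by simp

section \<open>Comparison with the semidirect products\<close>

lemma semidirect_mult: "monoid.mult (semidirect L W) x y = gmul x y"
  by (cases x; cases y) (simp add: semidirect_def gmul_def)

text \<open>\<open>m_inv\<close> is a definite description over the carrier, which is why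
  \<open>ginv x\<close> has to lie there as well.\<close>

lemma m_inv_semidirect:
  assumes x: "x \<in> L \<times> W" "ginv x \<in> L \<times> W" and W: "\<And>w. w \<in> W \<Longrightarrow> bij w"
  shows "m_inv (semidirect L W) x = ginv x"
proof -
  have bx: "bij (snd x)" using x(1) W by auto
  have eq: "carrier (semidirect L W) = L \<times> W" "one (semidirect L W) = (0, id)"
    by (simp_all add: semidirect_def)
  show ?thesis unfolding m_inv_def semidirect_mult eq
  proof (rule the_equality)
    show "ginv x \<in> L \<times> W \<and> gmul x (ginv x) = (0, id) \<and> gmul (ginv x) x = (0, id)"
      using x(2) bx by (simp add: ginv_left ginv_right)
  next
    fix y assume y: "y \<in> L \<times> W \<and> gmul x y = (0, id) \<and> gmul y x = (0, id)"
    show "y = ginv x" using gmul_inv_unique[of x y] bx y W by auto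
  qed
qed

lemma ext_group_mult: "monoid.mult (ext_group T n) x y = gmul x y"
  by (cases T) (simp_all add: semidirect_mult)

lemma grp_carrier:
  assumes "x \<in> grp n" "T = Type_A \<Longrightarrow> x \<in> grpA n"
  shows "x \<in> carrier (ext_group T n)"
  using assms by (cases T) (auto simp: grp_def grpA_def semidirect_def)

lemma m_inv_ext_group:
  assumes "x \<in> grp n" "T = Type_A \<Longrightarrow> x \<in> grpA n"
  shows "m_inv (ext_group T n) x = ginv x"
proof -
  have "ginv x \<in> grp n" "T = Type_A \<Longrightarrow> ginv x \<in> grpA n"
    using assms ginv_grp ginv_grpA by auto
  thus ?thesis using assms
    by (cases T) (auto intro!: m_inv_semidirect simp: grp_def grpA_def intro: sp_bij sym_perms_signed)
qed

section \<open>Roots\<close>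

text \<open>An interior point common to the alcoves of all four types: its coordinates n/(2n+2) >
  ... > 1/(2n+2) lie strictly between 0 and 1/2. The case distinction on the sign extends them
  oddly.\<close>

definition delta :: "nat \<Rightarrow> vec" where
  "delta n = (\<lambda>i. if i \<in> idx n then of_int ((if 0 < i then int n + 1 else - (int n + 1)) - i) / (2 * real n + 2)
                  else 0)"

lemma delta_Rn: "delta n \<in> Rn n"
proof (intro RnI)
  fix i show "delta n (- i) = - delta n i"
    using idx_nonzero[of i n] by (auto simp: delta_def field_simps)
qed (simp add: delta_def)

lemma delta_pos: "i \<in> {1..int n} \<Longrightarrow> delta n i = (real n + 1 - of_int i) / (2 * real n + 2)"
  by (simp add: delta_def idx_def)

lemma delta_bounds: "i \<in> {1..int n} \<Longrightarrow> 0 < delta n i" "i \<in> {1..int n} \<Longrightarrow> delta n i < 1/2"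
  by (auto simp: delta_pos field_simps)

lemma delta_mono: "i \<in> {1..int n} \<Longrightarrow> j \<in> {1..int n} \<Longrightarrow> i < j \<Longrightarrow> delta n j < delta n i"
  by (simp add: delta_pos divide_strict_right_mono)

lemma sum_idx: "(\<Sum>i\<in>idx n. f i) = (\<Sum>i=1..int n. f i + f (- i :: int) :: real)"
proof -
  have e: "idx n = {1..int n} \<union> uminus ` {1..int n}" 
    by (auto simp: idx_def abs_if image_iff split: if_splits intro: bexI[of _ "- _"])
  have "(\<Sum>i\<in>idx n. f i) = (\<Sum>i=1..int n. f i) + (\<Sum>i\<in>uminus ` {1..int n}. f i)"
    unfolding e by (rule sum.union_disjoint) auto
  also have "(\<Sum>i\<in>uminus ` {1..int n}. f i) = (\<Sum>i=1..int n. f (- i))"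
    by (subst sum.reindex) (auto simp: inj_on_def)
  finally show ?thesis by (simp add: sum.distrib)
qed

text \<open>Summed over indices of both signs, the form is visibly invariant under signed
  permutations, which only reorder the terms.\<close>

lemma ip_idx:
  assumes "u \<in> Rn n" "v \<in> Rn n" shows "2 * ip n u v = (\<Sum>i\<in>idx n. u i * v i)"
  by (simp add: sum_idx ip_def Rn_minus[OF assms(1)] Rn_minus[OF assms(2)] sum_distrib_left)

lemma ip_act:
  assumes "w \<in> signed_perms n" "u \<in> Rn n" "v \<in> Rn n"
  shows "ip n (act w u) (act w v) = ip n u v"
proof -
  have "(\<Sum>i\<in>idx n. act w u i * act w v i) = (\<Sum>i\<in>idx n. u i * v i)"
    unfolding act_def
    by (rule sum.reindex_bij_betw[OF permutes_imp_bij[OF sp_permutes[OF sp_iv[OF assms(1)]]],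
        of "\<lambda>i. u i * v i"])
  thus ?thesis using ip_idx[of "act w u" n "act w v"] ip_idx[of u n v] assms act_Rn by simp
qed

lemma ip_act_left:
  assumes "w \<in> signed_perms n" "u \<in> Rn n" "v \<in> Rn n"
  shows "ip n (act w u) v = ip n u (act (iv w) v)"
proof -
  have "act w (act (iv w) v) = v"
    using assms(1) by (simp add: act_def fun_eq_iff sp_iv_iv sp_iv_eq sp_eq_iv)
  thus ?thesis using ip_act[OF assms(1,2) act_Rn[OF sp_iv[OF assms(1)] assms(3)]] by simp
qed

lemma ip_add_left: "ip n (u + v) a = ip n u a + ip n v a"
  and ip_add_right: "ip n a (u + v) = ip n a u + ip n a v"
  and ip_diff_left: "ip n (u - v) a = ip n u a - ip n v a"
  and ip_diff_right: "ip n a (u - v) = ip n a u - ip n a v"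
  and ip_uminus_left: "ip n (- u) a = - ip n u a"
  and ip_uminus_right: "ip n a (- u) = - ip n a u"
  and ip_scale_left: "ip n (scale r u) a = r * ip n u a"
  and ip_scale_right: "ip n a (scale r u) = r * ip n a u"
  by (simp_all add: ip_def scale_def distrib_left distrib_right sum.distrib left_diff_distrib
      right_diff_distrib sum_subtractf sum_negf sum_distrib_left mult.left_commute mult.assoc)

lemma basis_minus: "i \<noteq> 0 \<Longrightarrow> basis_vec (- i) = - basis_vec i"
  by (auto simp: basis_vec_def fun_eq_iff)

lemma basis_Rn: "i \<in> idx n \<Longrightarrow> basis_vec i \<in> Rn n"
  using idx_nonzero[of i n] by (intro RnI) (auto simp: basis_vec_def)

lemma basis_Zn: "i \<in> idx n \<Longrightarrow> basis_vec i \<in> Zn n"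
  by (simp add: Zn_def basis_Rn) (simp add: basis_vec_def)

lemma ip_basis_pos: "i \<in> {1..int n} \<Longrightarrow> ip n v (basis_vec i) = v i"
proof -
  assume i: "i \<in> {1..int n}"
  have "ip n v (basis_vec i) = (\<Sum>j=1..int n. if j = i then v j else 0)"
    unfolding ip_def using i by (intro sum.cong) (auto simp: basis_vec_def)
  thus ?thesis using i by simp
qed

lemma act_basis: "w \<in> signed_perms n \<Longrightarrow> act w (basis_vec a) = basis_vec (w a)"
proof
  fix i assume w: "w \<in> signed_perms n"
  have "iv w i = a \<longleftrightarrow> i = w a" "iv w i = - a \<longleftrightarrow> i = - w a"
    using sp_iv_eq[OF w] sp_eq_iv[OF w] sp_minus[OF w] by metis+
  thus "act w (basis_vec a) i = basis_vec (w a) i" by (simp add: act_def basis_vec_def)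
qed

section \<open>Root systems of the four types\<close>

definition roots :: "classical_type \<Rightarrow> nat \<Rightarrow> vec set" where
  "roots T n = pos_roots T n \<union> neg_roots T n"

text \<open>As \<open>basis_vec (- i) = - basis_vec i\<close>, sums over signed indices cover all
  sign patterns of e_i and e_j at once; these are the roots of type D.\<close>

definition pair_roots :: "nat \<Rightarrow> vec set" where
  "pair_roots n = {basis_vec a + basis_vec c | a c. a \<in> idx n \<and> c \<in> idx n \<and> \<bar>a\<bar> \<noteq> \<bar>c\<bar>}"

lemma pair_rootsI: "a \<in> idx n \<Longrightarrow> c \<in> idx n \<Longrightarrow> \<bar>a\<bar> \<noteq> \<bar>c\<bar> \<Longrightarrow> basis_vec a + basis_vec c \<in> pair_roots n"
  by (auto simp: pair_roots_def)

lemma roots_uminus: "\<alpha> \<in> roots T n \<longleftrightarrow> - \<alpha> \<in> roots T n"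
  by (auto simp: roots_def neg_roots_def image_iff) (metis minus_equation_iff)+

lemma pos_roots_D_subset: "pos_roots Type_D n \<subseteq> pair_roots n"
proof -
  have "basis_vec i - basis_vec j \<in> pair_roots n" if "1 \<le> i" "i < j" "j \<le> int n" for i j
    using pair_rootsI[of i n "- j"] that by (simp add: idx_def basis_minus)
  moreover have "basis_vec i + basis_vec j \<in> pair_roots n" if "1 \<le> i" "i < j" "j \<le> int n" for i j
    using that by (intro pair_rootsI) (simp_all add: idx_def)
  ultimately show ?thesis by auto
qed

lemma pair_roots_uminus: "\<alpha> \<in> pair_roots n \<Longrightarrow> - \<alpha> \<in> pair_roots n"
proof -
  assume "\<alpha> \<in> pair_roots n"
  then obtain a c where ac: "a \<in> idx n" "c \<in> idx n" "\<bar>a\<bar> \<noteq> \<bar>c\<bar>" "\<alpha> = basis_vec a + basis_vec c"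
    by (auto simp: pair_roots_def)
  have "basis_vec (- a) + basis_vec (- c) \<in> pair_roots n" using ac by (intro pair_rootsI) auto
  thus ?thesis using ac idx_nonzero[OF ac(1)] idx_nonzero[OF ac(2)] by (simp add: basis_minus)
qed

lemma pair_roots_subset: "pair_roots n \<subseteq> roots Type_D n"
proof
  fix \<alpha> assume "\<alpha> \<in> pair_roots n"
  then obtain a c where "a \<in> idx n" "c \<in> idx n" "\<bar>a\<bar> < \<bar>c\<bar>" "\<alpha> = basis_vec a + basis_vec c"
    unfolding pair_roots_def by (auto, metis add.commute linorder_neqE)
  note ac = this
  have pos: "basis_vec a' + basis_vec c' \<in> pos_roots Type_D n"
    if "1 \<le> a'" "c' \<in> idx n" "a' < \<bar>c'\<bar>" for a' c'
    using that(2)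
  proof (cases rule: idx_cases)
    case 1 thus ?thesis using that by auto
  next
    case 2 
    have "basis_vec a' + basis_vec c' = basis_vec a' - basis_vec (- c')"
      using that by (simp add: basis_minus idx_nonzero)
    thus ?thesis using 2 that by fastforce
  qed
  show "\<alpha> \<in> roots Type_D n"
    using ac(1)
  proof (cases rule: idx_cases)
    case 1 thus ?thesis using pos[of a c] ac by (simp add: roots_def)
  next
    case 2
    have "basis_vec (- a) + basis_vec (- c) \<in> pos_roots Type_D n" using 2 ac by (intro pos) auto
    hence "- \<alpha> \<in> roots Type_D n"
      using ac idx_nonzero[OF ac(1)] idx_nonzero[OF ac(2)] by (simp add: basis_minus roots_def)
    thus ?thesis using roots_uminus by blast
  qed
qed

lemma roots_D: "roots Type_D n = pair_roots n"
proof
  show "roots Type_D n \<subseteq> pair_roots n"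
    using pos_roots_D_subset[of n] pair_roots_uminus[of _ n] by (auto simp: roots_def neg_roots_def simp del: pos_roots.simps)
qed (rule pair_roots_subset)

lemma basis_image: "basis_vec ` idx n = {basis_vec i | i. 1 \<le> i \<and> i \<le> int n} \<union> uminus ` {basis_vec i | i. 1 \<le> i \<and> i \<le> int n}"
  (is "_ = ?P \<union> uminus ` ?P")
proof (intro equalityI subsetI)
  fix v assume "v \<in> basis_vec ` idx n"
  then obtain i where i: "i \<in> idx n" "v = basis_vec i" by auto
  show "v \<in> ?P \<union> uminus ` ?P" using i(1)
  proof (cases rule: idx_cases)
    case 2
    hence "v = - basis_vec (- i)" using i idx_nonzero[OF i(1)] by (simp add: basis_minus)
    thus ?thesis using 2 by fastforce
  qed (use i in auto)
next
  fix v assume "v \<in> ?P \<union> uminus ` ?P"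
  then obtain i where i: "1 \<le> i" "i \<le> int n" "v = basis_vec i \<or> v = basis_vec (- i)"
    by (auto simp: basis_minus)
  hence "i \<in> idx n" by (simp add: idx_def)
  thus "v \<in> basis_vec ` idx n" using i(3) by fastforce
qed

lemma roots_B: "roots Type_B n = pair_roots n \<union> basis_vec ` idx n"
proof -
  have "pos_roots Type_B n = pos_roots Type_D n \<union> {basis_vec i | i. 1 \<le> i \<and> i \<le> int n}" by auto
  hence "roots Type_B n = roots Type_D n \<union> basis_vec ` idx n"
    unfolding basis_image roots_def neg_roots_def by (simp only: image_Un) blast
  thus ?thesis by (simp add: roots_D)
qed

lemma scale_uminus: "scale r (- v) = - scale r v"
  by (simp add: scale_def fun_eq_iff)

lemma roots_C: "roots Type_C n = pair_roots n \<union> scale 2 ` basis_vec ` idx n"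
proof -
  have "pos_roots Type_C n = pos_roots Type_D n \<union> scale 2 ` {basis_vec i | i. 1 \<le> i \<and> i \<le> int n}" by auto
  moreover have "uminus ` scale 2 ` X = scale 2 ` uminus ` X" for X
    by (simp add: image_image scale_uminus)
  ultimately have "roots Type_C n = roots Type_D n \<union> scale 2 ` basis_vec ` idx n"
    unfolding basis_image roots_def neg_roots_def by (simp only: image_Un) blast
  thus ?thesis by (simp add: roots_D)
qed

lemma roots_A: "roots Type_A n = {basis_vec i - basis_vec j | i j. i \<in> {1..int n} \<and> j \<in> {1..int n} \<and> i \<noteq> j}"
  (is "_ = ?R")
proof (intro equalityI subsetI)
  fix v assume "v \<in> ?R"
  then obtain i j where ij: "i \<in> {1..int n}" "j \<in> {1..int n}" "i \<noteq> j" "v = basis_vec i - basis_vec j" by auto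
  show "v \<in> roots Type_A n"
  proof (cases "i < j")
    case True thus ?thesis using ij by (auto simp: roots_def)
  next
    case False
    have "- v = basis_vec j - basis_vec i" using ij by simp
    moreover have "j < i" using False ij by simp
    ultimately have "- v \<in> pos_roots Type_A n" using ij unfolding pos_roots.simps by force
    hence "- v \<in> roots Type_A n" by (simp add: roots_def del: pos_roots.simps)
    thus ?thesis using roots_uminus[of v] by blast
  qed
next
  fix v assume "v \<in> roots Type_A n"
  then obtain i j where ij: "1 \<le> i" "i < j" "j \<le> int n"
      "v = basis_vec i - basis_vec j \<or> v = basis_vec j - basis_vec i"
    by (auto simp: roots_def neg_roots_def)
  thus "v \<in> ?R" by fastforce
qed

lemma pair_roots_Rn: "\<alpha> \<in> pair_roots n \<Longrightarrow> \<alpha> \<in> Rn n"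
  by (auto simp: pair_roots_def intro!: Rn_add basis_Rn)

lemma roots_Rn: "\<alpha> \<in> roots T n \<Longrightarrow> \<alpha> \<in> Rn n"
proof (cases T)
  case Type_A
  moreover assume "\<alpha> \<in> roots T n"
  ultimately show ?thesis by (auto simp: roots_A intro!: Rn_diff basis_Rn idxI)
qed (auto simp: roots_B roots_C roots_D intro: pair_roots_Rn basis_Rn Rn_scale)

lemma pos_roots_Rn: "\<alpha> \<in> pos_roots T n \<Longrightarrow> \<alpha> \<in> Rn n"
  using roots_Rn by (auto simp: roots_def)

lemma roots_int:
  assumes "\<alpha> \<in> roots T n" shows "\<alpha> i \<in> \<int>"
proof -
  have b: "basis_vec a i \<in> \<int>" for a by (simp add: basis_vec_def)
  show ?thesis using assms b
    by (cases T) (auto simp: roots_A roots_B roots_C roots_D pair_roots_def scale_def)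
qed

lemma ip_int: "u \<in> Zn n \<Longrightarrow> \<alpha> \<in> roots T n \<Longrightarrow> ip n u \<alpha> \<in> \<int>"
  unfolding ip_def by (rule Ints_sum) (simp add: Zn_int roots_int)

lemma finite_pair_roots: "finite (pair_roots n)"
proof -
  have "pair_roots n \<subseteq> (\<lambda>(a, c). basis_vec a + basis_vec c) ` (idx n \<times> idx n)" by (auto simp: pair_roots_def)
  thus ?thesis by (rule finite_subset) simp
qed

lemma finite_roots: "finite (roots T n)"
proof (cases T)
  case Type_A
  have "roots T n \<subseteq> (\<lambda>(a, c). basis_vec a - basis_vec c) ` ({1..int n} \<times> {1..int n})"
    using Type_A by (auto simp: roots_A)
  thus ?thesis by (rule finite_subset) simp
qed (simp_all add: roots_B roots_C roots_D finite_pair_roots)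

lemma finite_pos_roots: "finite (pos_roots T n)"
  using finite_roots[of T n] by (simp add: roots_def)

lemma act_roots:
  assumes "w \<in> signed_perms n" "T = Type_A \<Longrightarrow> w \<in> sym_perms n" "\<alpha> \<in> roots T n"
  shows "act w \<alpha> \<in> roots T n"
proof -
  have s: "act w v \<in> pair_roots n" if v: "v \<in> pair_roots n" for v
  proof -
    obtain a c where ac: "a \<in> idx n" "c \<in> idx n" "\<bar>a\<bar> \<noteq> \<bar>c\<bar>" "v = basis_vec a + basis_vec c"
      using v by (auto simp: pair_roots_def)
    have "\<bar>w a\<bar> \<noteq> \<bar>w c\<bar>" using ac(3) sp_iv_eq[OF assms(1)] sp_minus[OF assms(1)]
      by (metis abs_eq_iff)
    thus ?thesis using ac by (auto simp: act_add act_basis[OF assms(1)] sp_idx[OF assms(1)] intro!: pair_rootsI)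
  qed
  show ?thesis
  proof (cases T)
    case Type_A
    then obtain i j where ij: "i \<in> {1..int n}" "j \<in> {1..int n}" "i \<noteq> j" "\<alpha> = basis_vec i - basis_vec j"
      using assms(3)[unfolded Type_A roots_A] by blast
    have "w i \<noteq> w j" using ij(3) sp_iv_eq[OF assms(1)] by metis
    moreover have "w i \<in> {1..int n}" "w j \<in> {1..int n}"
      using ij sym_perms_pos[OF assms(2)[OF Type_A]] by auto
    ultimately show ?thesis unfolding Type_A roots_A ij(4) by (force simp: act_diff act_basis[OF assms(1)])
  qed (use assms s in \<open>auto simp: roots_B roots_C roots_D act_scale act_basis sp_idx\<close>)
qed

lemma pos_roots_cases:
  assumes "\<alpha> \<in> pos_roots T n"
  obtains (diff) i j where "1 \<le> i" "i < j" "j \<le> int n" "\<alpha> = basis_vec i - basis_vec j"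
  | (sum) i j where "T \<noteq> Type_A" "1 \<le> i" "i < j" "j \<le> int n" "\<alpha> = basis_vec i + basis_vec j"
  | (short) i where "T = Type_B" "1 \<le> i" "i \<le> int n" "\<alpha> = basis_vec i"
  | (long) i where "T = Type_C" "1 \<le> i" "i \<le> int n" "\<alpha> = scale 2 (basis_vec i)"
  using assms by (cases T) auto

lemma delta_pos_roots: 
  assumes "\<alpha> \<in> pos_roots T n" shows "0 < ip n (delta n) \<alpha> \<and> ip n (delta n) \<alpha> < 1"
  using assms
proof (cases rule: pos_roots_cases)
  case (diff i j)
  thus ?thesis using delta_bounds[of i n] delta_bounds[of j n] delta_mono[of i n j]
    by (simp add: ip_diff_right ip_basis_pos)
next
  case (sum i j)
  thus ?thesis using delta_bounds[of i n] delta_bounds[of j n]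
    by (simp add: ip_add_right ip_basis_pos)
next
  case (short i)
  thus ?thesis using delta_bounds[of i n] by (simp add: ip_basis_pos)
next
  case (long i)
  thus ?thesis using delta_bounds[of i n] by (simp add: ip_scale_right ip_basis_pos)
qed

text \<open>A single interior point of the alcove decides positivity, so that signs of roots become
  inequalities.\<close>

lemma pos_roots_iff: "\<alpha> \<in> pos_roots T n \<longleftrightarrow> \<alpha> \<in> roots T n \<and> 0 < ip n (delta n) \<alpha>"
  using delta_pos_roots[of _ T n] by (auto simp: roots_def neg_roots_def ip_uminus_right, force)

lemma neg_roots_iff: "\<alpha> \<in> neg_roots T n \<longleftrightarrow> \<alpha> \<in> roots T n \<and> ip n (delta n) \<alpha> < 0"
proof -
  have "\<alpha> \<in> neg_roots T n \<longleftrightarrow> - \<alpha> \<in> pos_roots T n"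
    by (auto simp: neg_roots_def image_iff) (metis minus_minus)
  thus ?thesis by (simp add: pos_roots_iff roots_uminus[of \<alpha>] ip_uminus_right)
qed

lemma roots_cases: "\<alpha> \<in> roots T n \<Longrightarrow> \<alpha> \<in> pos_roots T n \<or> - \<alpha> \<in> pos_roots T n"
  by (auto simp: roots_def neg_roots_def)

section \<open>The length function\<close>

text \<open>For \<open>q\<close> off all walls this counts the hyperplanes \<alpha> = k that
  separate \<open>q\<close> from the base alcove, on which 0 < \<alpha> < 1.\<close>

definition flen :: "classical_type \<Rightarrow> nat \<Rightarrow> vec \<Rightarrow> real" where
  "flen T n q = (\<Sum>\<alpha> \<in> pos_roots T n. \<bar>of_int \<lfloor>ip n q \<alpha>\<rfloor>\<bar>)"

definition inG :: "classical_type \<Rightarrow> nat \<Rightarrow> elt \<Rightarrow> bool" where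
  "inG T n x \<longleftrightarrow> x \<in> grp n \<and> (T = Type_A \<longrightarrow> x \<in> grpA n)"

lemma inG_grp: "inG T n x \<Longrightarrow> x \<in> grp n"
  by (simp add: inG_def)

lemma inG_gmul: "inG T n x \<Longrightarrow> inG T n y \<Longrightarrow> inG T n (gmul x y)"
  by (simp add: inG_def gmul_grp gmul_grpA)

lemma inG_ginv: "inG T n x \<Longrightarrow> inG T n (ginv x)"
  by (simp add: inG_def ginv_grp ginv_grpA)

lemma inG_act_roots: "inG T n x \<Longrightarrow> \<alpha> \<in> roots T n \<Longrightarrow> act (iv (snd x)) \<alpha> \<in> roots T n"
  by (rule act_roots) (auto simp: inG_def grp_def grpA_def sp_iv sym_perms_iv)

lemma ip_aff_delta:
  assumes "inG T n x" "\<alpha> \<in> roots T n"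
  shows "ip n (aff x (delta n)) \<alpha> = ip n (fst x) \<alpha> + ip n (delta n) (act (iv (snd x)) \<alpha>)"
  using assms ip_act_left[of "snd x" n "delta n" \<alpha>]
  by (simp add: aff_def ip_add_left delta_Rn roots_Rn grpD(2) inG_grp)

lemma ip_fst_int: "inG T n x \<Longrightarrow> \<alpha> \<in> roots T n \<Longrightarrow> ip n (fst x) \<alpha> \<in> \<int>"
  by (meson ip_int grpD(1) inG_grp)

lemma floor_add_Ints: "(k::real) \<in> \<int> \<Longrightarrow> of_int \<lfloor>k + r\<rfloor> = k + of_int \<lfloor>r\<rfloor>"
  by (elim Ints_cases) (simp add: add.commute)

lemma floor_unit: "0 < (r::real) \<Longrightarrow> r < 1 \<Longrightarrow> \<lfloor>r\<rfloor> = 0" "0 < (r::real) \<Longrightarrow> r < 1 \<Longrightarrow> \<lfloor>- r\<rfloor> = - 1"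
  by linarith+

text \<open>The integer \<open>ip n (fst x) \<alpha>\<close> is displaced by the value of w^-1
  \<alpha> at \<open>delta n\<close>, which lies in (0, 1) or in (-1, 0). The second case is the
  origin of the -1 in the length formula.\<close>

lemma floor_aff_delta:
  assumes x: "inG T n x" and a: "\<alpha> \<in> roots T n"
  shows "act (iv (snd x)) \<alpha> \<in> pos_roots T n \<Longrightarrow> of_int \<lfloor>ip n (aff x (delta n)) \<alpha>\<rfloor> = ip n (fst x) \<alpha>"
    and "- act (iv (snd x)) \<alpha> \<in> pos_roots T n \<Longrightarrow> of_int \<lfloor>ip n (aff x (delta n)) \<alpha>\<rfloor> = ip n (fst x) \<alpha> - 1"
proof -
  let ?r = "ip n (delta n) (act (iv (snd x)) \<alpha>)"
  have *: "of_int \<lfloor>ip n (aff x (delta n)) \<alpha>\<rfloor> = ip n (fst x) \<alpha> + of_int \<lfloor>?r\<rfloor>"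
    unfolding ip_aff_delta[OF assms] by (rule floor_add_Ints[OF ip_fst_int[OF assms]])
  show "of_int \<lfloor>ip n (aff x (delta n)) \<alpha>\<rfloor> = ip n (fst x) \<alpha>" if "act (iv (snd x)) \<alpha> \<in> pos_roots T n"
    using * floor_unit(1)[of ?r] delta_pos_roots[OF that] by simp
  show "of_int \<lfloor>ip n (aff x (delta n)) \<alpha>\<rfloor> = ip n (fst x) \<alpha> - 1" if "- act (iv (snd x)) \<alpha> \<in> pos_roots T n"
    using * floor_unit(2)[of "- ?r"] delta_pos_roots[OF that] by (simp add: ip_uminus_right)
qed

lemma aff_delta_notint:
  assumes "inG T n x" "\<alpha> \<in> pos_roots T n" shows "ip n (aff x (delta n)) \<alpha> \<notin> \<int>"
proof
  assume i: "ip n (aff x (delta n)) \<alpha> \<in> \<int>"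
  have a: "\<alpha> \<in> roots T n" using assms(2) by (simp add: roots_def)
  let ?b = "act (iv (snd x)) \<alpha>"
  have r: "ip n (delta n) ?b \<in> \<int>"
    using i ip_fst_int[OF assms(1) a] unfolding ip_aff_delta[OF assms(1) a]
    by (metis Ints_diff add_diff_cancel_left')
  have "0 < ip n (delta n) ?b \<and> ip n (delta n) ?b < 1 \<or> 0 < - ip n (delta n) ?b \<and> - ip n (delta n) ?b < 1"
    using roots_cases[OF inG_act_roots[OF assms(1) a]] delta_pos_roots[of ?b T n]
      delta_pos_roots[of "- ?b" T n] by (auto simp: ip_uminus_right)
  thus False using r by (auto elim!: Ints_cases)
qed

lemma len_flen:
  assumes "inG T n x" shows "len T n x = flen T n (aff x (delta n))"
proof -
  obtain \<chi> w where x: "x = (\<chi>, w)" by (cases x)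
  let ?P = "pos_roots T n"
  let ?A = "{\<alpha> \<in> ?P. act (iv w) \<alpha> \<in> ?P}" and ?B = "{\<alpha> \<in> ?P. act (iv w) \<alpha> \<in> neg_roots T n}"
  have r: "\<alpha> \<in> ?P \<Longrightarrow> \<alpha> \<in> roots T n" for \<alpha> by (simp add: roots_def)
  have neg: "v \<in> neg_roots T n \<longleftrightarrow> - v \<in> ?P" for v
    by (auto simp: neg_roots_def image_iff) (metis minus_minus)
  have un: "?P = ?A \<union> ?B"
    using inG_act_roots[OF assms r] by (auto simp: x roots_def)
  have dis: "?A \<inter> ?B = {}" by (auto simp: pos_roots_iff neg_roots_iff)
  have "flen T n (aff x (delta n)) = (\<Sum>\<alpha>\<in>?A. \<bar>of_int \<lfloor>ip n (aff x (delta n)) \<alpha>\<rfloor>\<bar>)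
      + (\<Sum>\<alpha>\<in>?B. \<bar>of_int \<lfloor>ip n (aff x (delta n)) \<alpha>\<rfloor>\<bar>)"
    unfolding flen_def by (subst un, rule sum.union_disjoint) (use dis in \<open>auto simp: finite_pos_roots\<close>)
  also have "(\<Sum>\<alpha>\<in>?A. \<bar>of_int \<lfloor>ip n (aff x (delta n)) \<alpha>\<rfloor>\<bar>) = (\<Sum>\<alpha>\<in>?A. \<bar>ip n \<chi> \<alpha>\<bar>)"
    using floor_aff_delta(1)[OF assms r] by (intro sum.cong refl) (simp add: x)
  also have "(\<Sum>\<alpha>\<in>?B. \<bar>of_int \<lfloor>ip n (aff x (delta n)) \<alpha>\<rfloor>\<bar>) = (\<Sum>\<alpha>\<in>?B. \<bar>ip n \<chi> \<alpha> - 1\<bar>)"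
    using floor_aff_delta(2)[OF assms r] by (intro sum.cong refl) (simp add: x neg)
  finally show ?thesis by (simp add: len_def x)
qed

text \<open>Up to sign, w^-1 permutes the positive roots, and corresponding terms of the two sums
  have the same modulus.\<close>

lemma flen_ginv:
  assumes x: "inG T n x" shows "flen T n (aff (ginv x) (delta n)) = flen T n (aff x (delta n))"
proof -
  obtain \<chi> w where xw: "x = (\<chi>, w)" by (cases x)
  have w: "w \<in> signed_perms n" and \<chi>: "\<chi> \<in> Rn n" using x by (auto simp: xw inG_def grp_def Zn_Rn)
  let ?P = "pos_roots T n"
  let ?b = "\<lambda>\<alpha>. act (iv w) \<alpha>"
  let ?\<phi> = "\<lambda>\<alpha>. if ?b \<alpha> \<in> ?P then ?b \<alpha> else - ?b \<alpha>"
  have r: "\<alpha> \<in> ?P \<Longrightarrow> \<alpha> \<in> roots T n" for \<alpha> by (simp add: roots_def)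
  have \<phi>P: "?\<phi> \<alpha> \<in> ?P" if "\<alpha> \<in> ?P" for \<alpha>
    using roots_cases[OF inG_act_roots[OF x r[OF that]]] by (auto simp: xw)
  have wb: "act w (?b \<alpha>) = \<alpha>" for \<alpha>
    using w by (simp add: act_def fun_eq_iff sp_iv_iv sp_iv_eq sp_eq_iv)
  have bij: "bij_betw ?\<phi> ?P ?P"
  proof -
    have "inj_on ?\<phi> ?P"
    proof (rule inj_onI)
      fix \<alpha> \<beta> assume ab: "\<alpha> \<in> ?P" "\<beta> \<in> ?P" "?\<phi> \<alpha> = ?\<phi> \<beta>"
      have "?\<phi> \<alpha> = ?b \<alpha> \<or> ?\<phi> \<alpha> = - ?b \<alpha>" "?\<phi> \<beta> = ?b \<beta> \<or> ?\<phi> \<beta> = - ?b \<beta>" by auto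
      hence "?b \<alpha> = ?b \<beta> \<or> ?b \<alpha> = - ?b \<beta>" unfolding ab(3) by (elim disjE) simp_all
      hence "act w (?b \<alpha>) = act w (?b \<beta>) \<or> act w (?b \<alpha>) = act w (- ?b \<beta>)"
        by (rule disj_forward) (erule arg_cong)+
      hence "\<alpha> = \<beta> \<or> \<alpha> = - \<beta>" unfolding act_uminus wb .
      moreover have "\<alpha> \<noteq> - \<beta>" using ab(1,2) by (auto simp: pos_roots_iff ip_uminus_right)
      ultimately show "\<alpha> = \<beta>" by simp
    qed
    moreover have "?\<phi> ` ?P \<subseteq> ?P" by (rule image_subsetI) (rule \<phi>P)
    ultimately show ?thesis using endo_inj_surj[OF finite_pos_roots] unfolding bij_betw_def by blast
  qed
  have iw: "iv w \<in> signed_perms n" using w by (rule sp_iv)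
  have eq: "\<bar>of_int \<lfloor>ip n (aff (ginv x) (delta n)) (?\<phi> \<alpha>)\<rfloor>\<bar> = \<bar>of_int \<lfloor>ip n (aff x (delta n)) \<alpha>\<rfloor> :: real\<bar>"
    if a: "\<alpha> \<in> ?P" for \<alpha>
  proof -
    have aR: "\<alpha> \<in> Rn n" using a by (rule pos_roots_Rn)
    have t: "ip n \<chi> \<alpha> \<in> \<int>" using ip_fst_int[OF x r[OF a]] by (simp add: xw)
    have i: "ip n (aff (ginv x) (delta n)) (?b \<alpha>) = - ip n \<chi> \<alpha> + ip n (delta n) \<alpha>"
      by (simp add: aff_def ginv_def xw ip_add_left ip_diff_left ip_uminus_left ip_act[OF iw] \<chi> aR delta_Rn)
    have d: "0 < ip n (delta n) \<alpha>" "ip n (delta n) \<alpha> < 1" using delta_pos_roots[OF a] by auto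
    show ?thesis
    proof (cases "?b \<alpha> \<in> ?P")
      case True
      have "of_int \<lfloor>- ip n \<chi> \<alpha> + ip n (delta n) \<alpha>\<rfloor> = - ip n \<chi> \<alpha>"
        using floor_add_Ints[of "- ip n \<chi> \<alpha>"] t floor_unit(1)[OF d] by simp
      thus ?thesis using floor_aff_delta(1)[OF x r[OF a]] True i by (simp add: xw)
    next
      case False
      hence m: "- ?b \<alpha> \<in> ?P" using \<phi>P[OF a] by simp
      have "of_int \<lfloor>ip n \<chi> \<alpha> + (- ip n (delta n) \<alpha>)\<rfloor> = ip n \<chi> \<alpha> - 1"
        using floor_add_Ints[OF t, of "- ip n (delta n) \<alpha>"] floor_unit(2)[OF d] by simp
      thus ?thesis using floor_aff_delta(2)[OF x r[OF a]] False m i by (simp add: xw ip_uminus_right)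
    qed
  qed
  have "flen T n (aff x (delta n)) = (\<Sum>\<alpha>\<in>?P. \<bar>of_int \<lfloor>ip n (aff (ginv x) (delta n)) (?\<phi> \<alpha>)\<rfloor>\<bar>)"
    unfolding flen_def using eq by (intro sum.cong refl) simp
  also have "\<dots> = flen T n (aff (ginv x) (delta n))"
    unfolding flen_def by (rule sum.reindex_bij_betw[OF bij])
  finally show ?thesis by simp
qed

text \<open>\<open>s\<close> changes a single term of \<^const>\<open>flen\<close>, the one of the wall it reflects in, and
  \<open>good q\<close> says that \<open>q\<close> lies beyond this wall.\<close>

definition wall_refl :: "classical_type \<Rightarrow> nat \<Rightarrow> elt \<Rightarrow> (vec \<Rightarrow> bool) \<Rightarrow> bool" where
  "wall_refl T n s good \<longleftrightarrow> inG T n s \<and> ginv s = s \<and>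
     (\<forall>q \<in> Rn n. (\<forall>\<alpha> \<in> pos_roots T n. ip n q \<alpha> \<notin> \<int>) \<longrightarrow>
        flen T n (aff s q) \<le> flen T n q + 1 \<and> (good q \<longrightarrow> flen T n (aff s q) = flen T n q - 1))"

text \<open>\<open>s\<close> reflects in the wall \<rho> = c. Every other positive root \<alpha> is
  matched with \<phi> \<alpha>, possibly with its value r replaced by 1 - r, as happens for an
  affine reflection; for nonintegral r the floors of r and 1 - r are opposite. So only the term of
  \<rho> can change.\<close>

lemma wall_reflI:
  assumes s: "inG T n s" "ginv s = s" and \<rho>: "\<rho> \<in> pos_roots T n"
    and \<phi>: "\<And>\<alpha>. \<alpha> \<in> pos_roots T n \<Longrightarrow> \<alpha> \<noteq> \<rho> \<Longrightarrow> \<phi> \<alpha> \<in> pos_roots T n \<and> \<phi> \<alpha> \<noteq> \<rho>"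
    and inj: "inj_on \<phi> (pos_roots T n - {\<rho>})"
    and ip\<phi>: "\<And>q \<alpha>. q \<in> Rn n \<Longrightarrow> \<alpha> \<in> pos_roots T n \<Longrightarrow> \<alpha> \<noteq> \<rho> \<Longrightarrow>
        ip n (aff s q) \<alpha> = ip n q (\<phi> \<alpha>) \<or> ip n (aff s q) \<alpha> = 1 - ip n q (\<phi> \<alpha>)"
    and ip0: "\<And>q. q \<in> Rn n \<Longrightarrow> ip n (aff s q) \<rho> = 2 * of_int c - ip n q \<rho>"
    and c: "c = 0 \<and> good = (\<lambda>q. ip n q \<rho> < 0) \<or> c = 1 \<and> good = (\<lambda>q. ip n q \<rho> > 1)"
  shows "wall_refl T n s good"
  unfolding wall_refl_def
proof (intro conjI s ballI impI)
  fix q assume q: "q \<in> Rn n" and gen: "\<forall>\<alpha> \<in> pos_roots T n. ip n q \<alpha> \<notin> \<int>"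
  let ?P = "pos_roots T n" and ?f = "\<lambda>r. \<bar>of_int \<lfloor>r\<rfloor> :: real\<bar>"
  have fin: "finite ?P" by (rule finite_pos_roots)
  have split: "flen T n v = ?f (ip n v \<rho>) + (\<Sum>\<alpha>\<in>?P - {\<rho>}. ?f (ip n v \<alpha>))" for v
    unfolding flen_def using sum.remove[OF fin \<rho>] by simp
  have "\<phi> ` (?P - {\<rho>}) \<subseteq> ?P - {\<rho>}" using \<phi> by auto
  hence bij: "bij_betw \<phi> (?P - {\<rho>}) (?P - {\<rho>})"
    using endo_inj_surj[OF _ _ inj] fin inj unfolding bij_betw_def by blast
  have sym: "?f (1 - r) = ?f r" if "r \<notin> \<int>" for r :: real
  proof -
    have "of_int \<lfloor>r\<rfloor> < r" using that by (metis Ints_of_int of_int_floor_le order_le_less)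
    hence "\<lfloor>1 - r\<rfloor> = - \<lfloor>r\<rfloor>" by linarith
    thus ?thesis by simp
  qed
  have "(\<Sum>\<alpha>\<in>?P - {\<rho>}. ?f (ip n (aff s q) \<alpha>)) = (\<Sum>\<alpha>\<in>?P - {\<rho>}. ?f (ip n q (\<phi> \<alpha>)))"
  proof (intro sum.cong refl)
    fix \<alpha> assume a: "\<alpha> \<in> ?P - {\<rho>}"
    hence "ip n q (\<phi> \<alpha>) \<notin> \<int>" using gen \<phi> by auto
    thus "?f (ip n (aff s q) \<alpha>) = ?f (ip n q (\<phi> \<alpha>))" using ip\<phi>[OF q, of \<alpha>] a sym by fastforce
  qed
  also have "\<dots> = (\<Sum>\<alpha>\<in>?P - {\<rho>}. ?f (ip n q \<alpha>))"
    by (rule sum.reindex_bij_betw[OF bij])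
  finally have d: "flen T n (aff s q) - flen T n q = ?f (2 * of_int c - ip n q \<rho>) - ?f (ip n q \<rho>)"
    using split[of q] split[of "aff s q"] ip0[OF q] by simp
  define t where "t = ip n q \<rho>"
  have t: "t \<notin> \<int>" using gen \<rho> by (simp add: t_def)
  hence t': "of_int \<lfloor>t\<rfloor> < t" by (metis Ints_of_int of_int_floor_le order_le_less)
  \<comment> \<open>The reflected value is 2c - t. Since t is not an integer, an extra -1 appears in
    its floor; beyond the wall this lowers the modulus by exactly 1.\<close>
  have fl: "\<lfloor>2 * of_int c - t\<rfloor> = 2 * c - \<lfloor>t\<rfloor> - 1"
    using t' by linarith
  have e: "flen T n (aff s q) - flen T n q = \<bar>of_int (2 * c - \<lfloor>t\<rfloor> - 1)\<bar> - \<bar>of_int \<lfloor>t\<rfloor>\<bar>"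
    using d unfolding t_def[symmetric] fl .
  show "flen T n (aff s q) \<le> flen T n q + 1" using e c by auto
  assume "good q"
  hence "c = 0 \<and> t < 0 \<or> c = 1 \<and> t > 1" using c by (auto simp: t_def)
  thus "flen T n (aff s q) = flen T n q - 1"
  proof
    assume *: "c = 0 \<and> t < 0"
    hence "t < 0" ..
    hence "\<lfloor>t\<rfloor> < 0" by simp
    hence "\<lfloor>t\<rfloor> + 1 \<le> 0" by presburger
    hence "real_of_int (\<lfloor>t\<rfloor> + 1) \<le> 0" by (simp only: of_int_le_0_iff)
    hence "real_of_int \<lfloor>t\<rfloor> \<le> - 1" by simp
    thus ?thesis using e * by simp
  next
    assume *: "c = 1 \<and> t > 1"
    hence "1 < t" ..
    hence "1 \<le> \<lfloor>t\<rfloor>" by simp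
    hence "of_int 1 \<le> real_of_int \<lfloor>t\<rfloor>" by (simp only: of_int_le_iff)
    hence "1 \<le> real_of_int \<lfloor>t\<rfloor>" by simp
    thus ?thesis using e * by simp
  qed
qed

text \<open>On the good side, left multiplication by \<open>s\<close> shortens by 1, while right
  multiplication, read through the inverse, lengthens by at most 1. If it is the inverse of
  \<open>x\<close> that lies on the good side, the argument is applied to it, inverses having equal
  length.\<close>

lemma wall_refl_len:
  assumes s: "wall_refl T n s good" and x: "inG T n x"
    and g: "good (aff x (delta n)) \<or> good (aff (ginv x) (delta n))"
  shows "len T n (gmul (gmul s x) s) \<le> len T n x"
proof -
  have sG: "inG T n s" "ginv s = s" using s by (auto simp: wall_refl_def)
  have R: "aff z (delta n) \<in> Rn n" if "inG T n z" for z
    using aff_Rn[OF inG_grp[OF that] delta_Rn] .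
  have le: "flen T n (aff (gmul s z) (delta n)) \<le> flen T n (aff z (delta n)) + 1"
    and eq: "good (aff z (delta n)) \<Longrightarrow> flen T n (aff (gmul s z) (delta n)) = flen T n (aff z (delta n)) - 1"
    if z: "inG T n z" for z
  proof -
    have "\<forall>\<alpha> \<in> pos_roots T n. ip n (aff z (delta n)) \<alpha> \<notin> \<int>" using aff_delta_notint[OF z] by blast
    thus "flen T n (aff (gmul s z) (delta n)) \<le> flen T n (aff z (delta n)) + 1"
      "good (aff z (delta n)) \<Longrightarrow> flen T n (aff (gmul s z) (delta n)) = flen T n (aff z (delta n)) - 1"
      using s R[OF z] by (auto simp: wall_refl_def aff_gmul grp_bij[OF inG_grp[OF sG(1)]] grp_bij[OF inG_grp[OF z]])
  qed
  have b: "bij (snd s)" using sG inG_grp grp_bij by blast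
  have main: "flen T n (aff (gmul (gmul s z) s) (delta n)) \<le> flen T n (aff z (delta n))"
    if z: "inG T n z" and g: "good (aff z (delta n))" for z
  proof -
    have bz: "bij (snd z)" using z inG_grp grp_bij by blast
    have "ginv (gmul (gmul s z) s) = gmul s (ginv (gmul s z))"
      using b bz by (simp add: ginv_gmul gmul_bij sG)
    hence "flen T n (aff (gmul (gmul s z) s) (delta n)) = flen T n (aff (gmul s (ginv (gmul s z))) (delta n))"
      using flen_ginv[of T n "gmul (gmul s z) s"] z sG by (simp add: inG_gmul)
    also have "\<dots> \<le> flen T n (aff (ginv (gmul s z)) (delta n)) + 1"
      by (rule le) (use z sG in \<open>simp add: inG_gmul inG_ginv\<close>)
    also have "\<dots> = flen T n (aff (gmul s z) (delta n)) + 1"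
      using flen_ginv z sG by (simp add: inG_gmul)
    also have "\<dots> = flen T n (aff z (delta n))" using eq[OF z g] by simp
    finally show ?thesis .
  qed
  have bx: "bij (snd x)" using x inG_grp grp_bij by blast
  have L: "len T n (gmul (gmul s x) s) = flen T n (aff (gmul (gmul s x) s) (delta n))"
    "len T n x = flen T n (aff x (delta n))"
    using x sG by (auto intro!: len_flen inG_gmul)
  from g show ?thesis
  proof
    assume "good (aff x (delta n))" thus ?thesis using main[OF x] L by simp
  next
    assume *: "good (aff (ginv x) (delta n))"
    have "ginv (gmul (gmul s x) s) = gmul (gmul s (ginv x)) s"
      using b bx by (simp add: ginv_gmul gmul_bij sG gmul_assoc ginv_bij)
    hence "flen T n (aff (gmul (gmul s x) s) (delta n)) = flen T n (aff (gmul (gmul s (ginv x)) s) (delta n))"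
      using flen_ginv[of T n "gmul (gmul s x) s"] x sG by (simp add: inG_gmul)
    thus ?thesis using main[OF inG_ginv[OF x] *] L flen_ginv[OF x] by simp
  qed
qed

section \<open>Elementary steps\<close>

lemma signed_perms_inverses:
  assumes "\<And>i. f (g i) = i" "\<And>i. g (f i) = i" "\<And>i. f (- i) = - f i" "\<And>i. i \<notin> idx n \<Longrightarrow> f i = i"
  shows "f \<in> signed_perms n" "iv f = g"
proof -
  have "f permutes idx n" unfolding permutes_def using assms(1,2,4) by metis
  thus "f \<in> signed_perms n" using assms(3) by (simp add: signed_perms_iff)
  show "iv f = g" by (rule inv_equality) (use assms(1,2) in auto)
qed

section \<open>Adjacent transpositions and sign changes as reflections in walls\<close>

definition adj :: "int \<Rightarrow> int \<Rightarrow> int" where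
  "adj i j = (if j = i then i + 1 else if j = i + 1 then i
     else if j = - i then - i - 1 else if j = - i - 1 then - i else j)"

definition sgnc :: "int \<Rightarrow> int \<Rightarrow> int" where
  "sgnc i j = (if \<bar>j\<bar> = i then - j else j)"

lemma adj_signed:
  assumes "1 \<le> i" "i < int n"
  shows "adj i \<in> signed_perms n" "iv (adj i) = adj i"
proof -
  have *: "adj i (adj i j) = j" "adj i (- j) = - adj i j" "j \<notin> idx n \<Longrightarrow> adj i j = j" for j
    using assms by (auto simp: adj_def idx_def)
  show "adj i \<in> signed_perms n" "iv (adj i) = adj i"
    using signed_perms_inverses[of "adj i" "adj i" n] * by blast+
qed

lemma adj_sym: "1 \<le> i \<Longrightarrow> i < int n \<Longrightarrow> adj i \<in> sym_perms n"
  using adj_signed[of i n] by (auto simp: sym_perms_def adj_def)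

lemma sgnc_signed:
  assumes "1 \<le> i" "i \<le> int n"
  shows "sgnc i \<in> signed_perms n" "iv (sgnc i) = sgnc i"
proof -
  have *: "sgnc i (sgnc i j) = j" "sgnc i (- j) = - sgnc i j" "j \<notin> idx n \<Longrightarrow> sgnc i j = j" for j
    using assms by (auto simp: sgnc_def idx_def)
  show "sgnc i \<in> signed_perms n" "iv (sgnc i) = sgnc i"
    using signed_perms_inverses[of "sgnc i" "sgnc i" n] * by blast+
qed

lemma inG_adj: "1 \<le> i \<Longrightarrow> i < int n \<Longrightarrow> inG T n (0, adj i)"
  using adj_signed[of i n] adj_sym[of i n] by (simp add: inG_def grp_def grpA_def Zn_zero)

lemma ip_act_self:
  assumes "w \<in> signed_perms n" "iv w = w" "q \<in> Rn n" "\<alpha> \<in> pos_roots T n"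
  shows "ip n (act w q) \<alpha> = ip n q (act w \<alpha>)"
  using ip_act_left[OF assms(1,3) pos_roots_Rn[OF assms(4)]] assms(2) by simp

lemma act_self_cancel: "w \<in> signed_perms n \<Longrightarrow> iv w = w \<Longrightarrow> act w (act w v) = v"
  using sp_iv_eq[of w n] by (simp add: act_def fun_eq_iff)

lemma inj_act_self: "w \<in> signed_perms n \<Longrightarrow> iv w = w \<Longrightarrow> inj_on (act w) X"
  by (metis act_self_cancel inj_onI)

lemma diff_pos: "1 \<le> i \<Longrightarrow> i < j \<Longrightarrow> j \<le> int n \<Longrightarrow> basis_vec i - basis_vec j \<in> pos_roots T n"
  by (cases T) auto

lemma sum_pos: "T \<noteq> Type_A \<Longrightarrow> 1 \<le> i \<Longrightarrow> i < j \<Longrightarrow> j \<le> int n \<Longrightarrow> basis_vec i + basis_vec j \<in> pos_roots T n"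
  by (cases T) auto

lemma short_pos: "1 \<le> i \<Longrightarrow> i \<le> int n \<Longrightarrow> basis_vec i \<in> pos_roots Type_B n"
  by auto

lemma long_pos: "1 \<le> i \<Longrightarrow> i \<le> int n \<Longrightarrow> scale 2 (basis_vec i) \<in> pos_roots Type_C n"
  by auto

declare pos_roots.simps [simp del]

text \<open>\<open>adj i\<close> reverses the order of no pair of positive indices except i, i + 1,
  so every other positive root stays positive.\<close>

lemma wall_refl_adj:
  assumes i: "1 \<le> i" "i < int n"
  shows "wall_refl T n (0, adj i) (\<lambda>q. ip n q (basis_vec i - basis_vec (i + 1)) < 0)"
proof (rule wall_reflI[where \<rho> = "basis_vec i - basis_vec (i + 1)" and \<phi> = "act (adj i)" and c = 0])
  note A = adj_signed[OF i]
  show "inG T n (0, adj i)" using i by (rule inG_adj)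
  show "ginv (0, adj i) = (0, adj i)" by (simp add: ginv_def A act_zero)
  show \<rho>: "basis_vec i - basis_vec (i + 1) \<in> pos_roots T n" using i by (intro diff_pos) auto
  have neg: "act (adj i) (basis_vec i - basis_vec (i + 1)) = - (basis_vec i - basis_vec (i + 1))"
    by (simp add: act_diff act_basis[OF A(1)] adj_def)
  show "act (adj i) \<alpha> \<in> pos_roots T n \<and> act (adj i) \<alpha> \<noteq> basis_vec i - basis_vec (i + 1)"
    if a: "\<alpha> \<in> pos_roots T n" "\<alpha> \<noteq> basis_vec i - basis_vec (i + 1)" for \<alpha>
  proof
    show "act (adj i) \<alpha> \<noteq> basis_vec i - basis_vec (i + 1)"
    proof
      assume "act (adj i) \<alpha> = basis_vec i - basis_vec (i + 1)"
      hence "\<alpha> = - (basis_vec i - basis_vec (i + 1))"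
        using act_self_cancel[OF A, of \<alpha>] neg by simp
      thus False using a(1) \<rho> by (simp add: pos_roots_iff ip_uminus_right ip_diff_right)
    qed
    show "act (adj i) \<alpha> \<in> pos_roots T n" using a(1)
    proof (cases rule: pos_roots_cases)
      case (diff k l)
      have "\<not> (k = i \<and> l = i + 1)" using diff a(2) by auto
      hence "1 \<le> adj i k \<and> adj i k < adj i l \<and> adj i l \<le> int n" using diff i by (auto simp: adj_def)
      thus ?thesis unfolding diff act_diff act_basis[OF A(1)] by (intro diff_pos) auto
    next
      case (sum k l)
      have "adj i k \<noteq> adj i l" "1 \<le> adj i k" "adj i k \<le> int n" "1 \<le> adj i l" "adj i l \<le> int n"
        using sum i by (auto simp: adj_def)
      thus ?thesis unfolding sum(5) act_add act_basis[OF A(1)]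
        using sum_pos[OF sum(1), of "adj i k" "adj i l" n] sum_pos[OF sum(1), of "adj i l" "adj i k" n]
        by (cases "adj i k < adj i l") (simp_all add: add.commute)
    next
      case (short k)
      have "1 \<le> adj i k" "adj i k \<le> int n" using short i by (auto simp: adj_def)
      thus ?thesis unfolding short(1,4) act_basis[OF A(1)] by (rule short_pos)
    next
      case (long k)
      have "1 \<le> adj i k" "adj i k \<le> int n" using long i by (auto simp: adj_def)
      thus ?thesis unfolding long(1,4) act_scale act_basis[OF A(1)] by (rule long_pos)
    qed
  qed
  show "inj_on (act (adj i)) (pos_roots T n - {basis_vec i - basis_vec (i + 1)})"
    by (rule inj_act_self[OF A])
  show "ip n (aff (0, adj i) q) \<alpha> = ip n q (act (adj i) \<alpha>) \<or>
      ip n (aff (0, adj i) q) \<alpha> = 1 - ip n q (act (adj i) \<alpha>)"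
    if "q \<in> Rn n" "\<alpha> \<in> pos_roots T n" for q \<alpha>
    using ip_act_self[OF A that] by (simp add: aff_def)
  show "ip n (aff (0, adj i) q) (basis_vec i - basis_vec (i + 1)) =
      2 * of_int 0 - ip n q (basis_vec i - basis_vec (i + 1))" if "q \<in> Rn n" for q
    using ip_act_self[OF A that \<rho>] neg by (simp add: aff_def ip_uminus_right ip_diff_right)
qed simp

lemma inG_sgnc: "T \<noteq> Type_A \<Longrightarrow> 1 \<le> i \<Longrightarrow> i \<le> int n \<Longrightarrow> inG T n (0, sgnc i)"
  using sgnc_signed[of i n] by (simp add: inG_def grp_def Zn_zero)

lemma inG_top: "T \<noteq> Type_A \<Longrightarrow> 1 \<le> n \<Longrightarrow> inG T n (basis_vec 1, sgnc 1)"
  using sgnc_signed[of 1 n] by (simp add: inG_def grp_def basis_Zn idx_def)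

text \<open>The sign change at n exchanges e_k - e_n with e_k + e_n and negates \<rho> alone among
  the positive roots.\<close>

lemma wall_refl_sgnc:
  assumes n: "1 \<le> n" and T: "T = Type_B \<and> \<rho> = basis_vec (int n) \<or> T = Type_C \<and> \<rho> = scale 2 (basis_vec (int n))"
  shows "wall_refl T n (0, sgnc (int n)) (\<lambda>q. ip n q \<rho> < 0)"
proof (rule wall_reflI[where \<rho> = \<rho> and \<phi> = "act (sgnc (int n))" and c = 0])
  have TA: "T \<noteq> Type_A" using T by auto
  have A: "sgnc (int n) \<in> signed_perms n" "iv (sgnc (int n)) = sgnc (int n)"
    using sgnc_signed[of "int n" n] n by auto
  show "inG T n (0, sgnc (int n))" using TA n by (intro inG_sgnc) auto
  show "ginv (0, sgnc (int n)) = (0, sgnc (int n))" by (simp add: ginv_def A act_zero)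
  show \<rho>: "\<rho> \<in> pos_roots T n" using T n by (auto simp: short_pos long_pos)
  have b: "act (sgnc (int n)) (basis_vec k) = (if k = int n then - basis_vec k else basis_vec k)" if "1 \<le> k" for k
    using that by (simp add: act_basis[OF A(1)] sgnc_def basis_minus)
  have neg: "act (sgnc (int n)) \<rho> = - \<rho>"
    using T b[of "int n"] n by (auto simp: act_scale scale_uminus)
  show "act (sgnc (int n)) \<alpha> \<in> pos_roots T n \<and> act (sgnc (int n)) \<alpha> \<noteq> \<rho>"
    if a: "\<alpha> \<in> pos_roots T n" "\<alpha> \<noteq> \<rho>" for \<alpha>
  proof
    show "act (sgnc (int n)) \<alpha> \<noteq> \<rho>"
    proof
      assume "act (sgnc (int n)) \<alpha> = \<rho>"
      hence "\<alpha> = - \<rho>" using act_self_cancel[OF A, of \<alpha>] neg by simp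
      thus False using a(1) \<rho> by (simp add: pos_roots_iff ip_uminus_right ip_diff_right)
    qed
    show "act (sgnc (int n)) \<alpha> \<in> pos_roots T n" using a(1)
    proof (cases rule: pos_roots_cases)
      case (diff k l)
      thus ?thesis using sum_pos[OF TA, of k l n] diff_pos[of k l n T] by (auto simp: act_diff b)
    next
      case (sum k l)
      thus ?thesis using sum_pos[OF TA, of k l n] diff_pos[of k l n T] by (auto simp: act_add b)
    next
      case (short k)
      hence "k \<noteq> int n" using a(2) T by auto
      thus ?thesis using short a by (simp add: b)
    next
      case (long k)
      hence "k \<noteq> int n" using a(2) T by auto
      thus ?thesis using long a by (simp add: act_scale b)
    qed
  qed
  show "inj_on (act (sgnc (int n))) (pos_roots T n - {\<rho>})"
    by (rule inj_act_self[OF A])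
  show "ip n (aff (0, sgnc (int n)) q) \<alpha> = ip n q (act (sgnc (int n)) \<alpha>) \<or>
      ip n (aff (0, sgnc (int n)) q) \<alpha> = 1 - ip n q (act (sgnc (int n)) \<alpha>)"
    if "q \<in> Rn n" "\<alpha> \<in> pos_roots T n" for q \<alpha>
    using ip_act_self[OF A that] by (simp add: aff_def)
  show "ip n (aff (0, sgnc (int n)) q) \<rho> = 2 * of_int 0 - ip n q \<rho>" if "q \<in> Rn n" for q
    using ip_act_self[OF A that \<rho>] neg by (simp add: aff_def ip_uminus_right)
qed simp

lemma wall_refl_top:
  assumes n: "1 \<le> n"
  shows "wall_refl Type_C n (basis_vec 1, sgnc 1) (\<lambda>q. ip n q (scale 2 (basis_vec 1)) > 1)"
proof -
  let ?e = "basis_vec 1" and ?s = "sgnc 1"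
  \<comment> \<open>A positive root other than 2 e_1 has value 0 or 1 at e_1. In the first case it
    is fixed; in the second the affine reflection turns the value of e_1 - e_k into 1 minus that of
    e_1 + e_k, and conversely.\<close>
  let ?\<phi> = "\<lambda>\<alpha>. if ip n ?e \<alpha> = 0 then act ?s \<alpha> else - act ?s \<alpha>"
  have A: "?s \<in> signed_perms n" "iv ?s = ?s" using sgnc_signed[of 1 n] n by auto
  have eR: "?e \<in> Rn n" using n by (intro basis_Rn) (simp add: idx_def)
  have b: "act ?s (basis_vec k) = (if k = 1 then - basis_vec k else basis_vec k)" if "1 \<le> k" for k
    using that by (simp add: act_basis[OF A(1)] sgnc_def basis_minus)
  have e: "ip n ?e (basis_vec k) = (if k = 1 then 1 else 0)" if "1 \<le> k" "k \<le> int n" for k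
    using that by (simp add: ip_basis_pos) (simp add: basis_vec_def)
  show ?thesis
  proof (rule wall_reflI[where \<rho> = "scale 2 ?e" and \<phi> = ?\<phi> and c = 1])
    show "inG Type_C n (?e, ?s)" using n by (intro inG_top) auto
    show "ginv (?e, ?s) = (?e, ?s)" by (simp add: ginv_def A b)
    show \<rho>: "scale 2 ?e \<in> pos_roots Type_C n" using n by (intro long_pos) auto
    show "?\<phi> \<alpha> \<in> pos_roots Type_C n \<and> ?\<phi> \<alpha> \<noteq> scale 2 ?e"
      if a: "\<alpha> \<in> pos_roots Type_C n" "\<alpha> \<noteq> scale 2 ?e" for \<alpha>
    proof
      have "act ?s (scale 2 ?e) = - scale 2 ?e" by (simp add: act_scale b scale_uminus)
      moreover have "act ?s (- scale 2 ?e) = scale 2 ?e" by (simp add: act_scale act_uminus b scale_uminus)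
      moreover have "ip n ?e (- scale 2 ?e) \<noteq> 0" "ip n ?e (scale 2 ?e) \<noteq> 0"
        using e[of 1] n by (simp_all add: ip_uminus_right ip_scale_right)
      moreover have "- scale 2 ?e \<notin> pos_roots Type_C n"
        using \<rho> by (auto simp: pos_roots_iff ip_uminus_right)
      ultimately show "?\<phi> \<alpha> \<noteq> scale 2 ?e" using a
        by (smt (verit) act_self_cancel[OF A] minus_equation_iff)
      show "?\<phi> \<alpha> \<in> pos_roots Type_C n" using a(1)
      proof (cases rule: pos_roots_cases)
        case (diff k l)
        thus ?thesis using sum_pos[of Type_C k l n] diff_pos[of k l n Type_C]
          by (auto simp: act_diff b ip_diff_right e add.commute)
      next
        case (sum k l)
        thus ?thesis using sum_pos[of Type_C k l n] diff_pos[of k l n Type_C]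
          by (auto simp: act_add b ip_add_right e add.commute)
      next
        case (long k)
        hence "k \<noteq> 1" using a(2) by auto
        thus ?thesis using long a by (simp add: act_scale b ip_scale_right e)
      qed simp
    qed
    show "inj_on ?\<phi> (pos_roots Type_C n - {scale 2 ?e})"
    proof (rule inj_onI)
      fix \<alpha> \<beta> assume ab: "\<alpha> \<in> pos_roots Type_C n - {scale 2 ?e}" "\<beta> \<in> pos_roots Type_C n - {scale 2 ?e}" "?\<phi> \<alpha> = ?\<phi> \<beta>"
      have s: "ip n ?e (act ?s \<gamma>) = - ip n ?e \<gamma>" if "\<gamma> \<in> pos_roots Type_C n" for \<gamma>
        using ip_act_self[OF A eR that] b[of 1] by (simp add: ip_uminus_left)
      have p: "ip n ?e (?\<phi> \<gamma>) = ip n ?e \<gamma>" if "\<gamma> \<in> pos_roots Type_C n" for \<gamma>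
        using s[OF that] by (simp add: ip_uminus_right)
      have "ip n ?e \<alpha> = ip n ?e \<beta>" using p[of \<alpha>] p[of \<beta>] ab by simp
      hence "act ?s \<alpha> = act ?s \<beta>" using ab(3) by (simp split: if_splits)
      thus "\<alpha> = \<beta>" by (metis act_self_cancel[OF A])
    qed
    show "ip n (aff (?e, ?s) q) \<alpha> = ip n q (?\<phi> \<alpha>) \<or> ip n (aff (?e, ?s) q) \<alpha> = 1 - ip n q (?\<phi> \<alpha>)"
      if q: "q \<in> Rn n" and a: "\<alpha> \<in> pos_roots Type_C n" "\<alpha> \<noteq> scale 2 ?e" for q \<alpha>
    proof -
      have "ip n ?e \<alpha> = 0 \<or> ip n ?e \<alpha> = 1" using a(1)
      proof (cases rule: pos_roots_cases)
        case (long k)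
        hence "k \<noteq> 1" using a(2) by auto
        thus ?thesis using long by (simp add: ip_scale_right e)
      qed (auto simp: ip_add_right ip_diff_right e)
      thus ?thesis using ip_act_self[OF A q a(1)]
        by (auto simp: aff_def ip_add_left ip_uminus_right)
    qed
    show "ip n (aff (?e, ?s) q) (scale 2 ?e) = 2 * of_int 1 - ip n q (scale 2 ?e)" if q: "q \<in> Rn n" for q
      using ip_act_self[OF A q \<rho>] b[of 1] e[of 1] n
      by (simp add: aff_def ip_add_left ip_scale_right act_scale scale_uminus ip_uminus_right)
  qed simp
qed

section \<open>Simple roots and the highest root, found by heights\<close>

lemma simple_rootI:
  assumes "\<alpha> \<in> pos_roots T n" "\<And>\<beta>. \<beta> \<in> pos_roots T n \<Longrightarrow> m \<le> ip n h \<beta>" "ip n h \<alpha> < 2 * m"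
  shows "\<alpha> \<in> simple_roots T n"
proof -
  have False if "\<beta> \<in> pos_roots T n" "\<gamma> \<in> pos_roots T n" "\<alpha> = \<beta> + \<gamma>" for \<beta> \<gamma>
    using assms(2)[OF that(1)] assms(2)[OF that(2)] assms(3) that(3) by (simp add: ip_add_right)
  thus ?thesis using assms(1) by (auto simp: simple_roots_def)
qed

text \<open>The shift by \<open>r\<close> is needed since the simple roots \<open>e\<^sub>n\<close> of type B and
  \<open>2 e\<^sub>n\<close> of type C must have height 1.\<close>

definition hvec :: "real \<Rightarrow> nat \<Rightarrow> vec" where
  "hvec r n = (\<lambda>i. real n - of_int i + r)"

lemma hvec_ge:
  assumes "\<beta> \<in> pos_roots T n" "T = Type_C \<and> r = 1/2 \<or> T \<noteq> Type_C \<and> r = 1"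
  shows "1 \<le> ip n (hvec r n) \<beta>"
  using assms(1)
  by (cases rule: pos_roots_cases)
     (use assms(2) in \<open>auto simp: ip_diff_right ip_add_right ip_scale_right ip_basis_pos hvec_def\<close>)

lemma adj_simple: 
  assumes "1 \<le> i" "i < int n" shows "basis_vec i - basis_vec (i + 1) \<in> simple_roots T n"
proof -
  let ?r = "if T = Type_C then 1/2 else 1 :: real"
  show ?thesis
  proof (rule simple_rootI)
    show "basis_vec i - basis_vec (i + 1) \<in> pos_roots T n" using assms by (intro diff_pos) auto
    show "\<And>\<beta>. \<beta> \<in> pos_roots T n \<Longrightarrow> 1 \<le> ip n (hvec ?r n) \<beta>" by (rule hvec_ge) auto
    show "ip n (hvec ?r n) (basis_vec i - basis_vec (i + 1)) < 2 * 1"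
      using assms by (simp add: ip_diff_right ip_basis_pos hvec_def)
  qed
qed

lemma last_simple:
  assumes n: "1 \<le> n" and T: "T = Type_B \<and> \<rho> = basis_vec (int n) \<or> T = Type_C \<and> \<rho> = scale 2 (basis_vec (int n))"
  shows "\<rho> \<in> simple_roots T n"
proof -
  let ?r = "if T = Type_C then 1/2 else 1 :: real"
  show ?thesis
  proof (rule simple_rootI)
    show "\<rho> \<in> pos_roots T n" using assms by (auto simp: short_pos long_pos)
    show "\<And>\<beta>. \<beta> \<in> pos_roots T n \<Longrightarrow> 1 \<le> ip n (hvec ?r n) \<beta>" by (rule hvec_ge) auto
    show "ip n (hvec ?r n) \<rho> < 2 * 1"
      using assms by (auto simp: ip_scale_right ip_basis_pos hvec_def)
  qed
qed

lemma ip_sum_right: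
  assumes "finite A" shows "ip n h (\<Sum>\<gamma>\<in>A. f \<gamma>) = (\<Sum>\<gamma>\<in>A. ip n h (f \<gamma>))"
  using assms
proof (induction A rule: finite_induct)
  case empty
  show ?case by (simp add: ip_def)
next
  case (insert x F)
  show ?case unfolding sum.insert[OF insert.hyps(1,2)] ip_add_right insert.IH ..
qed

text \<open>Adding simple roots never lowers the height, and 2 e_1 is the only positive root of
  height at least 2n - 1.\<close>

lemma top_highest:
  assumes n: "1 \<le> n" shows "scale 2 (basis_vec 1) \<in> highest_roots Type_C n"
proof -
  let ?h = "hvec (1/2) n" and ?t = "scale 2 (basis_vec 1)"
  have pos: "1 \<le> ip n ?h \<beta>" if "\<beta> \<in> pos_roots Type_C n" for \<beta> using hvec_ge[OF that] by auto
  have ht: "ip n ?h ?t = 2 * real n - 1" using n by (simp add: ip_scale_right ip_basis_pos hvec_def)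
  have fin: "finite (simple_roots Type_C n)"
    using finite_pos_roots[of Type_C n] by (simp add: simple_roots_def)
  have "\<beta> = ?t" if b: "\<beta> \<in> pos_roots Type_C n" "root_le Type_C n ?t \<beta>" for \<beta>
  proof -
    obtain m :: "vec \<Rightarrow> nat" where m: "\<beta> = ?t + (\<Sum>\<gamma> \<in> simple_roots Type_C n. scale (real (m \<gamma>)) \<gamma>)"
      using b(2) by (auto simp: root_le_def)
    have "ip n ?h (\<Sum>\<gamma> \<in> simple_roots Type_C n. scale (real (m \<gamma>)) \<gamma>) \<ge> 0"
      unfolding ip_sum_right[OF fin]
    proof (rule sum_nonneg)
      fix \<gamma> assume "\<gamma> \<in> simple_roots Type_C n"
      hence "1 \<le> ip n ?h \<gamma>" by (intro pos) (simp add: simple_roots_def)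
      thus "0 \<le> ip n ?h (scale (real (m \<gamma>)) \<gamma>)" by (simp add: ip_scale_right)
    qed
    hence ge: "ip n ?h \<beta> \<ge> 2 * real n - 1" using ht m by (simp add: ip_add_right)
    from b(1) show ?thesis
    proof (cases rule: pos_roots_cases)
      case (diff i j) thus ?thesis using ge by (simp add: ip_diff_right ip_basis_pos hvec_def)
    next
      case (sum i j) thus ?thesis using ge by (simp add: ip_add_right ip_basis_pos hvec_def)
    next
      case (long i)
      have "i = 1" using ge long by (simp add: ip_scale_right ip_basis_pos hvec_def)
      thus ?thesis using long by simp
    qed simp
  qed
  moreover have "?t \<in> pos_roots Type_C n" using n by (intro long_pos) auto
  ultimately show ?thesis by (simp add: highest_roots_def)
qed

lemma is_reflectionI:
  assumes "w \<in> signed_perms n" "\<And>v i. v \<in> Rn n \<Longrightarrow> v (iv w i) = v i - ip n v (coroot n \<alpha>) * \<alpha> i"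
  shows "is_reflection n \<alpha> w"
  using assms by (auto simp: is_reflection_def act_def scale_def fun_eq_iff)

lemma adj_reflection:
  assumes i: "1 \<le> i" "i < int n" shows "is_reflection n (basis_vec i - basis_vec (i + 1)) (adj i)"
proof (rule is_reflectionI)
  let ?a = "basis_vec i - basis_vec (i + 1)"
  have ip: "ip n v ?a = v i - v (i + 1)" for v
    using i by (simp add: ip_diff_right ip_basis_pos)
  have "ip n ?a ?a = 2" unfolding ip using i by (simp add: basis_vec_def)
  hence c: "coroot n ?a = ?a" by (simp add: coroot_def scale_def fun_eq_iff)
  fix v j assume "v \<in> Rn n"
  hence "v (- i) = - v i" "v (- i - 1) = - v (i + 1)"
    using Rn_minus[of v n i] Rn_minus[of v n "i + 1"] by simp_all
  thus "v (iv (adj i) j) = v j - ip n v (coroot n ?a) * ?a j"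
    unfolding adj_signed(2)[OF i] c ip using i by (auto simp: adj_def basis_vec_def)
qed (rule adj_signed[OF i])

lemma sgnc_reflection:
  assumes i: "1 \<le> i" "i \<le> int n" and \<alpha>: "\<alpha> = basis_vec i \<or> \<alpha> = scale 2 (basis_vec i)"
  shows "is_reflection n \<alpha> (sgnc i)"
proof (rule is_reflectionI)
  have ip: "ip n v (basis_vec i) = v i" for v using i by (simp add: ip_basis_pos)
  have "ip n \<alpha> \<alpha> = 1 \<and> \<alpha> = basis_vec i \<or> ip n \<alpha> \<alpha> = 4 \<and> \<alpha> = scale 2 (basis_vec i)"
    using \<alpha> i by (auto simp: ip_scale_left ip_scale_right ip) (auto simp: basis_vec_def)
  \<comment> \<open>Rescaling a root does not change its reflection, so e_i and 2 e_i lead to one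
    formula.\<close>
  hence c: "ip n v (coroot n \<alpha>) * \<alpha> j = 2 * v i * basis_vec i j" for v j
    by (auto simp: coroot_def ip_scale_right ip) (simp_all add: scale_def)
  fix v j assume "v \<in> Rn n"
  hence "v (- i) = - v i" by (rule Rn_minus)
  moreover have "\<bar>j\<bar> = i \<Longrightarrow> j = i \<or> j = - i" by auto
  ultimately show "v (iv (sgnc i) j) = v j - ip n v (coroot n \<alpha>) * \<alpha> j"
    unfolding sgnc_signed(2)[OF i] c using i by (auto simp: sgnc_def basis_vec_def)
qed (rule sgnc_signed[OF i])

lemma coroot_top: "1 \<le> n \<Longrightarrow> coroot n (scale 2 (basis_vec 1)) = basis_vec 1"
  by (simp add: coroot_def ip_scale_left ip_scale_right ip_basis_pos)
     (simp add: scale_def basis_vec_def fun_eq_iff)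

section \<open>The steps available in each type\<close>

lemma step_reflection:
  assumes "s \<in> simple_affine_reflections T n" "wall_refl T n s good" "inG T n x"
    "good (aff x (delta n)) \<or> good (aff (ginv x) (delta n))"
  shows "step T n x (gconj s x)"
  using wall_refl_len[OF assms(2-4)] assms(1,2)
  by (auto simp: step_def arrow_def gconj_def ext_group_mult wall_refl_def)

text \<open>An element that keeps \<open>delta n\<close> inside the base alcove crosses no wall,
  hence has length zero.\<close>

lemma step_Omega:
  assumes a: "inG T n a" and pos: "\<And>\<alpha>. \<alpha> \<in> pos_roots T n \<Longrightarrow> 0 < ip n (aff a (delta n)) \<alpha> \<and> ip n (aff a (delta n)) \<alpha> < 1"
  shows "step T n x (gconj a x)"
proof -
  have "len T n a = 0"
    unfolding len_flen[OF a] flen_def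
  proof (rule sum.neutral, rule ballI)
    fix \<alpha> assume "\<alpha> \<in> pos_roots T n"
    thus "\<bar>real_of_int \<lfloor>ip n (aff a (delta n)) \<alpha>\<rfloor>\<bar> = 0" using pos floor_unit(1) by force
  qed
  hence "a \<in> Omega T n" using a grp_carrier[of a n T] by (auto simp: Omega_def inG_def)
  moreover have "m_inv (ext_group T n) a = ginv a"
    using a m_inv_ext_group[of a n T] by (auto simp: inG_def)
  ultimately show ?thesis by (auto simp: step_def gconj_def ext_group_mult intro!: bexI[of _ a])
qed

lemma step_adj:
  assumes i: "1 \<le> i" "i < int n" and x: "inG T n x"
    and c: "aff x (delta n) i < aff x (delta n) (i + 1) \<or> aff (ginv x) (delta n) i < aff (ginv x) (delta n) (i + 1)"
  shows "step T n x (gconj (0, adj i) x)"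
proof (rule step_reflection[OF _ wall_refl_adj[OF i] x])
  show "(0, adj i) \<in> simple_affine_reflections T n"
    using adj_simple[OF i] adj_reflection[OF i] by (auto simp: simple_affine_reflections_def)
  show "ip n (aff x (delta n)) (basis_vec i - basis_vec (i + 1)) < 0 \<or>
    ip n (aff (ginv x) (delta n)) (basis_vec i - basis_vec (i + 1)) < 0"
    using c i by (simp add: ip_diff_right ip_basis_pos)
qed

lemma aff_reflect: "iv w = w \<Longrightarrow> aff (\<chi>, w) v i = \<chi> i + v (w i)"
  by (simp add: aff_apply)

text \<open>In type D the sign change at n preserves the alcove and has length zero; in types B and
  C it is the reflection in the last simple root.\<close>

lemma step_sgnc:
  assumes n: "1 \<le> n" and T: "T \<noteq> Type_A" and x: "inG T n x"
    and c: "aff x (delta n) (int n) < 0 \<or> aff (ginv x) (delta n) (int n) < 0"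
  shows "step T n x (gconj (0, sgnc (int n)) x)"
proof (cases "T = Type_D")
  case True
  have A: "iv (sgnc (int n)) = sgnc (int n)" using sgnc_signed[of "int n" n] n by auto
  show ?thesis
  proof (rule step_Omega)
    show "inG T n (0, sgnc (int n))" using T n by (intro inG_sgnc) auto
    fix \<alpha> assume "\<alpha> \<in> pos_roots T n"
    thus "0 < ip n (aff (0, sgnc (int n)) (delta n)) \<alpha> \<and> ip n (aff (0, sgnc (int n)) (delta n)) \<alpha> < 1"
    proof (cases rule: pos_roots_cases)
      case (diff i j)
      thus ?thesis using delta_bounds[of i n] delta_bounds[of j n] delta_mono[of i n j] Rn_minus[OF delta_Rn, of n j]
        by (auto simp: ip_diff_right ip_basis_pos aff_reflect[OF A] sgnc_def)
    next
      case (sum i j)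
      thus ?thesis using delta_bounds[of i n] delta_bounds[of j n] delta_mono[of i n j] Rn_minus[OF delta_Rn, of n j]
        by (auto simp: ip_add_right ip_basis_pos aff_reflect[OF A] sgnc_def)
    qed (use True in auto)
  qed
next
  case False
  define \<rho> where "\<rho> = (if T = Type_B then basis_vec (int n) else scale 2 (basis_vec (int n)))"
  have \<rho>: "T = Type_B \<and> \<rho> = basis_vec (int n) \<or> T = Type_C \<and> \<rho> = scale 2 (basis_vec (int n))"
    using T False by (cases T) (auto simp: \<rho>_def)
  show ?thesis
  proof (rule step_reflection[OF _ wall_refl_sgnc[OF n \<rho>] x])
    have "is_reflection n \<rho> (sgnc (int n))" using n \<rho> by (intro sgnc_reflection) auto
    thus "(0, sgnc (int n)) \<in> simple_affine_reflections T n"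
      using last_simple[OF n \<rho>] by (auto simp: simple_affine_reflections_def)
    show "ip n (aff x (delta n)) \<rho> < 0 \<or> ip n (aff (ginv x) (delta n)) \<rho> < 0"
      using c n \<rho> by (auto simp: ip_scale_right ip_basis_pos)
  qed
qed

text \<open>The reflection in the hyperplane x_1 = 1/2 is the affine generator in type C. In types B
  and D it maps the base alcove to itself and lies in \<open>Omega\<close>.\<close>

lemma step_top:
  assumes n: "1 \<le> n" and T: "T \<noteq> Type_A" and x: "inG T n x"
    and c: "1/2 < aff x (delta n) 1 \<or> 1/2 < aff (ginv x) (delta n) 1"
  shows "step T n x (gconj (basis_vec 1, sgnc 1) x)"
proof (cases "T = Type_C")
  case True
  show ?thesis
  proof (rule step_reflection[OF _ _ x, where good = "\<lambda>q. ip n q (scale 2 (basis_vec 1)) > 1"])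
    have "is_reflection n (scale 2 (basis_vec 1)) (sgnc 1)" using n by (intro sgnc_reflection) auto
    thus "(basis_vec 1, sgnc 1) \<in> simple_affine_reflections T n"
      using top_highest[OF n] coroot_top[OF n] True unfolding simple_affine_reflections_def
      by (intro UnI2 CollectI exI[of _ "scale 2 (basis_vec 1)"] exI[of _ "sgnc 1"]) simp
    show "wall_refl T n (basis_vec 1, sgnc 1) (\<lambda>q. 1 < ip n q (scale 2 (basis_vec 1)))"
      using wall_refl_top[OF n] True by simp
    show "1 < ip n (aff x (delta n)) (scale 2 (basis_vec 1)) \<or> 1 < ip n (aff (ginv x) (delta n)) (scale 2 (basis_vec 1))"
      using c n by (auto simp: ip_scale_right ip_basis_pos)
  qed
next
  case False
  have A: "iv (sgnc 1) = sgnc 1" using sgnc_signed[of 1 n] n by auto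
  have m: "delta n (- 1) = - delta n 1" by (rule Rn_minus[OF delta_Rn])
  have b: "1 \<le> i \<Longrightarrow> basis_vec 1 i = (if i = 1 then 1 else 0)" for i by (simp add: basis_vec_def)
  show ?thesis
  proof (rule step_Omega)
    show "inG T n (basis_vec 1, sgnc 1)" using T n by (intro inG_top) auto
    fix \<alpha> assume "\<alpha> \<in> pos_roots T n"
    thus "0 < ip n (aff (basis_vec 1, sgnc 1) (delta n)) \<alpha> \<and> ip n (aff (basis_vec 1, sgnc 1) (delta n)) \<alpha> < 1"
    proof (cases rule: pos_roots_cases)
      case (diff i j)
      thus ?thesis using delta_bounds[of i n] delta_bounds[of j n] delta_mono[of i n j] m
        by (auto simp: ip_diff_right ip_basis_pos aff_reflect[OF A] sgnc_def b)
    next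
      case (sum i j)
      thus ?thesis using delta_bounds[of i n] delta_bounds[of j n] delta_mono[of i n j] m
        by (auto simp: ip_add_right ip_basis_pos aff_reflect[OF A] sgnc_def b)
    next
      case (short i)
      thus ?thesis using delta_bounds[of i n] m
        by (auto simp: ip_basis_pos aff_reflect[OF A] sgnc_def b)
    qed (use False in auto)
  qed
qed

definition rot_perm :: "nat \<Rightarrow> int \<Rightarrow> int \<Rightarrow> int" where
  "rot_perm n j i = (if \<bar>i\<bar> \<le> int n then sgn i * (if \<bar>i\<bar> \<le> j then \<bar>i\<bar> + int n - j else \<bar>i\<bar> - j) else i)"

text \<open>An element of length zero in type A: it turns (v_1, ..., v_n) into (v_{j+1}, ..., v_n,
  v_1 - 1, ..., v_j - 1).\<close>

definition rot :: "nat \<Rightarrow> int \<Rightarrow> elt" where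
  "rot n j = ((\<lambda>i. if int n - j < \<bar>i\<bar> \<and> \<bar>i\<bar> \<le> int n then - of_int (sgn i) else 0), rot_perm n j)"

lemma rot_perm_sym:
  assumes "0 \<le> j" "j \<le> int n"
  shows "rot_perm n j \<in> sym_perms n" "iv (rot_perm n j) = rot_perm n (int n - j)"
proof -
  have *: "rot_perm n j (rot_perm n (int n - j) i) = i" "rot_perm n (int n - j) (rot_perm n j i) = i"
    "rot_perm n j (- i) = - rot_perm n j i" for i
    using assms by (auto simp: rot_perm_def sgn_if abs_if)
  have o: "rot_perm n j i = i" if "i \<notin> idx n" for i
    using that assms by (cases "i = 0") (auto simp: rot_perm_def idx_def)
  have s: "rot_perm n j \<in> signed_perms n" "iv (rot_perm n j) = rot_perm n (int n - j)"
    using signed_perms_inverses[of "rot_perm n j" "rot_perm n (int n - j)" n] * o by blast+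
  show "iv (rot_perm n j) = rot_perm n (int n - j)" by fact
  show "rot_perm n j \<in> sym_perms n" using s(1) assms by (auto simp: sym_perms_def rot_perm_def)
qed

lemma aff_rot:
  assumes "0 \<le> j" "j \<le> int n" "i \<in> {1..int n}"
  shows "aff (rot n j) v i = (if i \<le> int n - j then v (i + j) else v (i + j - int n) - 1)"
  using assms by (auto simp: rot_def aff_apply rot_perm_sym(2)) (auto simp: rot_perm_def algebra_simps)

lemma rot_grpA: "0 \<le> j \<Longrightarrow> j \<le> int n \<Longrightarrow> rot n j \<in> grpA n"
proof -
  assume j: "0 \<le> j" "j \<le> int n"
  have "fst (rot n j) \<in> Zn n"
    using j unfolding Zn_def rot_def by (auto intro!: RnI simp: idx_def)
  thus ?thesis using rot_perm_sym[OF j] by (simp add: grpA_def rot_def)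
qed

lemma step_rot:
  assumes j: "0 \<le> j" "j \<le> int n" shows "step Type_A n x (gconj (rot n j) x)"
proof (rule step_Omega)
  show "inG Type_A n (rot n j)" using rot_grpA[OF j] grpA_grp by (simp add: inG_def)
  fix \<alpha> assume "\<alpha> \<in> pos_roots Type_A n"
  thus "0 < ip n (aff (rot n j) (delta n)) \<alpha> \<and> ip n (aff (rot n j) (delta n)) \<alpha> < 1"
  proof (cases rule: pos_roots_cases)
    case (diff i k)
    have e: "ip n v \<alpha> = v i - v k" for v using diff by (simp add: ip_diff_right ip_basis_pos)
    have b: "1 \<le> l \<Longrightarrow> l \<le> int n \<Longrightarrow> 0 < delta n l \<and> delta n l < 1/2" for l
      using delta_bounds[of l n] by simp
    have m: "1 \<le> l \<Longrightarrow> l < l' \<Longrightarrow> l' \<le> int n \<Longrightarrow> delta n l' < delta n l" for l l'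
      using delta_mono[of l n l'] by simp
    consider "k \<le> int n - j" | "i \<le> int n - j" "int n - j < k" | "int n - j < i" by linarith
    thus ?thesis
    proof cases
      case 1
      thus ?thesis using j diff(1-3) b[of "i + j"] b[of "k + j"] m[of "i + j" "k + j"]
        by (simp add: e aff_rot)
    next
      case 2
      thus ?thesis using j diff(1-3) b[of "i + j"] b[of "k + j - int n"] m[of "k + j - int n" "i + j"]
        by (simp add: e aff_rot)
    next
      case 3
      thus ?thesis using j diff(1-3) b[of "i + j - int n"] b[of "k + j - int n"] m[of "i + j - int n" "k + j - int n"]
        by (simp add: e aff_rot)
    qed
  qed auto
qed

section \<open>Sorting\<close>

text \<open>For c = 1/2 the closed alcove of type C, which also serves types B and D. For c = 1 a
  compact piece of the closed alcove of type A, which by itself is unbounded in the direction (1,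
  ..., 1).\<close>

definition alc :: "real \<Rightarrow> nat \<Rightarrow> vec set" where
  "alc c n = {p \<in> Rn n. (\<forall>i. 1 \<le> i \<and> i < int n \<longrightarrow> p (i + 1) \<le> p i) \<and> 0 \<le> p (int n) \<and> p 1 \<le> c}"

definition roof :: "classical_type \<Rightarrow> real" where
  "roof T = (if T = Type_A then 1 else 1/2)"

lemma alc_Rn: "p \<in> alc c n \<Longrightarrow> p \<in> Rn n"
  by (simp add: alc_def)

lemma alc_mono:
  assumes p: "p \<in> alc c n" and i: "1 \<le> i" "i \<le> j" "j \<le> int n"
  shows "p j \<le> p i"
  using i(2,3)
proof (induction j rule: int_ge_induct)
  case (step j)
  hence "p (j + 1) \<le> p j" using p i(1) by (auto simp: alc_def)
  thus ?case using step by simp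
qed simp

lemma alc_bounds:
  assumes p: "p \<in> alc c n" and i: "i \<in> {1..int n}" shows "0 \<le> p i" "p i \<le> c"
  using alc_mono[OF p, of i "int n"] alc_mono[OF p, of 1 i] i p by (auto simp: alc_def)

text \<open>A weak inequality between coordinates that holds at the interior point cannot fail in
  the closed alcove. The bounds on \<open>delta n\<close> leave only k = 0, where \<open>p\<close>
  is ordered like \<open>delta n\<close>, and k \<le> -1, which differences of coordinates of
  \<open>p\<close> always satisfy.\<close>

lemma alc_le:
  assumes p: "p \<in> alc (roof T) n" and ab: "a \<in> idx n" "b \<in> idx n" and T: "T = Type_A \<Longrightarrow> 0 < a \<and> 0 < b"
    and le: "of_int k \<le> delta n a - delta n b"
  shows "of_int k \<le> p a - p b"
proof -
  have d: "\<bar>delta n i\<bar> < 1/2 \<and> \<bar>p i\<bar> \<le> roof T \<and> (0 < i \<longrightarrow> 0 < delta n i \<and> 0 \<le> p i) \<and> (i < 0 \<longrightarrow> delta n i < 0 \<and> p i \<le> 0)"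
    if "i \<in> idx n" for i
    using that delta_bounds[of i n] delta_bounds[of "-i" n] alc_bounds[OF p, of i] alc_bounds[OF p, of "-i"]
      Rn_minus[OF alc_Rn[OF p], of i] Rn_minus[OF delta_Rn, of n i]
    by (auto elim!: idx_cases)
  have k: "k < 1" using le d[OF ab(1)] d[OF ab(2)] by linarith
  show ?thesis
  proof (cases "k = 0")
    case False
    hence "k \<le> - 1" using k by simp
    hence "real_of_int k \<le> - 1" by linarith
    moreover have "- 1 \<le> p a - p b"
      using d[OF ab(1)] d[OF ab(2)] T by (cases "T = Type_A") (auto simp: roof_def)
    ultimately show ?thesis by linarith
  next
    case True
    hence le: "delta n b \<le> delta n a" using le by simp
    have "p b \<le> p a"
      using ab(1)
    proof (cases rule: idx_cases)
      case a: 1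
      show ?thesis using ab(2)
      proof (cases rule: idx_cases)
        case b: 1
        have "a \<le> b" using delta_mono[OF b a] le by fastforce
        thus ?thesis using alc_mono[OF p, of a b] a b by simp
      next
        case 2
        thus ?thesis using a d[OF ab(1)] d[OF ab(2)] by simp
      qed
    next
      case a: 2
      have "\<not> 0 < b" using d[OF ab(1)] d[OF ab(2)] a le by force
      hence b: "- b \<in> {1..int n}" using ab(2) by (auto elim!: idx_cases)
      have "- b \<le> - a" using delta_mono[OF a b] le Rn_minus[OF delta_Rn, of n a] Rn_minus[OF delta_Rn, of n b]
        by fastforce
      thus ?thesis
        using alc_mono[OF p, of "-b" "-a"] a b Rn_minus[OF alc_Rn[OF p], of a] Rn_minus[OF alc_Rn[OF p], of b]
        by simp
    qed
    thus ?thesis using True by simp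
  qed
qed

lemma alc_neg:
  assumes p: "p \<in> alc (1/2) n" and a: "a \<in> idx n" and le: "of_int k \<le> delta n a"
  shows "of_int k \<le> p a"
proof -
  have d: "\<bar>delta n a\<bar> < 1/2 \<and> \<bar>p a\<bar> \<le> 1/2 \<and> (0 < a \<longrightarrow> 0 \<le> p a) \<and> (a < 0 \<longrightarrow> delta n a < 0)"
    using a delta_bounds[of a n] delta_bounds[of "-a" n] alc_bounds[OF p, of a] alc_bounds[OF p, of "-a"]
      Rn_minus[OF alc_Rn[OF p], of a] Rn_minus[OF delta_Rn, of n a]
    by (auto elim!: idx_cases)
  have "k < 1" using le d by linarith
  show ?thesis
  proof (cases "k = 0")
    case True
    thus ?thesis using d le idx_nonzero[OF a] by auto
  next
    case False
    hence "real_of_int k \<le> - 1" using \<open>k < 1\<close> by linarith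
    thus ?thesis using d by linarith
  qed
qed

lemma alc_top:
  assumes p: "p \<in> alc (1/2) n" and a: "a \<in> idx n" and le: "delta n a \<le> 1/2 + of_int k"
  shows "p a \<le> 1/2 + of_int k"
proof -
  have d: "\<bar>delta n a\<bar> < 1/2 \<and> \<bar>p a\<bar> \<le> 1/2"
    using a delta_bounds[of a n] delta_bounds[of "-a" n] alc_bounds[OF p, of a] alc_bounds[OF p, of "-a"]
      Rn_minus[OF alc_Rn[OF p], of a] Rn_minus[OF delta_Rn, of n a]
    by (auto elim!: idx_cases)
  hence "- 1 < k" using le by linarith
  hence "0 \<le> real_of_int k" by linarith
  thus ?thesis using d by linarith
qed

section \<open>From the closed alcove to its interior point\<close>

lemma inG_iv_idx: "inG T n x \<Longrightarrow> i \<in> {1..int n} \<Longrightarrow> iv (snd x) i \<in> idx n"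
  using sp_idx[OF sp_iv[OF grpD(2)[OF inG_grp]], of T n x i] idxI[of i n] by simp

lemma inG_iv_pos: "inG Type_A n x \<Longrightarrow> i \<in> {1..int n} \<Longrightarrow> 0 < iv (snd x) i"
  using sym_perms_pos[OF sym_perms_iv, of "snd x" n i] by (auto simp: inG_def grpA_def)

lemma inG_int: "inG T n x \<Longrightarrow> fst x i \<in> \<int>"
  by (rule Zn_int[OF grpD(1)[OF inG_grp]])

text \<open>The contrapositive of \<open>alc_le\<close>, shifted by the integral translation of
  \<open>x\<close>. It permits testing walls at any point of the closed alcove, although lengths are
  read off at \<open>delta n\<close>.\<close>

lemma aff_delta_less:
  assumes x: "inG T n x" and p: "p \<in> alc (roof T) n" and ij: "i \<in> {1..int n}" "j \<in> {1..int n}"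
    and less: "aff x p i < aff x p j"
  shows "aff x (delta n) i < aff x (delta n) j"
proof (rule ccontr)
  assume "\<not> ?thesis"
  hence *: "fst x j - fst x i \<le> delta n (iv (snd x) i) - delta n (iv (snd x) j)" by (simp add: aff_apply)
  obtain k where k: "fst x j - fst x i = of_int k"
    using inG_int[OF x, of i] inG_int[OF x, of j] by (metis Ints_cases Ints_diff)
  have "of_int k \<le> p (iv (snd x) i) - p (iv (snd x) j)"
    by (rule alc_le[OF p]) (use * k ij x in \<open>auto intro: inG_iv_idx inG_iv_pos\<close>)
  thus False using less k by (simp add: aff_apply)
qed

lemma aff_delta_neg:
  assumes x: "inG T n x" and T: "T \<noteq> Type_A" and p: "p \<in> alc (roof T) n" and i: "i \<in> {1..int n}"
    and less: "aff x p i < 0"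
  shows "aff x (delta n) i < 0"
proof (rule ccontr)
  assume "\<not> ?thesis"
  hence *: "- fst x i \<le> delta n (iv (snd x) i)" by (simp add: aff_apply)
  obtain k where k: "- fst x i = of_int k"
    using inG_int[OF x, of i] by (metis Ints_cases Ints_minus)
  have "of_int k \<le> p (iv (snd x) i)"
    by (rule alc_neg) (use * k i x p T in \<open>auto intro: inG_iv_idx simp: roof_def\<close>)
  thus False using less k by (simp add: aff_apply)
qed

lemma aff_delta_top:
  assumes x: "inG T n x" and T: "T \<noteq> Type_A" and p: "p \<in> alc (roof T) n" and i: "i \<in> {1..int n}"
    and less: "1/2 < aff x p i"
  shows "1/2 < aff x (delta n) i"
proof (rule ccontr)
  assume "\<not> ?thesis"
  hence *: "delta n (iv (snd x) i) \<le> 1/2 + - fst x i" by (simp add: aff_apply)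
  obtain k where k: "- fst x i = of_int k"
    using inG_int[OF x, of i] by (metis Ints_cases Ints_minus)
  have "p (iv (snd x) i) \<le> 1/2 + of_int k"
    by (rule alc_top) (use * k i x p T in \<open>auto intro: inG_iv_idx simp: roof_def\<close>)
  thus False using less k by (simp add: aff_apply)
qed

text \<open>A conjugator \<open>y\<close> stands for the alcove that \<open>y\<close> maps onto the
  base alcove. Recording conjugators instead of conjugates keeps \<open>x0\<close>, and with it all
  displacements, fixed.\<close>

definition reachset :: "classical_type \<Rightarrow> nat \<Rightarrow> elt \<Rightarrow> elt \<Rightarrow> elt set" where
  "reachset T n w0 x0 = {y. inG T n y \<and> reaches T n w0 (gconj y x0)}"

lemma reachset_inG: "y \<in> reachset T n w0 x0 \<Longrightarrow> inG T n y"
  by (simp add: reachset_def)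

lemma inG_gconj: "inG T n y \<Longrightarrow> inG T n x \<Longrightarrow> inG T n (gconj y x)"
  by (simp add: inG_def gconj_grp gconj_grpA)

lemma reachset_step:
  assumes "y \<in> reachset T n w0 x0" "inG T n x0" "inG T n s" "step T n (gconj y x0) (gconj s (gconj y x0))"
  shows "gmul s y \<in> reachset T n w0 x0"
  using assms by (auto simp: reachset_def inG_gmul gconj_gmul[OF inG_grp inG_grp inG_grp] reaches_def)

text \<open>The conjugate by \<open>y\<close> acts at \<open>aff y u\<close> as \<open>x0\<close>
  acts at \<open>u\<close>, so the wall test only looks at the images of \<open>u\<close> under
  \<open>x0\<close> and its inverse.\<close>

lemma reachset_adj:
  assumes y: "y \<in> reachset T n w0 x0" and x0: "inG T n x0" and p: "aff y u \<in> alc (roof T) n"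
    and i: "1 \<le> i" "i < int n"
    and c: "aff y (aff x0 u) i < aff y (aff x0 u) (i + 1) \<or>
      aff y (aff (ginv x0) u) i < aff y (aff (ginv x0) u) (i + 1)"
  shows "gmul (0, adj i) y \<in> reachset T n w0 x0"
proof (rule reachset_step[OF y x0 inG_adj[OF i]], rule step_adj[OF i])
  note yG = reachset_inG[OF y]
  show xG: "inG T n (gconj y x0)" using yG x0 by (rule inG_gconj)
  have c': "aff (gconj y x0) (aff y u) i < aff (gconj y x0) (aff y u) (i + 1) \<or>
      aff (ginv (gconj y x0)) (aff y u) i < aff (ginv (gconj y x0)) (aff y u) (i + 1)"
    using c inG_grp[OF yG] inG_grp[OF x0] by (simp add: aff_gconj aff_gconj_inv)
  thus "aff (gconj y x0) (delta n) i < aff (gconj y x0) (delta n) (i + 1) \<or>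
    aff (ginv (gconj y x0)) (delta n) i < aff (ginv (gconj y x0)) (delta n) (i + 1)"
    using aff_delta_less[OF xG p, of i "i + 1"] aff_delta_less[OF inG_ginv[OF xG] p, of i "i + 1"] i by auto
qed

lemma reachset_sgnc:
  assumes y: "y \<in> reachset T n w0 x0" and x0: "inG T n x0" and p: "aff y u \<in> alc (roof T) n"
    and n: "1 \<le> n" and T: "T \<noteq> Type_A"
    and c: "aff y (aff x0 u) (int n) < 0 \<or> aff y (aff (ginv x0) u) (int n) < 0"
  shows "gmul (0, sgnc (int n)) y \<in> reachset T n w0 x0"
proof (rule reachset_step[OF y x0 inG_sgnc[OF T]], goal_cases)
  case 3
  note yG = reachset_inG[OF y]
  have xG: "inG T n (gconj y x0)" using yG x0 by (rule inG_gconj)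
  have c': "aff (gconj y x0) (aff y u) (int n) < 0 \<or> aff (ginv (gconj y x0)) (aff y u) (int n) < 0"
    using c inG_grp[OF yG] inG_grp[OF x0] by (simp add: aff_gconj aff_gconj_inv)
  show ?case
    by (rule step_sgnc[OF n T xG])
       (use c' n aff_delta_neg[OF xG T p, of "int n"] aff_delta_neg[OF inG_ginv[OF xG] T p, of "int n"] in auto)
qed (use n in auto)

lemma reachset_top:
  assumes y: "y \<in> reachset T n w0 x0" and x0: "inG T n x0" and p: "aff y u \<in> alc (roof T) n"
    and n: "1 \<le> n" and T: "T \<noteq> Type_A"
    and c: "1/2 < aff y (aff x0 u) 1 \<or> 1/2 < aff y (aff (ginv x0) u) 1"
  shows "gmul (basis_vec 1, sgnc 1) y \<in> reachset T n w0 x0"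
proof (rule reachset_step[OF y x0 inG_top[OF T n]])
  note yG = reachset_inG[OF y]
  have xG: "inG T n (gconj y x0)" using yG x0 by (rule inG_gconj)
  have c': "1/2 < aff (gconj y x0) (aff y u) 1 \<or> 1/2 < aff (ginv (gconj y x0)) (aff y u) 1"
    using c inG_grp[OF yG] inG_grp[OF x0] by (simp add: aff_gconj aff_gconj_inv)
  show "step T n (gconj y x0) (gconj (basis_vec 1, sgnc 1) (gconj y x0))"
    by (rule step_top[OF n T xG])
       (use c' n aff_delta_top[OF xG T p, of 1] aff_delta_top[OF inG_ginv[OF xG] T p, of 1] in auto)
qed

lemma reachset_rot:
  assumes "y \<in> reachset Type_A n w0 x0" "inG Type_A n x0" "0 \<le> j" "j \<le> int n"
  shows "gmul (rot n j) y \<in> reachset Type_A n w0 x0"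
  using assms rot_grpA[of j n] grpA_grp[of "rot n j" n]
  by (intro reachset_step step_rot) (auto simp: inG_def)

lemma adj_act:
  assumes "1 \<le> i" "i < int n" "v \<in> Rn n"
  shows "act (adj i) v = v - scale (v i - v (i + 1)) (basis_vec i - basis_vec (i + 1))"
proof -
  have "ip n (basis_vec i - basis_vec (i + 1)) (basis_vec i - basis_vec (i + 1)) = 2"
    using assms by (simp add: ip_diff_right ip_basis_pos) (simp add: basis_vec_def)
  hence "coroot n (basis_vec i - basis_vec (i + 1)) = basis_vec i - basis_vec (i + 1)"
    by (simp add: coroot_def scale_def fun_eq_iff)
  thus ?thesis using adj_reflection[OF assms(1,2)] assms
    by (simp add: is_reflection_def ip_diff_right ip_basis_pos)
qed

lemma sgnc_act:
  assumes "1 \<le> i" "i \<le> int n" "v \<in> Rn n"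
  shows "act (sgnc i) v = v - scale (2 * v i) (basis_vec i)"
proof -
  have "ip n (basis_vec i) (basis_vec i) = 1"
    using assms by (simp add: ip_basis_pos) (simp add: basis_vec_def)
  thus ?thesis using sgnc_reflection[of i n "basis_vec i"] assms
    by (simp add: is_reflection_def coroot_def ip_scale_right ip_basis_pos mult.commute)
qed

text \<open>Each triple a, b, m is a wall u_a - u_b = m through \<open>u\<close>, with
  \<open>D\<close> pointing to the side where the difference exceeds m; opposite indices give the
  walls on which 2 u_a is a constant integer. The condition is that \<open>x0\<close> or its inverse
  moves \<open>u\<close> strictly to that side.\<close>

definition crossable :: "nat \<Rightarrow> elt \<Rightarrow> vec \<Rightarrow> vec \<Rightarrow> bool" where
  "crossable n x0 u D \<longleftrightarrow> (\<forall>a \<in> idx n. \<forall>b \<in> idx n. \<forall>m \<in> \<int>. u a - u b = m \<and> D b < D a \<longrightarrow>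
     aff x0 u b + m < aff x0 u a \<or> aff (ginv x0) u b + m < aff (ginv x0) u a)"

lemma crossableD:
  assumes "crossable n x0 u D" "a \<in> idx n" "b \<in> idx n" "u a - u b = m" "m \<in> \<int>" "D b < D a"
  shows "aff x0 u b + m < aff x0 u a \<or> aff (ginv x0) u b + m < aff (ginv x0) u a"
  using assms unfolding crossable_def by blast

lemma finite_max:
  assumes "finite S" "S \<noteq> {}" obtains y where "y \<in> S" "\<And>z. z \<in> S \<Longrightarrow> f z \<le> (f y :: real)"
proof -
  have "Max (f ` S) \<in> f ` S" using assms by (intro Max_in) auto
  then obtain y where "y \<in> S" "f y = Max (f ` S)" by auto
  thus ?thesis using that[of y] assms by auto
qed

text \<open>Among the finitely many ways to carry \<open>u\<close> to \<open>p\<close>, one that maximises the pairing of the image of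
  \<open>D\<close> with \<open>delta n - p\<close> is sorted, since a further admissible reflection through \<open>p\<close> would increase it.\<close>

lemma sort:
  assumes n: "1 \<le> n" and y: "y \<in> reachset T n w0 x0" and x0: "inG T n x0" and u: "u \<in> Rn n" and D: "D \<in> Rn n"
    and p: "aff y u \<in> alc (roof T) n" and cr: "crossable n x0 u D"
  obtains y' where "y' \<in> reachset T n w0 x0" "aff y' u = aff y u"
    "\<And>i. 1 \<le> i \<Longrightarrow> i < int n \<Longrightarrow> aff y u i = aff y u (i + 1) \<Longrightarrow> act (snd y') D (i + 1) \<le> act (snd y') D i"
    "T \<noteq> Type_A \<Longrightarrow> aff y u (int n) = 0 \<Longrightarrow> 0 \<le> act (snd y') D (int n)"
    "T \<noteq> Type_A \<Longrightarrow> aff y u 1 = 1/2 \<Longrightarrow> act (snd y') D 1 \<le> 0"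
proof -
  define P where "P = aff y u"
  define S where "S = {z \<in> reachset T n w0 x0. aff z u = P}"
  define v where "v = delta n - P"
  have PR: "P \<in> Rn n" unfolding P_def by (rule alc_Rn[OF p])
  have SG: "inG T n z" if "z \<in> S" for z using that reachset_inG[of z T n w0 x0] by (simp add: S_def)
  \<comment> \<open>Given \<open>aff z u = P\<close>, the linear part of \<open>z\<close> determines
    its translation part, so only finitely many candidates exist.\<close>
  have "inj_on snd S"
  proof (rule inj_onI)
    fix z z' assume "z \<in> S" "z' \<in> S" "snd z = snd z'"
    thus "z = z'" by (auto simp: S_def aff_def prod_eq_iff)
  qed
  moreover have "snd ` S \<subseteq> signed_perms n" using SG grpD(2) inG_grp by blast
  ultimately have "finite S" by (metis finite_imageD finite_signed_perms finite_subset)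
  moreover have "y \<in> S" using y by (simp add: S_def P_def)
  hence "S \<noteq> {}" by blast
  ultimately obtain z where z: "z \<in> S" and
    max: "\<And>z'. z' \<in> S \<Longrightarrow> ip n v (act (snd z') D) \<le> ip n v (act (snd z) D)"
    by (rule finite_max[where f = "\<lambda>z. ip n v (act (snd z) D)"]) blast
  note zG = SG[OF z]
  have zr: "z \<in> reachset T n w0 x0" and zP: "aff z u = P" using z by (auto simp: S_def)
  have pz: "aff z u \<in> alc (roof T) n" using zP p by (simp add: P_def)
  define D' where "D' = act (snd z) D"
  have bz: "bij (snd z)" using zG inG_grp grp_bij by blast
  have D'R: "D' \<in> Rn n" unfolding D'_def by (rule act_Rn[OF grpD(2)[OF inG_grp[OF zG]] D])
  have D'i: "D' i = D (iv (snd z) i)" for i by (simp add: D'_def act_def)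
  have Pi: "P i = fst z i + u (iv (snd z) i)" for i using zP by (auto simp: aff_apply)
  have idxz: "iv (snd z) i \<in> idx n" if "i \<in> {1..int n}" for i using inG_iv_idx[OF zG that] .
  have new: "ip n v (act \<sigma> D') \<le> ip n v D'"
    if "gmul (\<chi>, \<sigma>) z \<in> reachset T n w0 x0" "bij \<sigma>" "aff (\<chi>, \<sigma>) P = P" for \<chi> \<sigma>
  proof -
    have "gmul (\<chi>, \<sigma>) z \<in> S" using that zP bz by (simp add: S_def aff_gmul)
    from max[OF this] show ?thesis by (simp add: gmul_def act_comp[OF that(2) bz] D'_def)
  qed
  have u_minus: "u (- i) = - u i" "D (- i) = - D i" for i
    using Rn_minus[OF u] Rn_minus[OF D] by auto
  have x_minus: "aff x0 u (- i) = - aff x0 u i" "aff (ginv x0) u (- i) = - aff (ginv x0) u i" for i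
    using Rn_minus[OF aff_Rn[OF inG_grp[OF x0] u]] Rn_minus[OF aff_Rn[OF ginv_grp[OF inG_grp[OF x0]] u]] by auto
  have c1: "D' (i + 1) \<le> D' i" if i: "1 \<le> i" "i < int n" and eq: "P i = P (i + 1)" for i
  proof (rule ccontr)
    assume less: "\<not> D' (i + 1) \<le> D' i"
    \<comment> \<open>The wall between positions i and i + 1, pulled back along \<open>z\<close>;
      the assumption says that \<open>D\<close> points beyond it.\<close>
    let ?a = "iv (snd z) (i + 1)" and ?b = "iv (snd z) i"
    have "u ?a - u ?b = fst z i - fst z (i + 1)" using eq Pi[of i] Pi[of "i + 1"] by simp
    moreover have "D ?b < D ?a" using less D'i by simp
    moreover have "fst z i - fst z (i + 1) \<in> \<int>" using inG_int[OF zG] by simp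
    ultimately have "aff x0 u ?b + (fst z i - fst z (i + 1)) < aff x0 u ?a \<or>
        aff (ginv x0) u ?b + (fst z i - fst z (i + 1)) < aff (ginv x0) u ?a"
      using idxz[of i] idxz[of "i + 1"] i by (intro crossableD[OF cr]) auto
    hence "aff z (aff x0 u) i < aff z (aff x0 u) (i + 1) \<or> aff z (aff (ginv x0) u) i < aff z (aff (ginv x0) u) (i + 1)"
      by (auto simp: aff_apply[of z])
    hence "gmul (0, adj i) z \<in> reachset T n w0 x0" by (rule reachset_adj[OF zr x0 pz i])
    moreover have "aff (0, adj i) P = P"
      using eq by (simp add: aff_def adj_act[OF i PR]) (simp add: scale_def fun_eq_iff)
    ultimately have "ip n v (act (adj i) D') \<le> ip n v D'" using sp_bij[OF adj_signed(1)[OF i]] by (intro new)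
    \<comment> \<open>The swap changes the pairing by this product. Its second factor is positive,
      because P agrees at the two positions while \<open>delta n\<close> strictly decreases.\<close>
    hence "(D' (i + 1) - D' i) * (v i - v (i + 1)) \<le> 0"
      using i by (simp add: adj_act[OF i D'R] ip_diff_right ip_scale_right ip_basis_pos algebra_simps)
    moreover have "0 < v i - v (i + 1)" using eq delta_mono[of i n "i + 1"] i by (simp add: v_def)
    ultimately show False using less by (simp add: mult_le_0_iff)
  qed
  have c2: "0 \<le> D' (int n)" if T: "T \<noteq> Type_A" and eq: "P (int n) = 0"
  proof (rule ccontr)
    assume less: "\<not> 0 \<le> D' (int n)"
    let ?b = "iv (snd z) (int n)"
    \<comment> \<open>The end wall, where the n-th coordinate vanishes, appears as a pair of
      opposite indices.\<close>
    have "u (- ?b) - u ?b = 2 * fst z (int n)" using eq Pi[of "int n"] u_minus by simp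
    moreover have "D ?b < D (- ?b)" using less D'i u_minus by simp
    moreover have "2 * fst z (int n) \<in> \<int>" using inG_int[OF zG] by simp
    ultimately have "aff x0 u ?b + 2 * fst z (int n) < aff x0 u (- ?b) \<or>
        aff (ginv x0) u ?b + 2 * fst z (int n) < aff (ginv x0) u (- ?b)"
      using idxz[of "int n"] n by (intro crossableD[OF cr]) auto
    hence "aff z (aff x0 u) (int n) < 0 \<or> aff z (aff (ginv x0) u) (int n) < 0"
      by (auto simp: aff_apply[of z] x_minus)
    hence "gmul (0, sgnc (int n)) z \<in> reachset T n w0 x0" by (rule reachset_sgnc[OF zr x0 pz n T])
    moreover have "aff (0, sgnc (int n)) P = P"
      using eq n by (simp add: aff_def sgnc_act[OF _ _ PR]) (simp add: scale_def fun_eq_iff)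
    ultimately have "ip n v (act (sgnc (int n)) D') \<le> ip n v D'"
      using sp_bij[OF sgnc_signed(1), of "int n" n] n by (intro new) auto
    hence "0 \<le> D' (int n) * v (int n)"
      using n by (simp add: sgnc_act[OF _ _ D'R] ip_diff_right ip_scale_right ip_basis_pos algebra_simps)
    moreover have "0 < v (int n)" using eq delta_bounds[of "int n" n] n by (simp add: v_def)
    ultimately show False using less by (simp add: zero_le_mult_iff)
  qed
  have c3: "D' 1 \<le> 0" if T: "T \<noteq> Type_A" and eq: "P 1 = 1/2"
  proof (rule ccontr)
    assume less: "\<not> D' 1 \<le> 0"
    let ?b = "iv (snd z) 1"
    have "u ?b - u (- ?b) = 1 - 2 * fst z 1" using eq Pi[of 1] u_minus by simp
    moreover have "D (- ?b) < D ?b" using less D'i u_minus by simp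
    moreover have "1 - 2 * fst z 1 \<in> \<int>" using inG_int[OF zG] by simp
    ultimately have "aff x0 u (- ?b) + (1 - 2 * fst z 1) < aff x0 u ?b \<or>
        aff (ginv x0) u (- ?b) + (1 - 2 * fst z 1) < aff (ginv x0) u ?b"
      using idxz[of 1] n by (intro crossableD[OF cr]) auto
    hence "1/2 < aff z (aff x0 u) 1 \<or> 1/2 < aff z (aff (ginv x0) u) 1"
      by (auto simp: aff_apply[of z] x_minus)
    hence "gmul (basis_vec 1, sgnc 1) z \<in> reachset T n w0 x0" by (rule reachset_top[OF zr x0 pz n T])
    moreover have "aff (basis_vec 1, sgnc 1) P = P"
      using eq n by (simp add: aff_def sgnc_act[OF _ _ PR]) (simp add: scale_def fun_eq_iff)
    ultimately have "ip n v (act (sgnc 1) D') \<le> ip n v D'"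
      using sp_bij[OF sgnc_signed(1), of 1 n] n by (intro new) auto
    hence "0 \<le> D' 1 * v 1"
      using n by (simp add: sgnc_act[OF _ _ D'R] ip_diff_right ip_scale_right ip_basis_pos algebra_simps)
    moreover have "v 1 < 0" using eq delta_bounds[of 1 n] n by (simp add: v_def)
    ultimately show False using less by (simp add: zero_le_mult_iff)
  qed
  show ?thesis
    by (rule that[OF zr]) (use zP c1 c2 c3 in \<open>auto simp: P_def D'_def\<close>)
qed

section \<open>Minimal displacement\<close>

lemma ev_nonneg:
  assumes "0 \<le> f" "f = 0 \<Longrightarrow> 0 \<le> g" shows "\<forall>\<^sub>F t in at_right (0::real). 0 \<le> f + t * g"
proof (cases "f = 0")
  case True
  thus ?thesis using assms(2) by (auto simp: eventually_at_right_less intro!: eventually_mono[OF eventually_at_right_less])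
next
  case False
  have "((\<lambda>t. f + t * g) \<longlongrightarrow> f + 0 * g) (at_right 0)" by (intro tendsto_intros)
  hence "\<forall>\<^sub>F t in at_right 0. 0 < f + t * g" using False assms(1) by (intro order_tendstoD) auto
  thus ?thesis by (rule eventually_mono) simp
qed

text \<open>A strict inequality survives small moves; a tight one only asks that \<open>D\<close>
  does not point outwards.\<close>

lemma alc_open:
  assumes n: "1 \<le> n" and p: "p \<in> alc c n" and D: "D \<in> Rn n"
    and "\<And>i. 1 \<le> i \<Longrightarrow> i < int n \<Longrightarrow> p i = p (i + 1) \<Longrightarrow> D (i + 1) \<le> D i"
    and "p (int n) = 0 \<Longrightarrow> 0 \<le> D (int n)" and "p 1 = c \<Longrightarrow> D 1 \<le> 0"
  obtains e where "0 < e" "\<And>t. 0 < t \<Longrightarrow> t < e \<Longrightarrow> p + scale t D \<in> alc c n"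
proof -
  have 1: "\<forall>\<^sub>F t in at_right 0. \<forall>i \<in> {1..<int n}. 0 \<le> (p i - p (i + 1)) + t * (D i - D (i + 1))"
    using assms p by (intro eventually_ball_finite ballI ev_nonneg) (auto simp: alc_def)
  have 2: "\<forall>\<^sub>F t in at_right 0. 0 \<le> p (int n) + t * D (int n)"
    using assms p by (intro ev_nonneg) (auto simp: alc_def)
  have 3: "\<forall>\<^sub>F t in at_right 0. 0 \<le> (c - p 1) + t * (- D 1)"
    using assms p by (intro ev_nonneg) (auto simp: alc_def)
  have "\<forall>\<^sub>F t in at_right 0. p + scale t D \<in> alc c n"
    using 1 2 3
  proof eventually_elim
    case (elim t)
    have "p (i + 1) + t * D (i + 1) \<le> p i + t * D i" if "1 \<le> i \<and> i < int n" for i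
      using elim(1) that by (auto simp: algebra_simps dest!: bspec[of _ _ i])
    thus ?case using elim(2,3) Rn_add[OF alc_Rn[OF p] Rn_scale[OF D, of t]]
      by (simp add: alc_def) (simp add: scale_def)
  qed
  then obtain e where "0 < e" "\<forall>t>0. t < e \<longrightarrow> p + scale t D \<in> alc c n"
    by (auto simp: eventually_at_right_field)
  thus ?thesis using that by blast
qed

lemma closed_Rn: "closed (Rn n)"
proof -
  have c: "continuous_on UNIV (\<lambda>v::vec. v i)" for i by (rule continuous_on_product_coordinates)
  show ?thesis unfolding Rn_def
    by (intro closed_Collect_conj closed_Collect_all closed_Collect_imp closed_Collect_eq c
        continuous_on_minus open_Collect_const continuous_on_const)
qed

text \<open>Vectors are functions on all integers with the product topology, so compactness comes
  from Tychonoff's theorem for a cube.\<close>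

lemma compact_alc: "compact (alc c n)"
proof -
  have cont: "continuous_on UNIV (\<lambda>v::vec. v i)" for i by (rule continuous_on_product_coordinates)
  have "alc c n = Rn n \<inter> ({p. \<forall>i. (1 \<le> i \<and> i < int n) \<longrightarrow> p (i + 1) \<le> p i} \<inter> ({p. 0 \<le> p (int n)} \<inter> {p. p 1 \<le> c}))"
    by (auto simp: alc_def)
  moreover have "closed {p :: vec. \<forall>i. (1 \<le> i \<and> i < int n) \<longrightarrow> p (i + 1) \<le> p i}"
    by (intro closed_Collect_all closed_Collect_imp closed_Collect_le cont open_Collect_const)
  moreover have "closed {p :: vec. 0 \<le> p (int n)}" "closed {p :: vec. p 1 \<le> c}"
    by (intro closed_Collect_le cont continuous_on_const)+
  ultimately have cl: "closed (alc c n)" using closed_Rn[of n] by (auto intro!: closed_Int)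
  have "compactin (product_topology (\<lambda>i::int. euclidean) UNIV) (PiE UNIV (\<lambda>i. {- \<bar>c\<bar>..\<bar>c\<bar>}))"
    by (subst compactin_PiE) auto
  hence "compact (PiE (UNIV :: int set) (\<lambda>i. {- \<bar>c\<bar>..\<bar>c\<bar>}))" 
    by (simp add: euclidean_product_topology)
  moreover have "alc c n \<subseteq> PiE (UNIV :: int set) (\<lambda>i. {- \<bar>c\<bar>..\<bar>c\<bar>})"
  proof
    fix p assume p: "p \<in> alc c n"
    have "\<bar>p i\<bar> \<le> \<bar>c\<bar>" for i
    proof (cases "i \<in> idx n")
      case True
      thus ?thesis using alc_bounds[OF p, of i] alc_bounds[OF p, of "-i"] Rn_minus[OF alc_Rn[OF p], of i]
        by (auto elim!: idx_cases)
    qed (simp add: Rn_outside[OF alc_Rn[OF p]])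
    thus "p \<in> PiE UNIV (\<lambda>i. {- \<bar>c\<bar>..\<bar>c\<bar>})" by (auto simp: abs_le_iff minus_le_iff)
  qed
  ultimately show ?thesis using cl by (metis compact_Int_closed inf.absorb2)
qed

section \<open>The displacement function and its minimum\<close>

definition energy :: "nat \<Rightarrow> elt \<Rightarrow> vec \<Rightarrow> real" where
  "energy n x p = ip n (aff x p - p) (aff x p - p)"

lemma energy_gconj:
  assumes "y \<in> grp n" "x \<in> grp n" "u \<in> Rn n"
  shows "energy n (gconj y x) (aff y u) = energy n x u"
proof -
  have "aff y (aff x u) - aff y u = act (snd y) (aff x u - u)" by (simp add: aff_def act_diff)
  thus ?thesis using assms
    by (simp add: energy_def aff_gconj ip_act[OF grpD(2)] Rn_diff aff_Rn)
qed

lemma continuous_energy: "continuous_on S (energy n x)"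
proof -
  have c: "continuous_on S (\<lambda>v::vec. v i)" for i
    by (rule continuous_on_subset[OF continuous_on_product_coordinates]) simp
  show ?thesis unfolding energy_def[abs_def] ip_def
    by (simp add: aff_apply) (intro continuous_intros c)
qed

lemma finite_Zn_bounded: "finite {v \<in> Zn n. \<forall>i \<in> {1..int n}. \<bar>v i\<bar> \<le> B}" (is "finite ?S")
proof -
  let ?f = "\<lambda>v. restrict (\<lambda>i. \<lfloor>v i\<rfloor>) {1..int n}"
  have "inj_on ?f ?S"
  proof (rule inj_onI)
    fix u v assume uv: "u \<in> ?S" "v \<in> ?S" "?f u = ?f v"
    show "u = v"
    proof (rule Rn_eqI)
      fix i assume i: "i \<in> {1..int n}"
      hence "\<lfloor>u i\<rfloor> = \<lfloor>v i\<rfloor>" using fun_cong[OF uv(3), of i] by simp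
      thus "u i = v i" using uv Zn_int[of u n i] Zn_int[of v n i] by (auto elim!: Ints_cases)
    qed (use uv Zn_Rn in auto)
  qed
  moreover have "?f ` ?S \<subseteq> PiE {1..int n} (\<lambda>i. {- \<lceil>B\<rceil>..\<lceil>B\<rceil>})"
  proof (intro image_subsetI PiE_I)
    fix v i assume v: "v \<in> ?S" and i: "i \<in> {1..int n}"
    obtain k where k: "v i = of_int k" using Zn_int[of v n i] v by (auto elim: Ints_cases)
    have "\<bar>real_of_int k\<bar> \<le> B" using v i k by force
    hence "real_of_int \<bar>k\<bar> \<le> of_int \<lceil>B\<rceil>" by linarith
    hence "\<bar>k\<bar> \<le> \<lceil>B\<rceil>" by (simp only: of_int_le_iff)
    thus "?f v i \<in> {- \<lceil>B\<rceil>..\<lceil>B\<rceil>}" using i k by auto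
  qed auto
  ultimately show ?thesis using finite_PiE[of "{1..int n}" "\<lambda>i. {- \<lceil>B\<rceil>..\<lceil>B\<rceil>}"]
    by (meson finite_atLeastAtMost_int finite_imageD finite_subset)
qed

lemma finite_grp_bounded:
  assumes "\<And>x. x \<in> X \<Longrightarrow> x \<in> grp n" "\<And>x i. x \<in> X \<Longrightarrow> i \<in> {1..int n} \<Longrightarrow> \<bar>fst x i\<bar> \<le> B"
  shows "finite X"
proof -
  have "X \<subseteq> {v \<in> Zn n. \<forall>i \<in> {1..int n}. \<bar>v i\<bar> \<le> B} \<times> signed_perms n"
  proof
    fix x assume "x \<in> X"
    thus "x \<in> {v \<in> Zn n. \<forall>i \<in> {1..int n}. \<bar>v i\<bar> \<le> B} \<times> signed_perms n"
      using assms[of x] grpD[of x n] by (cases x) auto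
  qed
  thus ?thesis by (rule finite_subset) (simp add: finite_Zn_bounded finite_signed_perms)
qed

lemma zero_alc: "0 \<le> c \<Longrightarrow> 0 \<in> alc c n"
  by (simp add: alc_def Rn_zero)

text \<open>A bound on the displacement bounds the translation part of a conjugate, so only finitely
  many conjugates compete, each of them with a minimum on the compact alcove.\<close>

lemma energy_min:
  assumes n: "1 \<le> n" and y0: "y0 \<in> reachset T n w0 x0" and x0: "inG T n x0"
  obtains y u where "y \<in> reachset T n w0 x0" "u \<in> Rn n" "aff y u \<in> alc (roof T) n"
    "\<And>y' u'. y' \<in> reachset T n w0 x0 \<Longrightarrow> u' \<in> Rn n \<Longrightarrow> aff y' u' \<in> alc (roof T) n \<Longrightarrow>
       energy n x0 u \<le> energy n x0 u'"
proof -
  let ?Y = "reachset T n w0 x0" and ?K = "alc (roof T) n"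
  have c: "0 \<le> roof T" "roof T \<le> 1" by (auto simp: roof_def)
  define X where "X = (\<lambda>y. gconj y x0) ` ?Y"
  have XG: "x \<in> grp n" if "x \<in> X" for x
    using that reachset_inG x0 inG_grp inG_gconj unfolding X_def by blast
  have K0: "0 \<in> ?K" using c by (rule_tac zero_alc)
  have ex: "\<exists>p \<in> ?K. \<forall>q \<in> ?K. energy n x p \<le> energy n x q" for x
    by (rule continuous_attains_inf[OF compact_alc _ continuous_energy]) (use K0 in auto)
  define m where "m x = (SOME p. p \<in> ?K \<and> (\<forall>q \<in> ?K. energy n x p \<le> energy n x q))" for x
  have m: "m x \<in> ?K" "q \<in> ?K \<Longrightarrow> energy n x (m x) \<le> energy n x q" for x q
    using someI_ex[of "\<lambda>p. p \<in> ?K \<and> (\<forall>q \<in> ?K. energy n x p \<le> energy n x q)"] ex[of x]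
    unfolding m_def by blast+
  define x1 where "x1 = gconj y0 x0"
  define e1 where "e1 = energy n x1 (m x1)"
  define X1 where "X1 = {x \<in> X. energy n x (m x) \<le> e1}"
  have x1: "x1 \<in> X1" using y0 by (auto simp: X1_def X_def x1_def e1_def)
  have "finite X1"
  proof (rule finite_grp_bounded)
    fix x assume x: "x \<in> X1"
    show xG: "x \<in> grp n" using x XG by (simp add: X1_def)
    fix i assume i: "i \<in> {1..int n}"
    let ?q = "aff x (m x) - m x"
    have "?q i * ?q i \<le> ip n ?q ?q"
      unfolding ip_def by (rule member_le_sum[OF i]) auto
    hence "(?q i)\<^sup>2 \<le> e1" using x by (simp add: X1_def energy_def power2_eq_square)
    hence q: "\<bar>?q i\<bar> \<le> sqrt e1" by (metis real_sqrt_abs real_sqrt_le_iff)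
    have b: "\<bar>m x j\<bar> \<le> 1" if "j \<in> idx n" for j
      using that alc_bounds[OF m(1)[of x], of j] alc_bounds[OF m(1)[of x], of "-j"] c
        Rn_minus[OF alc_Rn[OF m(1)[of x]], of j]
      by (auto elim!: idx_cases)
    have "iv (snd x) i \<in> idx n"
      using sp_idx[OF sp_iv[OF grpD(2)[OF xG]], of i] idxI[of i n] i by simp
    \<comment> \<open>The translation part is the displacement plus a difference of two coordinates
      of \<open>m x\<close>, each of modulus at most 1.\<close>
    from b[OF this] b[OF idxI[of i n]] show "\<bar>fst x i\<bar> \<le> sqrt e1 + 2" using q i by (auto simp: aff_apply)
  qed
  then obtain x where x: "x \<in> X1" and min: "\<And>x'. x' \<in> X1 \<Longrightarrow> energy n x (m x) \<le> energy n x' (m x')"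
    using finite_max[of X1 "\<lambda>x. - energy n x (m x)"] x1 by (metis empty_iff neg_le_iff_le)
  have minX: "energy n x (m x) \<le> energy n x' (m x')" if "x' \<in> X" for x'
    using min[of x'] that x by (cases "x' \<in> X1") (auto simp: X1_def)
  obtain y where y: "y \<in> ?Y" "x = gconj y x0" using x by (auto simp: X1_def X_def)
  note yG = inG_grp[OF reachset_inG[OF y(1)]]
  define u where "u = aff (ginv y) (m x)"
  have uR: "u \<in> Rn n" unfolding u_def by (rule aff_Rn[OF ginv_grp[OF yG] alc_Rn[OF m(1)]])
  have yu: "aff y u = m x" unfolding u_def by (rule aff_ginv'[OF grp_bij[OF yG]])
  show ?thesis
  proof (rule that[OF y(1) uR])
    show "aff y u \<in> ?K" using yu m by simp
    fix y' u' assume y': "y' \<in> ?Y" and u': "u' \<in> Rn n" "aff y' u' \<in> ?K"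
    note y'G = inG_grp[OF reachset_inG[OF y']]
    have "energy n x0 u = energy n x (m x)"
      using energy_gconj[OF yG inG_grp[OF x0] uR] yu y(2) by simp
    also have "\<dots> \<le> energy n (gconj y' x0) (m (gconj y' x0))" using y' by (intro minX) (auto simp: X_def)
    also have "\<dots> \<le> energy n (gconj y' x0) (aff y' u')" by (rule m(2)[OF u'(2)])
    also have "\<dots> = energy n x0 u'" by (rule energy_gconj[OF y'G inG_grp[OF x0] u'(1)])
    finally show "energy n x0 u \<le> energy n x0 u'" .
  qed
qed

text \<open>The second difference of the orbit of \<open>u\<close>, and minus one half of the
  gradient of \<open>energy n x\<close>. It vanishes exactly when x^-1 u, u, x u form an arithmetic
  progression.\<close>

definition lap :: "elt \<Rightarrow> vec \<Rightarrow> vec" where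
  "lap x u = aff x u + aff (ginv x) u - u - u"

lemma aff_scale_add: "aff x (u + scale t D) = aff x u + scale t (act (snd x) D)"
  by (simp add: aff_def act_add act_scale add.assoc)

lemma energy_lap:
  assumes x: "x \<in> grp n" and u: "u \<in> Rn n"
  shows "energy n x (u + scale t (lap x u)) = energy n x u - 2 * t * ip n (lap x u) (lap x u)
    + t\<^sup>2 * ip n (act (snd x) (lap x u) - lap x u) (act (snd x) (lap x u) - lap x u)"
proof -
  define D where "D = lap x u"
  define v where "v = aff x u - u"
  define h where "h = act (snd x) D - D"
  have w: "snd x \<in> signed_perms n" by (rule grpD(2)[OF x])
  have DR: "D \<in> Rn n" unfolding D_def lap_def
    by (intro Rn_diff Rn_add aff_Rn[OF x u] aff_Rn[OF ginv_grp[OF x] u] u)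
  have vR: "v \<in> Rn n" unfolding v_def by (intro Rn_diff aff_Rn[OF x u] u)
  have e: "aff x (u + scale t D) - (u + scale t D) = v + scale t h"
    by (simp add: aff_scale_add v_def h_def) (simp add: scale_def fun_eq_iff algebra_simps)
  \<comment> \<open>Moving the linear part across the form turns the first-order term into -2 t
    times the squared norm of \<open>D\<close>.\<close>
  have "act (iv (snd x)) v = u - aff (ginv x) u"
    using x by (simp add: v_def aff_def ginv_def act_add act_diff act_uminus act_comp[symmetric] sp_bij[OF w]
        bij_imp_bij_inv inv_o_cancel bij_is_inj[OF sp_bij[OF w]] act_id)
  hence "ip n v (act (snd x) D) = ip n (u - aff (ginv x) u) D"
    using ip_act_left[OF sp_iv[OF w] vR DR] sp_iv_iv[OF w] by simp
  moreover have "ip n D D = ip n (aff x u) D + ip n (aff (ginv x) u) D - ip n u D - ip n u D"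
    using ip_diff_left ip_add_left lap_def[of x u] D_def by metis
  ultimately have vh: "ip n v h = - ip n D D"
    unfolding h_def ip_diff_right by (simp add: v_def ip_diff_left)
  have c: "ip n h v = ip n v h" by (simp add: ip_def mult.commute)
  show ?thesis unfolding energy_def D_def[symmetric] e
    by (simp add: v_def[symmetric] h_def[symmetric] ip_add_left ip_add_right ip_scale_left ip_scale_right c vh
        power2_eq_square algebra_simps)
qed

text \<open>\<open>lap x0 u\<close> adds up the displacements of \<open>u\<close> under
  \<open>x0\<close> and its inverse; if the sum points beyond a wall, so does one of the
  two.\<close>

lemma lap_crossable: "crossable n x0 u (lap x0 u)"
  unfolding crossable_def
proof (intro ballI impI)
  fix a b m assume "u a - u b = m \<and> lap x0 u b < lap x0 u a"
  hence e: "u a = u b + m" "lap x0 u b < lap x0 u a" by auto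
  hence "aff x0 u b + aff (ginv x0) u b + 2 * m < aff x0 u a + aff (ginv x0) u a"
    unfolding lap_def by simp
  thus "aff x0 u b + m < aff x0 u a \<or> aff (ginv x0) u b + m < aff (ginv x0) u a" by linarith
qed

lemma ip_self_zero: "v \<in> Rn n \<Longrightarrow> ip n v v \<le> 0 \<Longrightarrow> v = 0"
proof (rule Rn_eqI[OF _ Rn_zero])
  fix i assume v: "ip n v v \<le> 0" and i: "i \<in> {1..int n}"
  have "v i * v i \<le> ip n v v" unfolding ip_def by (rule member_le_sum[OF i]) auto
  hence "v i * v i \<le> 0" using v by linarith
  hence "v i = 0" by (metis mult_eq_0_iff not_square_less_zero order_le_less)
  thus "v i = 0 i" by simp
qed

text \<open>Sorting yields a reachable alcove that contains \<open>u\<close> and into which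
  \<open>lap x0 u\<close> points; a short move along it would lower the energy unless it is zero. In
  type A the end faces of \<open>alc\<close> do not lie on root hyperplanes, hence the strict bounds
  there.\<close>

lemma lap_zero_if_min:
  assumes n: "1 \<le> n" and y: "y \<in> reachset T n w0 x0" and x0: "inG T n x0" and u: "u \<in> Rn n"
    and p: "aff y u \<in> alc (roof T) n" and A: "T = Type_A \<Longrightarrow> 0 < aff y u (int n) \<and> aff y u 1 < 1"
    and min: "\<And>y' u'. y' \<in> reachset T n w0 x0 \<Longrightarrow> u' \<in> Rn n \<Longrightarrow> aff y' u' \<in> alc (roof T) n \<Longrightarrow>
       energy n x0 u \<le> energy n x0 u'"
  shows "lap x0 u = 0"
proof -
  define D where "D = lap x0 u"
  note xG = inG_grp[OF x0]
  have DR: "D \<in> Rn n" unfolding D_def lap_def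
    by (intro Rn_diff Rn_add aff_Rn[OF xG u] aff_Rn[OF ginv_grp[OF xG] u] u)
  obtain z where z: "z \<in> reachset T n w0 x0" "aff z u = aff y u"
    "\<And>i. 1 \<le> i \<Longrightarrow> i < int n \<Longrightarrow> aff y u i = aff y u (i + 1) \<Longrightarrow> act (snd z) D (i + 1) \<le> act (snd z) D i"
    "T \<noteq> Type_A \<Longrightarrow> aff y u (int n) = 0 \<Longrightarrow> 0 \<le> act (snd z) D (int n)"
    "T \<noteq> Type_A \<Longrightarrow> aff y u 1 = 1/2 \<Longrightarrow> act (snd z) D 1 \<le> 0"
    using sort[OF n y x0 u DR p] lap_crossable unfolding D_def by metis
  note zG = inG_grp[OF reachset_inG[OF z(1)]]
  obtain e where e: "0 < e" "\<And>t. 0 < t \<Longrightarrow> t < e \<Longrightarrow> aff y u + scale t (act (snd z) D) \<in> alc (roof T) n"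
  proof (rule alc_open[OF n p act_Rn[OF grpD(2)[OF zG] DR]])
    show "aff y u (int n) = 0 \<Longrightarrow> 0 \<le> act (snd z) D (int n)" using z(4) A by fastforce
    show "aff y u 1 = roof T \<Longrightarrow> act (snd z) D 1 \<le> 0" using z(5) A by (fastforce simp: roof_def split: if_splits)
  qed (use z(3) in auto)
  define a where "a = ip n D D"
  define b where "b = ip n (act (snd x0) D - D) (act (snd x0) D - D)"
  have le: "2 * a \<le> t * b" if t: "0 < t" "t < e" for t
  proof -
    have "aff z (u + scale t D) \<in> alc (roof T) n" using e(2)[OF t] by (simp add: aff_scale_add z(2))
    hence "energy n x0 u \<le> energy n x0 (u + scale t D)"
      by (intro min[OF z(1)] Rn_add u Rn_scale DR)
    hence "2 * t * a \<le> t\<^sup>2 * b" using energy_lap[OF xG u, of t] by (simp add: a_def b_def D_def)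
    hence "t * (2 * a) \<le> t * (t * b)" by (simp add: power2_eq_square ac_simps)
    thus ?thesis using t(1) by simp
  qed
  have "((\<lambda>t. t * b) \<longlongrightarrow> 0 * b) (at_right 0)" by (intro tendsto_intros)
  moreover have "\<forall>\<^sub>F t in at_right 0. 2 * a \<le> t * b"
    unfolding eventually_at_right_field using le e(1) by blast
  ultimately have "2 * a \<le> 0 * b" by (rule tendsto_lowerbound) simp
  hence "D = 0" using ip_self_zero[OF DR] by (simp add: a_def)
  thus ?thesis by (simp add: D_def)
qed

section \<open>The direction (1, ..., 1) in type A\<close>

definition ones :: "nat \<Rightarrow> vec" where
  "ones n = (\<lambda>i. if i \<in> idx n then of_int (sgn i) else 0)"

lemma ones_Rn: "ones n \<in> Rn n"
  by (intro RnI) (auto simp: ones_def)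

lemma ones_pos: "i \<in> {1..int n} \<Longrightarrow> ones n i = 1"
  by (simp add: ones_def idx_def)

lemma act_ones:
  assumes "w \<in> sym_perms n" shows "act w (ones n) = ones n"
proof (rule Rn_eqI[OF act_Rn[OF sym_perms_signed[OF assms] ones_Rn] ones_Rn])
  fix i assume "i \<in> {1..int n}"
  thus "act w (ones n) i = ones n i"
    using sym_perms_pos[OF sym_perms_iv[OF assms]] by (simp add: act_def ones_pos)
qed

lemma aff_ones: "x \<in> grpA n \<Longrightarrow> aff x (u + scale r (ones n)) = aff x u + scale r (ones n)"
  by (simp add: aff_scale_add act_ones grpA_def mem_Times_iff)

lemma energy_ones: "x \<in> grpA n \<Longrightarrow> energy n x (u + scale r (ones n)) = energy n x u"
  by (simp add: energy_def aff_ones)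

lemma alc_shift_A:
  assumes n: "1 \<le> n" and y: "inG Type_A n y" and u: "u \<in> Rn n"
    and mono: "\<And>i. 1 \<le> i \<Longrightarrow> i < int n \<Longrightarrow> aff y u (i + 1) \<le> aff y u i"
    and less: "aff y u 1 - aff y u (int n) < 1"
  obtains r where "aff y (u + scale r (ones n)) \<in> alc 1 n"
    "0 < aff y (u + scale r (ones n)) (int n)" "aff y (u + scale r (ones n)) 1 < 1"
proof
  \<comment> \<open>With this shift the first and the last coordinate add up to 1, so both ends get
    the same room.\<close>
  define r where "r = (1 - aff y u 1 - aff y u (int n)) / 2"
  have e: "aff y (u + scale r (ones n)) = aff y u + scale r (ones n)"
    using y by (intro aff_ones) (simp add: inG_def)
  have i: "aff y (u + scale r (ones n)) i = aff y u i + r" if "i \<in> {1..int n}" for i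
    using that unfolding e by (simp add: scale_def ones_pos)
  show "0 < aff y (u + scale r (ones n)) (int n)" "aff y (u + scale r (ones n)) 1 < 1"
    using i[of 1] i[of "int n"] n less by (simp_all, simp_all add: r_def field_simps)
  thus "aff y (u + scale r (ones n)) \<in> alc 1 n"
    using i mono aff_Rn[OF inG_grp[OF y] Rn_add[OF u Rn_scale[OF ones_Rn]], of r] by (auto simp: alc_def)
qed

text \<open>Cutting the cyclic order at a strict descent leaves room at both ends.\<close>

lemma rotate_A:
  assumes n: "1 \<le> n" and y: "y \<in> reachset Type_A n w0 x0" and x0: "inG Type_A n x0" and u: "u \<in> Rn n"
    and p: "aff y u \<in> alc 1 n"
  obtains y' u' where "y' \<in> reachset Type_A n w0 x0" "u' \<in> Rn n" "aff y' u' \<in> alc 1 n"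
    "0 < aff y' u' (int n)" "aff y' u' 1 < 1" "energy n x0 u' = energy n x0 u"
proof -
  let ?Y = "reachset Type_A n w0 x0"
  note result = that
  have x0A: "x0 \<in> grpA n" using x0 by (simp add: inG_def)
  have *: thesis if z: "z \<in> ?Y" and mono: "\<And>i. 1 \<le> i \<Longrightarrow> i < int n \<Longrightarrow> aff z u (i + 1) \<le> aff z u i"
    and less: "aff z u 1 - aff z u (int n) < 1" for z
  proof -
    obtain r where "aff z (u + scale r (ones n)) \<in> alc 1 n"
      "0 < aff z (u + scale r (ones n)) (int n)" "aff z (u + scale r (ones n)) 1 < 1"
      by (rule alc_shift_A[OF n reachset_inG[OF z] u mono less])
    thus thesis by (intro result[OF z Rn_add[OF u Rn_scale[OF ones_Rn]]] energy_ones[OF x0A])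
  qed
  define P where "P = aff y u"
  have P: "P \<in> alc 1 n" using p by (simp add: P_def)
  show thesis
  proof (cases "P 1 - P (int n) < 1")
    case True
    thus thesis using * y P by (auto simp: P_def alc_def)
  next
    case False
    hence e: "P 1 = 1" "P (int n) = 0" using P by (auto simp: alc_def)
    have "\<exists>j. 1 \<le> j \<and> j < int n \<and> P (j + 1) < P j"
    proof (rule ccontr)
      assume "\<not> ?thesis"
      hence c: "1 \<le> j \<Longrightarrow> j < int n \<Longrightarrow> P j \<le> P (j + 1)" for j by force
      have "1 \<le> j \<Longrightarrow> j \<le> int n \<Longrightarrow> P 1 \<le> P j" for j
      proof (induction j rule: int_ge_induct)
        case (step j) thus ?case using c[of j] by simp
      qed simp
      from this[of "int n"] show False using n e by simp
    qed
    then obtain j where j: "1 \<le> j" "j < int n" "P (j + 1) < P j" by blast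
    define z where "z = gmul (rot n j) y"
    have z: "z \<in> ?Y" unfolding z_def by (rule reachset_rot[OF y x0]) (use j in auto)
    have rG: "rot n j \<in> grp n" using rot_grpA[of j n] grpA_grp j by auto
    have zi: "aff z u i = (if i \<le> int n - j then P (i + j) else P (i + j - int n) - 1)" if "i \<in> {1..int n}" for i
      unfolding z_def P_def
      using aff_rot[of j n i "aff y u"] j that
      by (simp add: aff_gmul grp_bij[OF rG] grp_bij[OF inG_grp[OF reachset_inG[OF y]]])
    show thesis
    proof (rule *[OF z])
      \<comment> \<open>The first coordinate is now P_{j+1} and the last one P_j - 1.\<close>
      show "aff z u 1 - aff z u (int n) < 1" using j n by (simp add: zi add.commute)
      fix i assume i: "1 \<le> i" "i < int n"
      have P': "P (l + 1) \<le> P l" if "1 \<le> l" "l < int n" for l using P that by (simp add: alc_def)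
      consider "i + 1 \<le> int n - j" | "i = int n - j" | "int n - j < i" by linarith
      thus "aff z u (i + 1) \<le> aff z u i"
      proof cases
        case 1 thus ?thesis using i j P'[of "i + j"] by (simp add: zi add.commute add.left_commute)
      next
        case 2
        \<comment> \<open>At the seam P_n = 0 is followed by P_1 - 1 = 0.\<close>
        thus ?thesis using i j e alc_bounds[OF P, of 1] by (simp add: zi)
      next
        case 3 thus ?thesis using i j P'[of "i + j - int n"] by (simp add: zi algebra_simps)
      qed
    qed
  qed
qed

text \<open>In type A the minimiser may touch an end face. Rotation and shift free it at equal
  energy, so the new point is a minimiser too.\<close>

lemma reach_translation_point:
  assumes n: "1 \<le> n" and y: "y \<in> reachset T n w0 x0" and x0: "inG T n x0"
  obtains y' u where "y' \<in> reachset T n w0 x0" "u \<in> Rn n" "aff y' u \<in> alc (roof T) n" "lap x0 u = 0"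
    "T = Type_A \<Longrightarrow> aff y' u 1 < 1"
proof -
  obtain z u where z: "z \<in> reachset T n w0 x0" "u \<in> Rn n" "aff z u \<in> alc (roof T) n" and
    min: "\<And>y' u'. y' \<in> reachset T n w0 x0 \<Longrightarrow> u' \<in> Rn n \<Longrightarrow> aff y' u' \<in> alc (roof T) n \<Longrightarrow>
       energy n x0 u \<le> energy n x0 u'"
    using energy_min[OF n y x0] by metis
  show ?thesis
  proof (cases "T = Type_A")
    case False
    show ?thesis by (rule that[OF z lap_zero_if_min[OF n z(1) x0 z(2,3) _ min]]) (use False in auto)
  next
    case True
    obtain z' u' where z': "z' \<in> reachset T n w0 x0" "u' \<in> Rn n" "aff z' u' \<in> alc (roof T) n"
      "0 < aff z' u' (int n)" "aff z' u' 1 < 1" "energy n x0 u' = energy n x0 u"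
      using rotate_A[of n z w0 x0 u] n z x0 True by (auto simp: roof_def)
    show ?thesis
      by (rule that[OF z'(1-3) lap_zero_if_min[OF n z'(1) x0 z'(2,3) _ min[folded z'(6)]]]) (use z'(4,5) in auto)
  qed
qed

section \<open>Moving along paths\<close>

lemma closed_alc_path:
  assumes "x \<in> grp n" "u \<in> Rn n" "d \<in> Rn n"
  shows "closed {s. aff x (u + scale s d) \<in> alc c n}"
proof -
  have i: "aff x (u + scale s d) i = aff x u i + s * act (snd x) d i" for s i
    by (simp add: aff_scale_add) (simp add: scale_def)
  have "{s. aff x (u + scale s d) \<in> alc c n} =
      {s. \<forall>i. 1 \<le> i \<and> i < int n \<longrightarrow> aff x u (i + 1) + s * act (snd x) d (i + 1) \<le> aff x u i + s * act (snd x) d i}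
      \<inter> ({s. 0 \<le> aff x u (int n) + s * act (snd x) d (int n)} \<inter> {s. aff x u 1 + s * act (snd x) d 1 \<le> c})"
    using aff_Rn[OF assms(1) Rn_add[OF assms(2) Rn_scale[OF assms(3)]]] unfolding alc_def i by auto
  thus ?thesis
    by (auto intro!: closed_Int closed_Collect_all closed_Collect_imp closed_Collect_le continuous_intros
        open_Collect_const)
qed

text \<open>The parameters whose point lies in some reachable alcove form a compact set, since
  finitely many alcoves suffice to cover it. At its largest element, sorting allows a further move
  unless the end of the segment is reached.\<close>

lemma path:
  assumes n: "1 \<le> n" and T: "T \<noteq> Type_A" and y: "y \<in> reachset T n w0 x0" and x0: "inG T n x0"
    and u: "u \<in> Rn n" and d: "d \<in> Rn n" and p: "aff y u \<in> alc (roof T) n"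
    and cr: "\<And>s. 0 \<le> s \<Longrightarrow> s < 1 \<Longrightarrow> crossable n x0 (u + scale s d) d"
  obtains y' where "y' \<in> reachset T n w0 x0" "aff y' (u + d) \<in> alc (roof T) n"
proof -
  let ?Y = "reachset T n w0 x0" and ?K = "alc (roof T) n"
  let ?q = "\<lambda>s. u + scale s d"
  define F where "F = {z \<in> ?Y. \<exists>s \<in> {0..1}. aff z (?q s) \<in> ?K}"
  define S where "S = (\<Union>z\<in>F. {s. aff z (?q s) \<in> ?K} \<inter> {0..1})"
  \<comment> \<open>Bounds the translation part of every conjugator that brings a point of the
    segment into the alcove, where coordinates are at most 1.\<close>
  define B where "B = (\<Sum>i\<in>idx n. \<bar>u i\<bar> + \<bar>d i\<bar>) + 1"
  have qR: "?q s \<in> Rn n" for s by (intro Rn_add Rn_scale u d)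
  have FG: "z \<in> grp n" if "z \<in> F" for z using that reachset_inG inG_grp unfolding F_def by blast
  have "finite F"
  proof (rule finite_grp_bounded)
    fix z assume z: "z \<in> F"
    show "z \<in> grp n" by (rule FG[OF z])
    fix i assume i: "i \<in> {1..int n}"
    obtain s where s: "0 \<le> s" "s \<le> 1" "aff z (?q s) \<in> ?K" using z by (auto simp: F_def)
    have j: "iv (snd z) i \<in> idx n"
      using sp_idx[OF sp_iv[OF grpD(2)[OF FG[OF z]]], of i] idxI[of i n] i by simp
    have "\<bar>u j\<bar> + \<bar>d j\<bar> \<le> B - 1" if "j \<in> idx n" for j
      unfolding B_def using member_le_sum[OF that, of "\<lambda>i. \<bar>u i\<bar> + \<bar>d i\<bar>"] by simp
    from this[OF j] have "\<bar>u (iv (snd z) i)\<bar> + \<bar>d (iv (snd z) i)\<bar> \<le> B - 1" .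
    moreover have "\<bar>s * d (iv (snd z) i)\<bar> \<le> \<bar>d (iv (snd z) i)\<bar>"
      using s by (simp add: abs_mult mult_left_le_one_le)
    moreover have "\<bar>aff z (?q s) i\<bar> \<le> 1"
      using alc_bounds[OF s(3) i] T by (simp add: roof_def)
    moreover have "aff z (?q s) i = fst z i + (u (iv (snd z) i) + s * d (iv (snd z) i))"
      by (simp add: aff_apply) (simp add: scale_def)
    ultimately show "\<bar>fst z i\<bar> \<le> B" by linarith
  qed
  moreover have "compact ({s. aff z (?q s) \<in> ?K} \<inter> {0..1})" if "z \<in> F" for z
    by (rule closed_Int_compact[OF closed_alc_path[OF FG[OF that] u d]]) simp
  ultimately have "compact S" unfolding S_def by (intro compact_UN) auto
  have yF: "y \<in> F" unfolding F_def using y p by (auto intro!: bexI[of _ 0]) (simp add: scale_def zero_fun_def[symmetric])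
  have "0 \<in> S" unfolding S_def using yF p by (auto intro!: bexI[OF _ yF]) (simp add: scale_def zero_fun_def[symmetric])
  then obtain s where s: "s \<in> S" and max: "\<And>t. t \<in> S \<Longrightarrow> t \<le> s"
    using compact_attains_sup[OF \<open>compact S\<close>] by blast
  obtain z where z: "z \<in> ?Y" "aff z (?q s) \<in> ?K" "0 \<le> s" "s \<le> 1"
    using s by (auto simp: S_def F_def)
  have "s = 1"
  proof (rule ccontr)
    assume "s \<noteq> 1"
    hence s1: "s < 1" using z by simp
    obtain z' where z': "z' \<in> ?Y" "aff z' (?q s) = aff z (?q s)"
      "\<And>i. 1 \<le> i \<Longrightarrow> i < int n \<Longrightarrow> aff z (?q s) i = aff z (?q s) (i + 1) \<Longrightarrow> act (snd z') d (i + 1) \<le> act (snd z') d i"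
      "T \<noteq> Type_A \<Longrightarrow> aff z (?q s) (int n) = 0 \<Longrightarrow> 0 \<le> act (snd z') d (int n)"
      "T \<noteq> Type_A \<Longrightarrow> aff z (?q s) 1 = 1/2 \<Longrightarrow> act (snd z') d 1 \<le> 0"
      using sort[OF n z(1) x0 qR d z(2) cr[OF z(3) s1]] by metis
    have z'G: "z' \<in> grp n" using z'(1) reachset_inG inG_grp by blast
    obtain e where e: "0 < e" "\<And>t. 0 < t \<Longrightarrow> t < e \<Longrightarrow> aff z (?q s) + scale t (act (snd z') d) \<in> ?K"
      by (rule alc_open[OF n z(2) act_Rn[OF grpD(2)[OF z'G] d]]) (use z' T in \<open>auto simp: roof_def\<close>)
    define t where "t = min (e / 2) (1 - s)"
    have t: "0 < t" "t < e" "s + t \<le> 1" using e(1) s1 by (auto simp: t_def)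
    have "?q (s + t) = ?q s + scale t d" by (simp add: scale_def fun_eq_iff algebra_simps)
    hence K: "aff z' (?q (s + t)) \<in> ?K"
      using e(2)[OF t(1,2)] aff_scale_add[of z' "?q s" t d] z'(2) by (simp only:)
    hence "z' \<in> F" using z'(1) t z(3) unfolding F_def by (auto intro!: bexI[of _ "s + t"])
    hence "s + t \<in> S" using K t z(3) unfolding S_def by auto
    thus False using max[of "s + t"] t by simp
  qed
  thus ?thesis using z that[of z] by (simp add: scale_def)
qed

section \<open>Straightening the cycles of nonzero slope\<close>

text \<open>A homotopy from the identity at s = 0 to a map that contracts each [k, k + 1) onto [k +
  1/8, k + 3/8) at s = 1 and commutes with integral shifts. The margins keep the image away from all
  half-integers.\<close>

definition squash :: "real \<Rightarrow> real \<Rightarrow> real" where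
  "squash s t = t + s * (1/8 - 3/4 * frac t)"

lemma squash_add: "k \<in> \<int> \<Longrightarrow> squash s (t + k) = squash s t + k"
  by (elim Ints_cases) (simp add: squash_def frac_def)

text \<open>Within a unit interval the slope is 1 - 3/4 s > 0, and at an integer the function can
  only jump upwards.\<close>

lemma squash_strict_mono:
  assumes s: "0 \<le> s" "s \<le> 1" and t: "t < t'" shows "squash s t < squash s t'"
proof -
  have e: "squash s r = of_int \<lfloor>r\<rfloor> + (1 - 3/4 * s) * frac r + s / 8" for r
    by (simp add: squash_def frac_def algebra_simps)
  have f: "0 \<le> frac r" "frac r < 1" for r :: real by (simp_all add: frac_lt_1)
  show ?thesis
  proof (cases "\<lfloor>t\<rfloor> = \<lfloor>t'\<rfloor>")
    case True
    hence "frac t < frac t'" using t by (simp add: frac_def)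
    thus ?thesis unfolding e using True s by simp
  next
    case False
    hence "\<lfloor>t\<rfloor> + 1 \<le> \<lfloor>t'\<rfloor>" using floor_mono[of t t'] t by linarith
    hence "real_of_int (\<lfloor>t\<rfloor> + 1) \<le> of_int \<lfloor>t'\<rfloor>" by (simp only: of_int_le_iff)
    moreover have "(1 - 3/4 * s) * frac t < 1" 
    proof -
      have "(1 - 3/4 * s) * frac t \<le> 1 * frac t" using s f by (intro mult_right_mono) auto
      thus ?thesis using f[of t] by linarith
    qed
    moreover have "0 \<le> (1 - 3/4 * s) * frac t'" using s f by (intro mult_nonneg_nonneg) auto
    ultimately show ?thesis unfolding e by simp
  qed
qed

lemma squash_one: "squash 1 t = of_int \<lfloor>t\<rfloor> + (1/8 + frac t / 4)"
  by (simp add: squash_def frac_def field_simps)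

text \<open>\<open>v\<close> is the slope of the coordinate. Its sign selects the branch so that
  opposite coordinates, having opposite slopes, stay opposite; slope zero is left alone.\<close>

definition ssquash :: "real \<Rightarrow> real \<Rightarrow> real \<Rightarrow> real" where
  "ssquash v s t = (if 0 < v then squash s t else if v < 0 then - squash s (- t) else t)"

lemma ssquash_add: "k \<in> \<int> \<Longrightarrow> ssquash v s (t + k) = ssquash v s t + k"
  using squash_add[of k s t] squash_add[of "- k" s "- t"] by (auto simp: ssquash_def)

lemma ssquash_strict_mono: "0 \<le> s \<Longrightarrow> s \<le> 1 \<Longrightarrow> t < t' \<Longrightarrow> ssquash v s t < ssquash v s t'"
  using squash_strict_mono[of s t t'] squash_strict_mono[of s "- t'" "- t"] by (auto simp: ssquash_def)

lemma ssquash_linear: "ssquash v s t = t + s * (ssquash v 1 t - t)"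
  by (auto simp: ssquash_def squash_def algebra_simps)

text \<open>\<open>u\<close> is a point where \<open>x0\<close> acts as a translation: x0^-1 u, u,
  x0 u form an arithmetic progression.\<close>

locale flat0 =
  fixes n :: nat and T :: classical_type and w0 x0 :: elt and u :: vec
  assumes n: "1 \<le> n" and x0: "inG T n x0" and u: "u \<in> Rn n" and lap0: "lap x0 u = 0"
begin

abbreviation (input) "Y \<equiv> reachset T n w0 x0"

definition nu :: vec where "nu = aff x0 u - u"

abbreviation (input) "w \<equiv> snd x0"

abbreviation (input) "v \<equiv> iv (snd x0)"

lemma x0_grp: "x0 \<in> grp n" by (rule inG_grp[OF x0])

lemma w: "w \<in> signed_perms n" by (rule grpD(2)[OF x0_grp])

lemma nu_Rn: "nu \<in> Rn n"
  unfolding nu_def by (intro Rn_diff aff_Rn[OF x0_grp] u)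

lemma aff_x0: "aff x0 u i = u i + nu i"
  by (simp add: nu_def)

lemma aff_ginv_x0: "aff (ginv x0) u i = u i - nu i"
  using fun_cong[OF lap0, of i] by (simp add: lap_def nu_def)

lemma snd_ginv: "snd (ginv x) = iv (snd x)"
  by (simp add: ginv_def)

text \<open>Applying \<open>x0\<close> to x0^-1 u = u - \<open>nu\<close> returns \<open>u\<close>,
  so the linear part fixes \<open>nu\<close>: the slope is constant along cycles.\<close>

lemma nu_v: "nu (v i) = nu i"
proof -
  have e: "aff (ginv x0) u = u - nu" using aff_ginv_x0 by (simp add: fun_eq_iff)
  have "u i = aff x0 (aff (ginv x0) u) i" by (simp add: aff_ginv' grp_bij[OF x0_grp])
  also have "\<dots> = aff x0 u i - nu (v i)" unfolding e by (simp add: aff_apply)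
  finally show ?thesis by (simp add: aff_x0)
qed

lemma nu_w: "nu (w i) = nu i"
  using nu_v[of "w i"] by (simp add: sp_iv_eq[OF w])

end

locale flat = flat0 +
  assumes T: "T \<noteq> Type_A"
begin

definition squash_dir :: vec where
  "squash_dir = (\<lambda>i. ssquash (nu i) 1 (u i) - u i)"

lemma squash_dir_Rn: "squash_dir \<in> Rn n"
  by (intro RnI) (auto simp: squash_dir_def ssquash_def Rn_minus[OF u] Rn_minus[OF nu_Rn]
      Rn_outside[OF u] Rn_outside[OF nu_Rn])

lemma squash_path: "(u + scale s squash_dir) i = ssquash (nu i) s (u i)"
  unfolding squash_dir_def by (subst ssquash_linear) (simp add: scale_def)

lemma aff_squash_path:
  assumes "x \<in> grp n" "\<And>i. nu (iv (snd x) i) = nu i"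
  shows "aff x (u + scale s squash_dir) i = ssquash (nu i) s (aff x u i)"
proof -
  have "ssquash (nu i) s (u (iv (snd x) i) + fst x i) = ssquash (nu i) s (u (iv (snd x) i)) + fst x i"
    by (rule ssquash_add) (rule Zn_int[OF grpD(1)[OF assms(1)]])
  thus ?thesis unfolding aff_apply squash_path assms(2) by (simp add: add.commute)
qed

text \<open>With slopes of equal sign one strictly increasing function governs both coordinates. If
  they differ by an integer at time s, they did so at the start, and they move alike.\<close>

lemma ssquash_eq_dir:
  assumes "0 \<le> s" "s \<le> 1" "sgn (nu a) = sgn (nu b)" "ssquash (nu a) s (u a) = ssquash (nu b) s (u b) + m" "m \<in> \<int>"
  shows "squash_dir a = squash_dir b"
proof -
  have same: "ssquash (nu a) = ssquash (nu b)"
    using assms(3) by (auto simp: ssquash_def fun_eq_iff sgn_if split: if_splits)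
  have "ssquash (nu b) s (u a) = ssquash (nu b) s (u b + m)"
    using assms(4) same ssquash_add[OF assms(5)] by simp
  hence "u a = u b + m"
    using ssquash_strict_mono[OF assms(1,2)] by (metis linorder_neq_iff)
  thus ?thesis unfolding squash_dir_def same using ssquash_add[OF assms(5), of "nu b" 1 "u b"] by simp
qed

text \<open>Along an orbit the value increases with the sign of \<open>nu\<close>; so functionals of different
  signs may cross freely in either direction, and those of equal sign never meet.\<close>

lemma squash_crossable:
  assumes s: "0 \<le> s" "s \<le> 1" shows "crossable n x0 (u + scale s squash_dir) squash_dir"
  unfolding crossable_def
proof (intro ballI impI)
  fix a b m
  let ?q = "u + scale s squash_dir"
  assume m: "m \<in> \<int>" and "?q a - ?q b = m \<and> squash_dir b < squash_dir a"
  hence eq: "ssquash (nu a) s (u a) - ssquash (nu b) s (u b) = m" and d: "squash_dir b < squash_dir a"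
    unfolding squash_path by auto
  have fw: "aff x0 ?q i = ssquash (nu i) s (u i + nu i)" for i
    using aff_squash_path[OF x0_grp nu_v, of s i] aff_x0 by simp
  have bw: "aff (ginv x0) ?q i = ssquash (nu i) s (u i - nu i)" for i
    using aff_squash_path[OF ginv_grp[OF x0_grp], of s i] aff_ginv_x0 nu_w by (simp add: snd_ginv sp_iv_iv[OF w])
  have mono: "(0 < c \<longrightarrow> ssquash e s t < ssquash e s (t + c)) \<and> (c = 0 \<longrightarrow> ssquash e s (t + c) = ssquash e s t)
      \<and> (c < 0 \<longrightarrow> ssquash e s (t + c) < ssquash e s t)" for e t c
    using ssquash_strict_mono[OF s, of t "t + c" e] ssquash_strict_mono[OF s, of "t + c" t e] by auto
  have "sgn (nu a) \<noteq> sgn (nu b)" using ssquash_eq_dir[OF s _ _ m, of a b] eq d by force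
  hence "(0 < nu a \<and> nu b \<le> 0 \<or> nu a = 0 \<and> nu b < 0) \<or> (nu a \<le> 0 \<and> 0 < nu b \<or> nu a < 0 \<and> nu b = 0)"
    by (auto simp: sgn_if split: if_splits)
  thus "aff x0 ?q b + m < aff x0 ?q a \<or> aff (ginv x0) ?q b + m < aff (ginv x0) ?q a"
  proof
    assume "0 < nu a \<and> nu b \<le> 0 \<or> nu a = 0 \<and> nu b < 0"
    hence "aff x0 ?q b + m < aff x0 ?q a" unfolding fw
      using eq mono[of "nu a" "nu a" "u a"] mono[of "nu b" "nu b" "u b"] by auto
    thus ?thesis ..
  next
    assume "nu a \<le> 0 \<and> 0 < nu b \<or> nu a < 0 \<and> nu b = 0"
    hence "aff (ginv x0) ?q b + m < aff (ginv x0) ?q a" unfolding bw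
      using eq mono[of "- nu a" "nu a" "u a"] mono[of "- nu b" "nu b" "u b"] by auto
    thus ?thesis ..
  qed
qed

definition u1 :: vec where "u1 = u + squash_dir"

lemma u1_Rn: "u1 \<in> Rn n"
  unfolding u1_def by (intro Rn_add u squash_dir_Rn)

lemma u1_eq: "u1 i = ssquash (nu i) 1 (u i)"
  using squash_path[of 1 i] by (simp add: u1_def scale_def)

lemma reach_u1:
  assumes "y \<in> Y" "aff y u \<in> alc (roof T) n"
  obtains y' where "y' \<in> Y" "aff y' u1 \<in> alc (roof T) n"
proof -
  have "crossable n x0 (u + scale s squash_dir) squash_dir" if "0 \<le> s" "s < 1" for s
    using that by (intro squash_crossable) auto
  from path[OF n T assms(1) x0 u squash_dir_Rn assms(2) this] show ?thesis
    using that unfolding u1_def by blast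
qed

section \<open>Cycles of slope zero at the special points\<close>

text \<open>The contraction leaves exactly these coordinates at integers or half-integers; they have
  slope zero and do not move, while all others end up elsewhere.\<close>

definition Z0 :: "int set" where
  "Z0 = {i \<in> idx n. nu i = 0 \<and> 2 * u i \<in> \<int>}"

lemma Z0_idx: "i \<in> Z0 \<Longrightarrow> i \<in> idx n"
  by (simp add: Z0_def)

lemma Z0_minus: "- i \<in> Z0 \<longleftrightarrow> i \<in> Z0"
  by (simp add: Z0_def Rn_minus[OF u] Rn_minus[OF nu_Rn])

lemma Z0_v: "v i \<in> Z0 \<longleftrightarrow> i \<in> Z0"
proof -
  have "2 * u (v i) \<in> \<int> \<longleftrightarrow> 2 * u i \<in> \<int>" if "nu i = 0"
  proof -
    have e: "u i = fst x0 i + u (v i)" using aff_x0[of i] that by (simp add: aff_apply)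
    have "2 * fst x0 i \<in> \<int>" using Zn_int[OF grpD(1)[OF x0_grp]] by simp
    thus ?thesis unfolding e distrib_left by (metis Ints_add Ints_diff add_diff_cancel_left')
  qed
  thus ?thesis by (auto simp: Z0_def nu_v sp_idx[OF sp_iv[OF w]])
qed

lemma Z0_w: "w i \<in> Z0 \<longleftrightarrow> i \<in> Z0"
  using Z0_v[of "w i"] by (simp add: sp_iv_eq[OF w])

lemma finite_Z0: "finite Z0"
  by (rule finite_subset[of _ "idx n"]) (auto simp: Z0_def)

lemma u1_Z0: "i \<in> Z0 \<Longrightarrow> u1 i = u i"
  by (simp add: Z0_def u1_eq ssquash_def)

lemma squash_one_notint: "2 * squash 1 t \<notin> \<int>"
proof
  assume "2 * squash 1 t \<in> \<int>"
  then obtain k where "2 * squash 1 t = of_int k" by (auto elim: Ints_cases)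
  hence "1/4 + frac t / 2 = of_int (k - 2 * \<lfloor>t\<rfloor>)" by (simp add: squash_one)
  moreover have "0 \<le> frac t" "frac t < 1" by (simp_all add: frac_lt_1)
  ultimately have "0 < real_of_int (k - 2 * \<lfloor>t\<rfloor>)" "real_of_int (k - 2 * \<lfloor>t\<rfloor>) < 1" by linarith+
  hence "0 < k - 2 * \<lfloor>t\<rfloor>" "k - 2 * \<lfloor>t\<rfloor> < 1" by (simp_all only: of_int_0_less_iff of_int_less_1_iff)
  thus False by simp
qed

lemma u1_notint: "i \<in> idx n \<Longrightarrow> i \<notin> Z0 \<Longrightarrow> 2 * u1 i \<notin> \<int>"
  using squash_one_notint[of "u i"] squash_one_notint[of "- u i"]
  by (auto simp: Z0_def u1_eq ssquash_def)

text \<open>Outside \<open>Z0\<close> finitely many coordinates avoid the multiples of 1/2, so they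
  keep a common distance from them. Perturbing \<open>Z0\<close> by at most this distance makes it
  meet no other coordinate; the bound 1/8 also separates the perturbed clusters at different
  multiples of 1/2.\<close>

lemma gap_exists: "\<exists>g. 0 < g \<and> g < 1/8 \<and> (\<forall>i \<in> idx n - Z0. \<forall>k \<in> \<int>. g < \<bar>u1 i - k / 2\<bar>)"
proof -
  have "\<forall>\<^sub>F g in at_right 0. \<forall>i \<in> idx n - Z0. \<forall>k \<in> \<int>. g < \<bar>u1 i - k / 2\<bar>"
  proof (rule eventually_ball_finite, simp, rule ballI)
    fix i assume i: "i \<in> idx n - Z0"
    define t where "t = 2 * u1 i"
    have "t \<notin> \<int>" using u1_notint i by (simp add: t_def)
    hence f: "0 < frac t" "frac t < 1" by (simp_all add: frac_gt_0_iff frac_lt_1)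
    have "g < \<bar>u1 i - k / 2\<bar>" if g: "g < min (frac t) (1 - frac t) / 2" and kI: "k \<in> \<int>" for g k
    proof -
      obtain k' where k: "k = of_int k'" using kI by (auto elim: Ints_cases)
      have "min (frac t) (1 - frac t) \<le> \<bar>t - k\<bar>"
      proof (cases "k' \<le> \<lfloor>t\<rfloor>")
        case True
        hence "k \<le> of_int \<lfloor>t\<rfloor>" using k by simp
        thus ?thesis by (auto simp: frac_def)
      next
        case False
        hence "\<lfloor>t\<rfloor> + 1 \<le> k'" by simp
        hence "of_int (\<lfloor>t\<rfloor> + 1) \<le> k" unfolding k by (simp only: of_int_le_iff)
        thus ?thesis by (auto simp: frac_def)
      qed
      moreover have "t - k = 2 * (u1 i - k / 2)" by (simp add: t_def)
      hence "\<bar>t - k\<bar> = 2 * \<bar>u1 i - k / 2\<bar>" by (metis abs_mult abs_numeral)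
      moreover have "A \<le> B \<Longrightarrow> B = 2 * C \<Longrightarrow> g < A / 2 \<Longrightarrow> g < C" for A B C :: real by simp
      ultimately show ?thesis using g by blast
    qed
    thus "\<forall>\<^sub>F g in at_right 0. \<forall>k \<in> \<int>. g < \<bar>u1 i - k / 2\<bar>"
      unfolding eventually_at_right_field using f
      by (intro exI[of _ "min (frac t) (1 - frac t) / 2"]) auto
  qed
  moreover have "\<forall>\<^sub>F g in at_right 0. g < (1/8 :: real)"
    by (rule eventually_at_right_real[THEN eventually_mono, of 0 "1/8"]) auto
  moreover have "\<forall>\<^sub>F g in at_right 0. 0 < (g :: real)" by (rule eventually_at_right_less)
  ultimately have "\<forall>\<^sub>F g in at_right 0. 0 < g \<and> g < 1/8 \<and> (\<forall>i \<in> idx n - Z0. \<forall>k \<in> \<int>. g < \<bar>u1 i - k / 2\<bar>)"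
    by eventually_elim auto
  thus ?thesis by (metis (no_types, lifting) eventually_happens trivial_limit_at_right_real)
qed

definition gap :: real where
  "gap = (SOME g. 0 < g \<and> g < 1/8 \<and> (\<forall>i \<in> idx n - Z0. \<forall>k \<in> \<int>. g < \<bar>u1 i - k / 2\<bar>))"

lemma gap: "0 < gap" "gap < 1/8" "i \<in> idx n \<Longrightarrow> i \<notin> Z0 \<Longrightarrow> k \<in> \<int> \<Longrightarrow> gap < \<bar>u1 i - k / 2\<bar>"
  using someI_ex[OF gap_exists] unfolding gap_def by blast+

section \<open>Perturbing the coordinates at integers and half-integers\<close>

definition good :: "vec \<Rightarrow> bool" where
  "good z \<longleftrightarrow> z \<in> Rn n \<and> (\<forall>i. i \<notin> Z0 \<longrightarrow> z i = 0) \<and> (\<forall>i. \<bar>z i\<bar> \<le> gap) \<and>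
     (\<exists>y \<in> Y. aff y (u1 + z) \<in> alc (roof T) n)"

text \<open>Only coordinates of \<open>Z0\<close> lie within \<open>gap\<close> of a multiple of
  1/2, so a tie that involves one of them involves two. Then 2 (z_b - z_a) is an integer of modulus
  below 1.\<close>

lemma tie_Z0:
  assumes z: "\<And>i. i \<notin> Z0 \<Longrightarrow> z i = 0" "\<And>i. \<bar>z i\<bar> \<le> gap" and ab: "a \<in> idx n" "b \<in> idx n" "a \<in> Z0 \<or> b \<in> Z0"
    and m: "m \<in> \<int>" "(u1 + z) a - (u1 + z) b = m"
  shows "a \<in> Z0 \<and> b \<in> Z0 \<and> u1 a - u1 b = m \<and> z a = z b"
proof -
  have half: "2 * u1 i \<in> \<int>" if "i \<in> Z0" for i using that u1_Z0[OF that] by (simp add: Z0_def)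
  have a: "a \<in> Z0" if b: "b \<in> Z0" 
  proof (rule ccontr)
    assume na: "a \<notin> Z0"
    have "gap < \<bar>u1 a - (2 * u1 b + 2 * m) / 2\<bar>" using half[OF b] m(1) by (intro gap(3) ab na) auto
    moreover have "u1 a - (2 * u1 b + 2 * m) / 2 = z b" using m(2) z(1)[OF na] by (simp add: field_simps)
    ultimately show False using z(2)[of b] by simp
  qed
  have b: "b \<in> Z0" if a: "a \<in> Z0" 
  proof (rule ccontr)
    assume nb: "b \<notin> Z0"
    have "gap < \<bar>u1 b - (2 * u1 a - 2 * m) / 2\<bar>" using half[OF a] m(1) by (intro gap(3) ab nb) auto
    moreover have "u1 b - (2 * u1 a - 2 * m) / 2 = z a" using m(2) z(1)[OF nb] by (simp add: field_simps)
    ultimately show False using z(2)[of a] by simp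
  qed
  have Z: "a \<in> Z0" "b \<in> Z0" using ab(3) a b by auto
  have "2 * u1 a - 2 * u1 b - 2 * m \<in> \<int>" using half[OF Z(1)] half[OF Z(2)] m(1) by simp
  then obtain k where k: "2 * u1 a - 2 * u1 b - 2 * m = of_int k" by (auto elim: Ints_cases)
  moreover have "2 * u1 a - 2 * u1 b - 2 * m = 2 * (z b - z a)" using m(2) by simp
  ultimately have "real_of_int k = 2 * (z b - z a)" by simp
  moreover have "- gap \<le> z a" "z a \<le> gap" "- gap \<le> z b" "z b \<le> gap"
    using z(2)[of a] z(2)[of b] by auto
  hence "- 1 < 2 * (z b - z a)" "2 * (z b - z a) < 1" using gap(2) by auto
  ultimately have "of_int (- 1) < real_of_int k" "real_of_int k < of_int 1" by simp_all
  hence "- 1 < k" "k < 1" by (simp_all only: of_int_less_iff)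
  hence "k = 0" by simp
  thus ?thesis using Z k m(2) by simp
qed

end

context flat begin

lemma goodD:
  assumes "good z"
  shows "z \<in> Rn n" "i \<notin> Z0 \<Longrightarrow> z i = 0" "\<bar>z i\<bar> \<le> gap" "z (- i) = - z i"
  using assms Rn_minus[of z n i] by (auto simp: good_def)

text \<open>On \<open>Z0\<close> the slope is zero, so x0^-1 keeps the base value and only moves the
  perturbation along \<open>w\<close>.\<close>

lemma aff_ginv_x0_Z0: "i \<in> Z0 \<Longrightarrow> aff (ginv x0) (u1 + z) i = u1 i + z (w i)"
  using aff_ginv_x0[of i] u1_Z0[of i] u1_Z0[of "w i"] Z0_w[of i]
  by (simp add: aff_apply snd_ginv sp_iv_iv[OF w]) (simp add: Z0_def)

definition raise :: "int \<Rightarrow> real \<Rightarrow> vec \<Rightarrow> vec" where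
  "raise j M z = (\<lambda>i. if i = j then M else if i = - j then - M else z i)"

text \<open>While the j-th perturbation rises to the value at w j, it meets, besides its own
  negative, only coordinates h with z_j \<le> z_h < z_{w j}. Such a wall is crossed by means of
  x0^-1, which compares the values at w h and w j instead; this explains the last hypothesis. The
  value at w j itself stays put.\<close>

lemma raise_good:
  assumes z: "good z" and j: "j \<in> Z0" and wj: "w j \<noteq> j" "w j \<noteq> - j" and le: "z j \<le> z (w j)"
    and below: "\<And>h. h \<in> Z0 \<Longrightarrow> h \<noteq> j \<Longrightarrow> z j \<le> z h \<Longrightarrow> z h < z (w j) \<Longrightarrow> z (w h) < z (w j)"
  shows "good (raise j (z (w j)) z)"
proof -
  define M where "M = z (w j)"
  define z' where "z' = raise j M z"
  define d where "d = z' - z"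
  have jn: "j \<noteq> 0" using idx_nonzero Z0_idx[OF j] by blast
  have zR: "z \<in> Rn n" using goodD(1)[OF z] .
  have zm: "z (- i) = - z i" for i using goodD(4)[OF z] .
  have z'R: "z' \<in> Rn n" unfolding z'_def raise_def
    using j jn Z0_idx[OF j] by (intro RnI) (auto simp: zm Rn_outside[OF zR])
  have z'Z: "z' i = 0" if "i \<notin> Z0" for i
    using that j Z0_minus[of j] goodD(2)[OF z] by (auto simp: z'_def raise_def)
  have z'g: "\<bar>z' i\<bar> \<le> gap" for i using goodD(3)[OF z, of i] goodD(3)[OF z, of "w j"] by (simp add: z'_def raise_def M_def)
  have dR: "d \<in> Rn n" unfolding d_def by (intro Rn_diff z'R zR)
  have dj: "d j = M - z j" "d (- j) = - (M - z j)" "i \<noteq> j \<Longrightarrow> i \<noteq> - j \<Longrightarrow> d i = 0" for i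
    using jn by (auto simp: d_def z'_def raise_def zm)
  obtain y where y: "y \<in> Y" "aff y (u1 + z) \<in> alc (roof T) n" using z by (auto simp: good_def)
  have cr: "crossable n x0 (u1 + z + scale s d) d" if s: "0 \<le> s" "s < 1" for s
    unfolding crossable_def
  proof (intro ballI impI)
    fix a b m assume ab: "a \<in> idx n" "b \<in> idx n" and m: "m \<in> \<int>"
      and "(u1 + z + scale s d) a - (u1 + z + scale s d) b = m \<and> d b < d a"
    hence eq: "(u1 + z + scale s d) a - (u1 + z + scale s d) b = m" and dab: "d b < d a" by auto
    define t where "t = z + scale s d"
    have ti: "t i = (1 - s) * z i + s * z' i" for i
      by (simp add: t_def d_def) (simp add: scale_def algebra_simps)
    have tZ: "t i = 0" if "i \<notin> Z0" for i using z'Z[OF that] goodD(2)[OF z that] by (simp add: ti)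
    have tg: "\<bar>t i\<bar> \<le> gap" for i
    proof -
      have "\<bar>t i\<bar> \<le> (1 - s) * \<bar>z i\<bar> + s * \<bar>z' i\<bar>" unfolding ti
        using s by (intro order.trans[OF abs_triangle_ineq]) (simp add: abs_mult)
      also have "\<dots> \<le> (1 - s) * gap + s * gap"
        using s goodD(3)[OF z, of i] z'g[of i] by (intro add_mono mult_left_mono) auto
      finally show ?thesis by (simp add: algebra_simps)
    qed
    have tR: "t \<in> Rn n" unfolding t_def by (intro Rn_add zR Rn_scale dR)
    have tm: "t (- i) = - t i" for i using Rn_minus[OF tR] .
    have e: "u1 + z + scale s d = u1 + t" by (simp add: t_def add.assoc)
    have "a \<in> Z0 \<or> b \<in> Z0"
      using dab dj(3)[of a] dj(3)[of b] j Z0_minus[of j] by (metis less_irrefl)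
    from tie_Z0[OF tZ tg ab this m] have Z: "a \<in> Z0" "b \<in> Z0" "u1 a - u1 b = m" "t a = t b"
      using eq unfolding e by auto
    have tw: "t (w j) = M" using wj by (simp add: ti z'_def raise_def M_def algebra_simps)
    have tj: "t j = (1 - s) * z j + s * M" by (simp add: ti z'_def raise_def)
    \<comment> \<open>The comparison for j overtaking \<open>c\<close>; every tie is reduced to it
      below.\<close>
    have main: "t (w c) < t (w j)" if c: "c \<in> Z0" "c \<noteq> j" "t c = t j" "d c < d j" for c
    proof -
      have tjM: "t j < M \<and> z j < M \<and> z j \<le> t j"
      proof (cases "c = - j")
        case True
        hence "z j < M" using c(4) dj by simp
        hence "(1 - s) * z j < (1 - s) * M" using s by simp
        moreover have "s * z j \<le> s * M" using \<open>z j < M\<close> s by (simp add: mult_left_mono)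
        ultimately show ?thesis using \<open>z j < M\<close> unfolding tj by (simp add: algebra_simps)
      next
        case False
        hence "z j < M" using c(2,4) dj by simp
        hence "(1 - s) * z j < (1 - s) * M" using s by simp
        moreover have "s * z j \<le> s * M" using \<open>z j < M\<close> s by (simp add: mult_left_mono)
        ultimately show ?thesis using \<open>z j < M\<close> unfolding tj by (simp add: algebra_simps)
      qed
      show ?thesis
      proof (cases "c = - j")
        case True
        \<comment> \<open>The coordinate meets its own negative only at 0, on the way up to a
          positive M.\<close>
        hence "t j = 0" using c(3) tm[of j] by simp
        hence "0 < M" using tjM by simp
        thus ?thesis using True tw tm[of "w j"] by (simp add: sp_minus[OF w])
      next
        case False
        have tc: "t c = z c" using False c(2) by (simp add: ti z'_def raise_def algebra_simps)
        have zwc: "z (w c) < M" unfolding M_def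
          by (rule below[OF c(1,2)]) (use tc c(3) tjM in \<open>auto simp: M_def\<close>)
        consider "w c = j" | "w c = - j" | "w c \<noteq> j" "w c \<noteq> - j" by blast
        thus ?thesis
        proof cases
          case 1 thus ?thesis using tjM tw by simp
        next
          case 2
          have "- z j < M" using zwc 2 zm by simp
          thus ?thesis using 2 tm tjM tw by simp
        next
          case 3 thus ?thesis using zwc tw by (simp add: ti z'_def raise_def algebra_simps)
        qed
      qed
    qed
    have "t (w b) < t (w a)"
    proof (cases "a = j")
      case True
      thus ?thesis using main[of b] Z dab by auto
    next
      case False
      \<comment> \<open>If j is not the one that overtakes, then - j is being overtaken, and
        negating the tie makes j overtake - a.\<close>
      have "b = - j"
      proof (rule ccontr)
        assume "b \<noteq> - j"
        hence "0 \<le> d b" using dj(1) dj(3)[of b] le by (cases "b = j") (auto simp: M_def)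
        hence "0 < d a" using dab by simp
        hence "a = - j" using dj(3)[of a] False by force
        thus False using \<open>0 < d a\<close> dj(2) le by (simp add: M_def)
      qed
      have "t (w (- a)) < t (w j)"
      proof (rule main)
        show "- a \<in> Z0" using Z Z0_minus by simp
        show "- a \<noteq> j" using dab \<open>b = - j\<close> by auto
        show "t (- a) = t j" using Z(4) tm \<open>b = - j\<close> by simp
        have "d (- i) = - d i" for i using Rn_minus[OF dR] .
        thus "d (- a) < d j" using dab \<open>b = - j\<close> by simp
      qed
      thus ?thesis using \<open>b = - j\<close> tm by (simp add: sp_minus[OF w])
    qed
    hence "aff (ginv x0) (u1 + t) b + m < aff (ginv x0) (u1 + t) a"
      using Z by (simp add: aff_ginv_x0_Z0)
    thus "aff x0 (u1 + z + scale s d) b + m < aff x0 (u1 + z + scale s d) a \<or>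
      aff (ginv x0) (u1 + z + scale s d) b + m < aff (ginv x0) (u1 + z + scale s d) a" unfolding e ..
  qed
  have "u1 + z + d = u1 + z'" by (simp add: d_def fun_eq_iff)
  moreover obtain y' where "y' \<in> Y" "aff y' (u1 + z + d) \<in> alc (roof T) n"
    by (rule path[OF n T y(1) x0 Rn_add[OF u1_Rn zR] dR y(2) cr])
  ultimately have "\<exists>y \<in> Y. aff y (u1 + z') \<in> alc (roof T) n" by metis
  thus ?thesis using z'R z'Z z'g unfolding good_def M_def[symmetric] z'_def[symmetric] by blast
qed

text \<open>The factor at the cluster \<open>1/2\<close> makes the absolute values at the two clusters distinct.\<close>

lemma initial_good:
  assumes y: "y \<in> Y" and p: "aff y u1 \<in> alc (roof T) n"
  obtains z where "good z" "\<And>i. i \<in> Z0 \<Longrightarrow> z i \<noteq> 0"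
    "\<And>a b. a \<in> Z0 \<Longrightarrow> b \<in> Z0 \<Longrightarrow> \<bar>z a\<bar> = \<bar>z b\<bar> \<Longrightarrow> a = b \<or> a = - b"
proof -
  define P where "P = aff y u1"
  have PK: "P \<in> alc (1/2) n" using p T by (simp add: P_def roof_def)
  have PR: "P \<in> Rn n" by (rule alc_Rn[OF PK])
  have yG: "y \<in> grp n" using reachset_inG[OF y] inG_grp by blast
  define \<sigma> where "\<sigma> = snd y"
  have \<sigma>: "\<sigma> \<in> signed_perms n" unfolding \<sigma>_def by (rule grpD(2)[OF yG])
  \<comment> \<open>Both nonzero formulas point towards \<open>delta n\<close>, hence into the
    alcove. The moduli are at least 1/(2n+2) at 0 and smaller at 1/2.\<close>
  define D where "D i = (if P i = 0 then delta n i else if \<bar>P i\<bar> = 1/2 then (delta n i - P i) / (2 * real n + 2) else 0)" for i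
  have Pm: "P (- i) = - P i" and dm: "delta n (- i) = - delta n i" for i
    using Rn_minus[OF PR] Rn_minus[OF delta_Rn] by auto
  have Dm: "D (- i) = - D i" for i by (simp add: D_def Pm dm minus_divide_left[symmetric] diff_divide_distrib)
  have DR: "D \<in> Rn n"
    by (rule RnI[of D n, OF Dm]) (simp add: D_def Rn_outside[OF PR] Rn_outside[OF delta_Rn])
  have Db: "P i = 0 \<Longrightarrow> 1 / (2 * real n + 2) \<le> D i"
    "P i = 1/2 \<Longrightarrow> - (1 / (2 * real n + 2)) < D i \<and> D i < 0" if i: "i \<in> {1..int n}" for i
  proof -
    show "1 / (2 * real n + 2) \<le> D i" if "P i = 0"
      using i that by (simp add: D_def delta_pos divide_right_mono)
    assume h: "P i = 1/2"
    have "- 1 < delta n i - 1/2 \<and> delta n i - 1/2 < 0" using delta_bounds[OF i] by simp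
    thus "- (1 / (2 * real n + 2)) < D i \<and> D i < 0" using h by (simp add: D_def field_simps)
  qed
  obtain e where e: "0 < e" "\<And>t. 0 < t \<Longrightarrow> t < e \<Longrightarrow> P + scale t D \<in> alc (1/2) n"
  proof (rule alc_open[OF n PK DR])
    fix i assume i: "1 \<le> i" "i < int n" and eq: "P i = P (i + 1)"
    have "delta n (i + 1) \<le> delta n i" using delta_mono[of i n "i + 1"] i by simp
    thus "D (i + 1) \<le> D i" using eq by (auto simp: D_def divide_right_mono)
  next
    show "0 \<le> D (int n)" if "P (int n) = 0"
    proof -
      have "0 \<le> 1 / (2 * real n + 2)" by simp
      also have "\<dots> \<le> D (int n)" using n that by (intro Db) auto
      finally show ?thesis .
    qed
    show "D 1 \<le> 0" if "P 1 = 1/2" using Db(2)[of 1] n that by simp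
  qed auto
  have Dle: "\<bar>D i\<bar> \<le> 1" for i
  proof (cases "i \<in> idx n")
    case True
    have d: "\<bar>delta n i\<bar> < 1/2" using True delta_bounds[of i n] delta_bounds[of "-i" n] dm[of i]
      by (auto elim!: idx_cases)
    hence "\<bar>delta n i - P i\<bar> \<le> 1" if "\<bar>P i\<bar> = 1/2" using that by linarith
    hence "\<bar>delta n i - P i\<bar> / (2 * real n + 2) \<le> 1" if "\<bar>P i\<bar> = 1/2"
      using that by (simp add: field_simps) 
    thus ?thesis using d by (auto simp: D_def abs_divide)
  qed (simp add: D_def Rn_outside[OF PR] Rn_outside[OF delta_Rn])
  define t where "t = min (e / 2) gap"
  have t: "0 < t" "t < e" "t \<le> gap" using e(1) gap(1) by (auto simp: t_def)
  define z where "z = act (iv \<sigma>) (scale t D)"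
  have zi: "z i = t * D (\<sigma> i)" for i by (simp add: z_def act_def sp_iv_iv[OF \<sigma>] scale_def)
  have zR: "z \<in> Rn n" unfolding z_def by (intro act_Rn sp_iv \<sigma> Rn_scale DR)
  \<comment> \<open>A coordinate of P is 0 or of modulus 1/2 iff its double is an integer, which the
    integral translation of \<open>y\<close> does not affect.\<close>
  have PZ: "P (\<sigma> i) = 0 \<or> \<bar>P (\<sigma> i)\<bar> = 1/2 \<longleftrightarrow> i \<in> Z0" if i: "i \<in> idx n" for i
  proof -
    have Pi: "P (\<sigma> i) = fst y (\<sigma> i) + u1 i" by (simp add: P_def aff_apply \<sigma>_def[symmetric] sp_iv_eq[OF \<sigma>])
    have b: "\<bar>P j\<bar> \<le> 1/2" if "j \<in> idx n" for j
      using that alc_bounds[OF PK, of j] alc_bounds[OF PK, of "-j"] Pm[of j] by (auto elim!: idx_cases)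
    have "\<sigma> i \<in> idx n" using i sp_idx[OF \<sigma>] by simp
    have "P (\<sigma> i) = 0 \<or> \<bar>P (\<sigma> i)\<bar> = 1/2 \<longleftrightarrow> 2 * P (\<sigma> i) \<in> \<int>"
    proof
      assume "2 * P (\<sigma> i) \<in> \<int>"
      then obtain k where k: "2 * P (\<sigma> i) = of_int k" by (auto elim: Ints_cases)
      hence "\<bar>real_of_int k\<bar> \<le> 1" using b[OF \<open>\<sigma> i \<in> idx n\<close>] by linarith
      hence "\<bar>k\<bar> \<le> 1" by (simp only: of_int_abs[symmetric] of_int_le_1_iff)
      hence "k = 0 \<or> k = 1 \<or> k = - 1" by linarith
      thus "P (\<sigma> i) = 0 \<or> \<bar>P (\<sigma> i)\<bar> = 1/2" using k by auto
    next
      assume "P (\<sigma> i) = 0 \<or> \<bar>P (\<sigma> i)\<bar> = 1/2"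
      hence "2 * P (\<sigma> i) = 0 \<or> 2 * P (\<sigma> i) = 1 \<or> 2 * P (\<sigma> i) = - 1" by linarith
      thus "2 * P (\<sigma> i) \<in> \<int>" by (elim disjE) simp_all
    qed
    also have "\<dots> \<longleftrightarrow> 2 * u1 i \<in> \<int>"
    proof -
      have k: "2 * fst y (\<sigma> i) \<in> \<int>" using Zn_int[OF grpD(1)[OF yG]] by simp
      thus ?thesis unfolding Pi distrib_left by (metis Ints_add Ints_diff add_diff_cancel_left')
    qed
    also have "\<dots> \<longleftrightarrow> i \<in> Z0"
      using u1_notint[OF i] u1_Z0[of i] by (auto simp: Z0_def)
    finally show ?thesis .
  qed
  show ?thesis
  proof (rule that[of z])
    have "aff y (u1 + z) = P + scale t D"
      by (simp add: aff_def act_add P_def add.assoc)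
         (simp add: z_def act_def fun_eq_iff \<sigma>_def[symmetric] sp_iv_iv[OF \<sigma>] sp_eq_iv[OF \<sigma>])
    hence "aff y (u1 + z) \<in> alc (roof T) n" using e(2)[OF t(1,2)] T by (simp add: roof_def)
    moreover have "z i = 0" if "i \<notin> Z0" for i
      using PZ[of i] that Rn_outside[OF zR, of i] by (cases "i \<in> idx n") (auto simp: zi D_def)
    moreover have "\<bar>z i\<bar> \<le> gap" for i
    proof -
      have "\<bar>z i\<bar> \<le> t * 1" unfolding zi using Dle[of "\<sigma> i"] t(1) by (simp add: abs_mult)
      thus ?thesis using t(3) by simp
    qed
    ultimately show "good z" using zR y unfolding good_def by blast
    have cl: "(P i = 0 \<and> 1 / (2 * real n + 2) \<le> \<bar>D i\<bar>) \<or> (\<bar>P i\<bar> = 1/2 \<and> \<bar>D i\<bar> < 1 / (2 * real n + 2) \<and> D i \<noteq> 0)"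
      if "i \<in> idx n" "P i = 0 \<or> \<bar>P i\<bar> = 1/2" for i
      using that(1)
    proof (cases rule: idx_cases)
      case 1
      thus ?thesis using that(2) Db[OF 1] alc_bounds[OF PK 1] by auto
    next
      case 2
      thus ?thesis using that(2) Db[OF 2] alc_bounds[OF PK 2] Pm[of i] Dm[of i] by auto
    qed
    have cZ: "(P (\<sigma> i) = 0 \<and> 1 / (2 * real n + 2) \<le> \<bar>D (\<sigma> i)\<bar>) \<or>
       (\<bar>P (\<sigma> i)\<bar> = 1/2 \<and> \<bar>D (\<sigma> i)\<bar> < 1 / (2 * real n + 2) \<and> D (\<sigma> i) \<noteq> 0)" if "i \<in> Z0" for i
      using PZ[OF Z0_idx[OF that]] that by (intro cl) (auto simp: sp_idx[OF \<sigma>] Z0_idx)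
    have np: "0 < 1 / (2 * real n + 2)" by simp
    show "z i \<noteq> 0" if "i \<in> Z0" for i
    proof -
      have "D (\<sigma> i) \<noteq> 0" using cZ[OF that] np by linarith
      thus ?thesis unfolding zi using t(1) by simp
    qed
    fix a b assume ab: "a \<in> Z0" "b \<in> Z0" "\<bar>z a\<bar> = \<bar>z b\<bar>"
    have Dab: "\<bar>D (\<sigma> a)\<bar> = \<bar>D (\<sigma> b)\<bar>" using ab(3) t(1) by (simp add: zi abs_mult)
    have inj: "i = j" if ij: "i \<in> {1..int n}" "j \<in> {1..int n}" "\<bar>D i\<bar> = \<bar>D j\<bar>"
      "P i = 0 \<and> P j = 0 \<or> P i = 1/2 \<and> P j = 1/2" for i j
    proof -
      have "D i = D j" using ij Db(1)[OF ij(1)] Db(1)[OF ij(2)] Db(2)[OF ij(1)] Db(2)[OF ij(2)] np by linarith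
      hence "delta n i = delta n j" using ij(4) by (auto simp: D_def)
      thus ?thesis using delta_mono[OF ij(1,2)] delta_mono[OF ij(2,1)] by linarith
    qed
    have rep: "\<exists>k \<in> {1..int n}. (i = k \<or> i = - k) \<and> \<bar>D k\<bar> = \<bar>D i\<bar> \<and> \<bar>P k\<bar> = \<bar>P i\<bar>" if "i \<in> idx n" for i
      using that
    proof (cases rule: idx_cases)
      case 1 thus ?thesis by auto
    next
      case 2 thus ?thesis using Pm[of i] Dm[of i] by (intro bexI[of _ "- i"]) auto
    qed
    obtain k where k: "k \<in> {1..int n}" "\<sigma> a = k \<or> \<sigma> a = - k" "\<bar>D k\<bar> = \<bar>D (\<sigma> a)\<bar>" "\<bar>P k\<bar> = \<bar>P (\<sigma> a)\<bar>"
      using rep[of "\<sigma> a"] Z0_idx[OF ab(1)] sp_idx[OF \<sigma>] by blast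
    obtain l where l: "l \<in> {1..int n}" "\<sigma> b = l \<or> \<sigma> b = - l" "\<bar>D l\<bar> = \<bar>D (\<sigma> b)\<bar>" "\<bar>P l\<bar> = \<bar>P (\<sigma> b)\<bar>"
      using rep[of "\<sigma> b"] Z0_idx[OF ab(2)] sp_idx[OF \<sigma>] by blast
    have "P k = 0 \<and> P l = 0 \<or> P k = 1/2 \<and> P l = 1/2"
      using cZ[OF ab(1)] cZ[OF ab(2)] Dab k(4) l(4) alc_bounds[OF PK k(1)] alc_bounds[OF PK l(1)] by auto
    hence "k = l" using k l Dab by (intro inj) auto
    hence "\<sigma> a = \<sigma> b \<or> \<sigma> a = \<sigma> (- b)" using k(2) l(2) by (auto simp: sp_minus[OF \<sigma>])
    thus "a = b \<or> a = - b" using sp_iv_eq[OF \<sigma>] by metis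
  qed
qed

end

context flat begin

section \<open>Signed cycles and the greedy sort\<close>

lemma v_minus: "v (- i) = - v i"
  by (rule sp_minus[OF sp_iv[OF w]])

lemma vpow_minus: "(v ^^ k) (- i) = - (v ^^ k) i"
  by (rule sp_minus[OF sp_pow[OF sp_iv[OF w]]])

lemma vpow_inj: "(v ^^ k) i = (v ^^ k) j \<Longrightarrow> i = j"
  by (meson sp_bij sp_pow sp_iv w bij_is_inj injD)

lemma w_vpow_Suc: "w ((v ^^ Suc k) i) = (v ^^ k) i"
  by (simp add: sp_eq_iv[OF w])

lemma vpow_returns: "\<exists>b\<ge>1. (v ^^ b) j = j \<or> (v ^^ b) j = - j"
proof -
  have "permutation v"
    using sp_permutes[OF sp_iv[OF w]] finite_idx permutation_permutes by blast
  then obtain b where "v ^^ b = id" "0 < b" by (rule permutation_is_nilpotent)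
  thus ?thesis by (intro exI[of _ b]) auto
qed

text \<open>Under \<open>cyc z j b\<close>, the sign of \<open>z\<close> changes at most once along the signed cycle of \<open>j\<close>.\<close>

definition cyc :: "vec \<Rightarrow> int \<Rightarrow> nat \<Rightarrow> bool" where
  "cyc z j b \<longleftrightarrow> 1 \<le> b \<and> ((v ^^ b) j = j \<or> (v ^^ b) j = - j) \<and> 0 < z j \<and> (\<forall>k<b. z ((v ^^ k) j) = z j)"

definition aligned :: "vec \<Rightarrow> int set \<Rightarrow> bool" where
  "aligned z X \<longleftrightarrow> (\<forall>h \<in> X. \<exists>j \<in> X. \<exists>b l. cyc z j b \<and> l < b \<and> (h = (v ^^ l) j \<or> h = - (v ^^ l) j))"

text \<open>\<open>U\<close> consists of the cycles still untreated. Their values are nonzero with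
  moduli distinct up to sign, and all treated values have larger modulus, so that raising inside
  \<open>U\<close> never reaches them.\<close>

definition stage :: "vec \<Rightarrow> int set \<Rightarrow> bool" where
  "stage z U \<longleftrightarrow> good z \<and> U \<subseteq> Z0 \<and> (\<forall>i \<in> U. - i \<in> U \<and> v i \<in> U \<and> w i \<in> U \<and> z i \<noteq> 0) \<and>
     (\<forall>a \<in> U. \<forall>b \<in> U. \<bar>z a\<bar> = \<bar>z b\<bar> \<longrightarrow> a = b \<or> a = - b) \<and>
     (\<forall>i \<in> U. \<forall>h \<in> Z0 - U. \<bar>z i\<bar> < \<bar>z h\<bar>) \<and> aligned z (Z0 - U)"

text \<open>The points v j, v^2 j, ... are raised one after another to the maximal value M on
  \<open>U\<close>; the next point a has its image w a at M already. A coordinate h met on the way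
  is neither raised nor equal to a, so w h is no raised point of value M, and every remaining value
  is below M. This is the hypothesis of \<open>raise_good\<close>.\<close>

lemma stage_step:
  assumes st: "stage z U" and ne: "U \<noteq> {}"
  obtains z' U' where "stage z' U'" "U' \<subset> U"
proof -
  have z: "good z" and UZ: "U \<subseteq> Z0" and U: "\<And>i. i \<in> U \<Longrightarrow> - i \<in> U \<and> v i \<in> U \<and> w i \<in> U \<and> z i \<noteq> 0"
    and gen: "\<And>a b. a \<in> U \<Longrightarrow> b \<in> U \<Longrightarrow> \<bar>z a\<bar> = \<bar>z b\<bar> \<Longrightarrow> a = b \<or> a = - b"
    and sep: "\<And>i h. i \<in> U \<Longrightarrow> h \<in> Z0 \<Longrightarrow> h \<notin> U \<Longrightarrow> \<bar>z i\<bar> < \<bar>z h\<bar>" and al: "aligned z (Z0 - U)"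
    using st unfolding stage_def by blast+
  have fU: "finite U" using UZ finite_Z0 by (rule finite_subset)
  obtain j where j: "j \<in> U" and max: "\<And>i. i \<in> U \<Longrightarrow> z i \<le> z j"
    using finite_max[OF fU ne, of z] by metis
  define M where "M = z j"
  have zm: "z (- i) = - z i" for i by (rule goodD(4)[OF z])
  have M: "0 < M" using max[of "- j"] U[OF j] zm[of j] unfolding M_def by fastforce
  have leM: "\<bar>z i\<bar> \<le> M" if "i \<in> U" for i
    using max[OF that] max[of "- i"] U[OF that] zm[of i] by (simp add: M_def abs_le_iff)
  have eqM: "i = j \<or> i = - j" if "i \<in> U" "\<bar>z i\<bar> = M" for i
    using gen[OF that(1) j] that(2) M by (simp add: M_def)
  have Upow: "(v ^^ k) i \<in> U" if "i \<in> U" for k i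
    by (induction k) (use that U in auto)
  \<comment> \<open>The length of the cycle up to sign: v^b j may be j or - j.\<close>
  define b where "b = (LEAST b. 1 \<le> b \<and> ((v ^^ b) j = j \<or> (v ^^ b) j = - j))"
  have b: "1 \<le> b" "(v ^^ b) j = j \<or> (v ^^ b) j = - j"
    using LeastI_ex[OF vpow_returns[of j]] unfolding b_def by auto
  have least: "(v ^^ k) j \<noteq> j \<and> (v ^^ k) j \<noteq> - j" if "1 \<le> k" "k < b" for k
    using not_less_Least[of k "\<lambda>b. 1 \<le> b \<and> ((v ^^ b) j = j \<or> (v ^^ b) j = - j)"] that unfolding b_def by auto
  have dist: "(v ^^ k) j \<noteq> (v ^^ l) j \<and> (v ^^ k) j \<noteq> - (v ^^ l) j" if "l < k" "k < b" for k l
  proof -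
    have e: "(v ^^ k) j = (v ^^ l) ((v ^^ (k - l)) j)"
      using that funpow_add[of l "k - l" v] by simp
    have "(v ^^ (k - l)) j \<noteq> j" "(v ^^ (k - l)) j \<noteq> - j" using least[of "k - l"] that by auto
    thus ?thesis unfolding e vpow_minus[symmetric] using vpow_inj by blast
  qed
  have ex: "\<exists>z'. good z' \<and> (\<forall>l\<le>k. z' ((v ^^ l) j) = M) \<and>
      (\<forall>i. (\<forall>l\<le>k. i \<noteq> (v ^^ l) j \<and> i \<noteq> - (v ^^ l) j) \<longrightarrow> z' i = z i)" if "k < b" for k
    using that
  proof (induction k)
    case 0
    show ?case using z by (intro exI[of _ z]) (auto simp: M_def)
  next
    case (Suc k)
    then obtain z' where z': "good z'" and zM: "\<And>l. l \<le> k \<Longrightarrow> z' ((v ^^ l) j) = M"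
      and zo: "\<And>i. (\<And>l. l \<le> k \<Longrightarrow> i \<noteq> (v ^^ l) j \<and> i \<noteq> - (v ^^ l) j) \<Longrightarrow> z' i = z i" by auto
    define a where "a = (v ^^ Suc k) j"
    have aU: "a \<in> U" unfolding a_def by (rule Upow[OF j])
    have wa: "w a = (v ^^ k) j" unfolding a_def by (rule w_vpow_Suc)
    have aO: "a \<noteq> (v ^^ l) j \<and> a \<noteq> - (v ^^ l) j" if "l \<le> k" for l
      unfolding a_def using dist[of l "Suc k"] that Suc.prems by simp
    have za: "z' a = z a" using aO by (rule zo)
    have zm': "z' (- i) = - z' i" for i by (rule goodD(4)[OF z'])
    have zwa: "z' (w a) = M" using zM[of k] wa by simp
    have aM: "\<bar>z a\<bar> < M" using leM[OF aU] eqM[OF aU] aO[of 0] by force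
    have "good (raise a (z' (w a)) z')"
    proof (rule raise_good[OF z'])
      show "a \<in> Z0" using aU UZ by blast
      show "w a \<noteq> a" "w a \<noteq> - a" using aO[of k] wa by auto
      show "z' a \<le> z' (w a)" using za zwa aM by simp
      fix h assume h: "h \<in> Z0" "h \<noteq> a" "z' a \<le> z' h" "z' h < z' (w a)"
      have hM: "\<bar>z' h\<bar> < M" using h(3,4) za zwa aM by (simp add: abs_less_iff)
      have hO: "h \<noteq> (v ^^ l) j \<and> h \<noteq> - (v ^^ l) j" if "l \<le> k" for l
        using zM[OF that] hM zm' by force
      have zh: "z' h = z h" using hO by (rule zo)
      have hU: "h \<in> U"
      proof (rule ccontr)
        assume "h \<notin> U"
        hence "M < \<bar>z h\<bar>" using sep[OF j h(1)] M by (simp add: M_def)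
        thus False using hM zh by simp
      qed
      hence whU: "w h \<in> U" using U by blast
      show "z' (w h) < z' (w a)"
      proof (cases "\<exists>l\<le>k. w h = - (v ^^ l) j")
        case True
        thus ?thesis using zM zm' zwa M by fastforce
      next
        case False
        have n: "w h \<noteq> (v ^^ l) j" if "l \<le> k" for l
        proof
          assume "w h = (v ^^ l) j"
          hence "h = (v ^^ Suc l) j" using sp_iv_eq[OF w, of h] by simp
          thus False using hO[of "Suc l"] h(2) that by (cases "l = k") (auto simp: a_def)
        qed
        have "z' (w h) = z (w h)" using n False by (intro zo) auto
        moreover have "w h \<noteq> j" "w h \<noteq> - j" using n[of 0] False by auto
        ultimately show ?thesis using leM[OF whU] eqM[OF whU] zwa by force
      qed
    qed
    hence g: "good (raise a M z')" using zwa by simp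
    show ?case
    proof (intro exI conjI allI impI)
      show "good (raise a M z')" by (rule g)
      show "raise a M z' ((v ^^ l) j) = M" if "l \<le> Suc k" for l
      proof (cases "l = Suc k")
        case True thus ?thesis by (simp add: raise_def a_def)
      next
        case False
        hence l: "l \<le> k" using that by simp
        have "(v ^^ l) j \<noteq> - a" using aO[OF l] by auto
        thus ?thesis using zM[OF l] by (simp add: raise_def)
      qed
      fix i assume i: "\<forall>l\<le>Suc k. i \<noteq> (v ^^ l) j \<and> i \<noteq> - (v ^^ l) j"
      hence "i \<noteq> a" "i \<noteq> - a" by (auto simp: a_def simp del: funpow.simps)
      thus "raise a M z' i = z i" using zo[of i] i by (simp add: raise_def)
    qed
  qed
  obtain z' where z': "good z'" and zM: "\<And>l. l < b \<Longrightarrow> z' ((v ^^ l) j) = M"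
    and zo: "\<And>i. (\<And>l. l < b \<Longrightarrow> i \<noteq> (v ^^ l) j \<and> i \<noteq> - (v ^^ l) j) \<Longrightarrow> z' i = z i"
    using ex[of "b - 1"] b(1) by (auto simp: less_Suc_eq_le[symmetric])
  define Orb where "Orb = {i. \<exists>l<b. i = (v ^^ l) j \<or> i = - (v ^^ l) j}"
  have OU: "i \<in> U" if "i \<in> Orb" for i using that Upow[OF j] U unfolding Orb_def by auto
  have Ov: "v i \<in> Orb" if i: "i \<in> Orb" for i
  proof -
    obtain l where l: "l < b" "i = (v ^^ l) j \<or> i = - (v ^^ l) j" using i by (auto simp: Orb_def)
    hence e: "v i = (v ^^ Suc l) j \<or> v i = - (v ^^ Suc l) j" by (auto simp: v_minus)
    show ?thesis
    proof (cases "Suc l < b")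
      case True thus ?thesis using e unfolding Orb_def by blast
    next
      case False
      hence "Suc l = b" using l by simp
      hence "v i = (v ^^ 0) j \<or> v i = - (v ^^ 0) j" using e b(2) by auto
      thus ?thesis using b(1) unfolding Orb_def by (intro CollectI exI[of _ 0]) auto
    qed
  qed
  have Ow: "w i \<in> Orb" if i: "i \<in> Orb" for i
  proof -
    obtain l where l: "l < b" "i = (v ^^ l) j \<or> i = - (v ^^ l) j" using i by (auto simp: Orb_def)
    show ?thesis
    proof (cases l)
      case (Suc k)
      hence "w i = (v ^^ k) j \<or> w i = - (v ^^ k) j" using l w_vpow_Suc[of k j] by (auto simp: sp_minus[OF w] simp del: funpow.simps)
      thus ?thesis using l(1) Suc unfolding Orb_def by (intro CollectI exI[of _ k]) auto
    next
      case 0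
      hence "i = j \<or> i = - j" using l by simp
      \<comment> \<open>Stepping back from j enters the orbit at its last point v^(b-1) j, up to
        sign.\<close>
      moreover have "j = (v ^^ b) j \<or> j = - (v ^^ b) j" using b(2) by auto
      moreover have "(v ^^ b) j = (v ^^ Suc (b - 1)) j" using b(1) by simp
      ultimately have "i = (v ^^ Suc (b - 1)) j \<or> i = - (v ^^ Suc (b - 1)) j" by auto
      hence "w i = (v ^^ (b - 1)) j \<or> w i = - (v ^^ (b - 1)) j"
        using w_vpow_Suc[of "b - 1" j] by (auto simp: sp_minus[OF w] simp del: funpow.simps)
      thus ?thesis using b(1) unfolding Orb_def by (intro CollectI exI[of _ "b - 1"]) auto
    qed
  qed
  have Om: "- i \<in> Orb \<longleftrightarrow> i \<in> Orb" for i unfolding Orb_def by (auto simp: minus_equation_iff)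
  have jO: "j \<in> Orb" unfolding Orb_def using b(1) by (intro CollectI exI[of _ 0]) auto
  have zO: "z' i = z i" if "i \<notin> Orb" for i using that unfolding Orb_def by (intro zo) auto
  have zOM: "\<bar>z' i\<bar> = M" if "i \<in> Orb" for i
    using that zM goodD(4)[OF z'] M unfolding Orb_def by auto
  define U' where "U' = U - Orb"
  have "stage z' U'"
    unfolding stage_def
  proof (intro conjI ballI impI)
    show "good z'" by (rule z')
    show "U' \<subseteq> Z0" using UZ by (auto simp: U'_def)
    show "- i \<in> U'" if "i \<in> U'" for i using that U Om by (auto simp: U'_def)
    show "v i \<in> U'" if "i \<in> U'" for i
      using that U Ow[of "v i"] sp_eq_iv[OF w, of i] by (auto simp: U'_def)
    show "w i \<in> U'" if "i \<in> U'" for i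
      using that U Ov[of "w i"] sp_iv_eq[OF w, of i] by (auto simp: U'_def)
    show "z' i \<noteq> 0" if "i \<in> U'" for i using that U zO by (auto simp: U'_def)
    show "a = c \<or> a = - c" if "a \<in> U'" "c \<in> U'" "\<bar>z' a\<bar> = \<bar>z' c\<bar>" for a c
      using that gen[of a c] zO by (auto simp: U'_def)
    show "\<bar>z' i\<bar> < \<bar>z' h\<bar>" if i: "i \<in> U'" and h: "h \<in> Z0 - U'" for i h
    proof (cases "h \<in> Orb")
      case True
      have "i \<noteq> j" "i \<noteq> - j" using i jO Om[of j] by (auto simp: U'_def)
      hence "\<bar>z i\<bar> < M" using leM[of i] eqM[of i] i by (force simp: U'_def)
      thus ?thesis using zOM[OF True] zO[of i] i by (simp add: U'_def)
    next
      case False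
      thus ?thesis using sep[of i h] i h zO by (auto simp: U'_def)
    qed
    show "aligned z' (Z0 - U')"
      unfolding aligned_def
    proof
      fix h assume h: "h \<in> Z0 - U'"
      show "\<exists>j \<in> Z0 - U'. \<exists>b l. cyc z' j b \<and> l < b \<and> (h = (v ^^ l) j \<or> h = - (v ^^ l) j)"
      proof (cases "h \<in> Orb")
        case True
        then obtain l where l: "l < b" "h = (v ^^ l) j \<or> h = - (v ^^ l) j" by (auto simp: Orb_def)
        have "z' j = M" using zM[of 0] b(1) by simp
        hence "cyc z' j b" unfolding cyc_def using b M zM by simp
        moreover have "j \<in> Z0 - U'" using j UZ jO by (auto simp: U'_def)
        ultimately show ?thesis using l by blast
      next
        case False
        hence "h \<in> Z0 - U" using h by (auto simp: U'_def)
        then obtain i c l where i: "i \<in> Z0 - U" "cyc z i c" "l < c" "h = (v ^^ l) i \<or> h = - (v ^^ l) i"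
          using al unfolding aligned_def by blast
        have pow: "(v ^^ k) i \<notin> U" for k
        proof
          assume "(v ^^ k) i \<in> U"
          hence "i \<in> U"
          proof (induction k)
            case (Suc k)
            hence "w ((v ^^ Suc k) i) \<in> U" using U by blast
            thus ?case using Suc.IH by (simp only: w_vpow_Suc)
          qed simp
          thus False using i(1) by simp
        qed
        have "z' ((v ^^ k) i) = z ((v ^^ k) i)" for k using zO pow[of k] OU by blast
        hence "cyc z' i c" using i(2) unfolding cyc_def by (metis funpow_0)
        moreover have "i \<in> Z0 - U'" using i(1) by (auto simp: U'_def)
        ultimately show ?thesis using i(3,4) by blast
      qed
    qed
  qed
  moreover have "U' \<subset> U" using j jO by (auto simp: U'_def)
  ultimately show ?thesis by (rule that)
qed

lemma reach_aligned:
  assumes y: "y \<in> Y" and p: "aff y u1 \<in> alc (roof T) n"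
  obtains z where "good z" "aligned z Z0"
proof -
  obtain z where z: "good z" "\<And>i. i \<in> Z0 \<Longrightarrow> z i \<noteq> 0"
    "\<And>a b. a \<in> Z0 \<Longrightarrow> b \<in> Z0 \<Longrightarrow> \<bar>z a\<bar> = \<bar>z b\<bar> \<Longrightarrow> a = b \<or> a = - b"
    using initial_good[OF y p] by metis
  have "stage z Z0"
    unfolding stage_def using z by (auto simp: Z0_minus Z0_v Z0_w aligned_def)
  moreover have "\<exists>z. good z \<and> aligned z Z0" if "finite U" "stage z U" for z U
    using that
  proof (induction U arbitrary: z rule: finite_psubset_induct)
    case (psubset U)
    show ?case
    proof (cases "U = {}")
      case True
      thus ?thesis using psubset.prems unfolding stage_def by auto
    next
      case False
      obtain z' U' where "stage z' U'" "U' \<subset> U" using stage_step[OF psubset.prems False] .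
      thus ?thesis using psubset.IH by blast
    qed
  qed
  ultimately show ?thesis using finite_Z0 that by blast
qed

end

section \<open>Matching with elements of the centraliser\<close>

text \<open>The translation part of the k-th power of \<open>x\<close>.\<close>

definition orbit0 :: "elt \<Rightarrow> nat \<Rightarrow> vec" where
  "orbit0 x k = (aff x ^^ k) 0"

lemma aff_Zn: "x \<in> grp n \<Longrightarrow> u \<in> Zn n \<Longrightarrow> aff x u \<in> Zn n"
  unfolding aff_def by (intro Zn_add act_Zn grpD)

lemma orbit0_Zn: "x \<in> grp n \<Longrightarrow> orbit0 x k \<in> Zn n"
  by (induction k) (simp_all add: orbit0_def Zn_zero aff_Zn)

lemma orbit0_Suc: "orbit0 x (Suc k) i = fst x i + orbit0 x k (iv (snd x) i)"
  by (simp add: orbit0_def aff_apply)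

lemma aff_funpow: "(aff x ^^ k) U i = orbit0 x k i + U ((iv (snd x) ^^ k) i)"
proof (induction k arbitrary: i)
  case (Suc k)
  thus ?case by (simp add: aff_apply orbit0_Suc funpow_swap1)
qed (simp add: orbit0_def)

text \<open>Splits off the innermost factor of the power, where \<open>orbit0_Suc\<close> splits off
  the outermost one; comparing the two shows that powers commute with \<open>x\<close>.\<close>

lemma orbit0_Suc': "orbit0 x (Suc k) i = orbit0 x k i + fst x ((iv (snd x) ^^ k) i)"
proof -
  have "(aff x ^^ k) (fst x) i = orbit0 x k i + fst x ((iv (snd x) ^^ k) i)" by (rule aff_funpow)
  moreover have "aff x 0 = fst x" by (simp add: aff_def act_zero)
  ultimately show ?thesis by (simp add: orbit0_def funpow_swap1)
qed

lemma invariant_funpow: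
  assumes "w \<in> signed_perms n" "\<And>i. f (w i) = f i"
  shows "f (iv w i) = f i" "f ((w ^^ l) i) = f i" "f ((iv w ^^ l) i) = f i"
proof -
  show *: "f (iv w i) = f i" for i using assms(2)[of "iv w i"] by (simp add: sp_eq_iv[OF assms(1)])
  show "f ((w ^^ l) i) = f i" "f ((iv w ^^ l) i) = f i"
    by (induction l arbitrary: i) (simp_all add: assms(2) *)
qed

text \<open>The centralising element acts on each cycle as a power of \<open>x\<close>, followed by a translation
  and possibly by a sign change.\<close>

lemma centraliser:
  fixes k :: "int \<Rightarrow> nat" and e :: "int \<Rightarrow> int" and m :: vec
  assumes x: "x \<in> grp n" and m: "m \<in> Zn n"
    and k: "\<And>i. k (- i) = k i" "\<And>i. k (snd x i) = k i"
    and e: "\<And>i. e i = 1 \<or> e i = - 1" "\<And>i. e (- i) = e i" "\<And>i. e (snd x i) = e i"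
      "\<And>i. i \<notin> idx n \<Longrightarrow> e i = 1"
    and mw: "\<And>i. m (snd x i) = m i" and fx: "\<And>i. e i = - 1 \<Longrightarrow> fst x i = 0"
  obtains g where "g \<in> grp n" "gconj g x = x"
    "\<And>U i. U \<in> Rn n \<Longrightarrow> aff g U i = m i + of_int (e i) * (aff x ^^ k i) U i"
    "\<And>i. iv (snd g) i = e i * (iv (snd x) ^^ k i) i"
proof -
  define w where "w = snd x"
  define v where "v = iv w"
  have w: "w \<in> signed_perms n" using grpD(2)[OF x] by (simp add: w_def)
  have v: "v \<in> signed_perms n" unfolding v_def by (rule sp_iv[OF w])
  have wm: "(w ^^ l) (- i) = - (w ^^ l) i" and vm: "(v ^^ l) (- i) = - (v ^^ l) i" for l i
    using sp_minus[OF sp_pow[OF w]] sp_minus[OF sp_pow[OF v]] by auto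
  have wv: "w (v i) = i" and vw: "v (w i) = i" for i
    using sp_eq_iv[OF w] sp_iv_eq[OF w] by (auto simp: v_def)
  have wvk: "(w ^^ l) ((v ^^ l) i) = i" and vwk: "(v ^^ l) ((w ^^ l) i) = i" for l i
    by (induction l arbitrary: i) (simp_all add: funpow_swap1 wv vw)
  have kw: "k (w i) = k i" and ew: "e (w i) = e i" for i using k(2) e(3) by (auto simp: w_def)
  have esq: "e i * (e i * j) = j" for i j using e(1)[of i] by auto
  have emul: "k (e i * j) = k j" "e (e i * j) = e j" for i j
    using e(1)[of i] k(1)[of j] e(2)[of j] by auto
  have odd: "f (e i * j) = e i * f j" if "\<And>j. f (- j) = - f j" for f :: "int \<Rightarrow> int" and i j
    using e(1)[of i] that[of j] by auto
  have ow: "(w ^^ l) (e i * j) = e i * (w ^^ l) j" and ov: "(v ^^ l) (e i * j) = e i * (v ^^ l) j" for l i j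
    using odd[of "w ^^ l"] odd[of "v ^^ l"] wm vm by blast+
  note kpow = invariant_funpow[of w n k, OF w kw, folded v_def]
  note epow = invariant_funpow[of w n e, OF w ew, folded v_def]
  define \<theta> where "\<theta> i = e i * (v ^^ k i) i" for i
  define \<tau> where "\<tau> i = e i * (w ^^ k i) i" for i
  have e\<theta>: "e (\<theta> i) = e i" "k (\<theta> i) = k i" "e (\<tau> i) = e i" "k (\<tau> i) = k i" for i
    by (simp_all add: \<theta>_def \<tau>_def emul kpow epow)
  \<comment> \<open>Inverse to each other because \<open>k\<close> and \<open>e\<close> are constant
    along cycles and under negation.\<close>
  have "\<theta> (\<tau> i) = i" "\<tau> (\<theta> i) = i" for i
    using e\<theta> by (simp_all add: \<theta>_def[of "\<tau> i"] \<tau>_def[of "\<theta> i"])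
      (simp_all add: \<theta>_def \<tau>_def ow ov wvk vwk esq)
  moreover have \<tau>m: "\<tau> (- i) = - \<tau> i" for i by (simp add: \<tau>_def k e wm)
  moreover have "\<tau> i = i" if "i \<notin> idx n" for i
    using e(4)[OF that] sp_outside[OF sp_pow[OF w] that] by (simp add: \<tau>_def)
  ultimately have \<tau>: "\<tau> \<in> signed_perms n" "iv \<tau> = \<theta>"
    using signed_perms_inverses[of \<tau> \<theta> n] by blast+
  define \<eta> where "\<eta> i = m i + of_int (e i) * orbit0 x (k i) i" for i
  define g where "g = (\<eta>, \<tau>)"
  have "\<eta> \<in> Zn n"
  proof -
    have "\<eta> \<in> Rn n"
      using Rn_minus[OF Zn_Rn[OF m]] Rn_minus[OF Zn_Rn[OF orbit0_Zn[OF x]]]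
        Rn_outside[OF Zn_Rn[OF m]] Rn_outside[OF Zn_Rn[OF orbit0_Zn[OF x]]]
      by (intro RnI) (simp_all add: \<eta>_def k e)
    thus ?thesis using Zn_int[OF m] Zn_int[OF orbit0_Zn[OF x]] by (simp add: Zn_def \<eta>_def)
  qed
  hence g: "g \<in> grp n" using \<tau> by (simp add: g_def grp_def)
  have "\<tau> \<circ> w = w \<circ> \<tau>"
    using odd[of w] sp_minus[OF w] by (simp add: fun_eq_iff \<tau>_def ew kw funpow_swap1)
  moreover have "\<eta> + act \<tau> (fst x) = fst x + act w \<eta>"
  proof
    fix i
    have kv: "k (v i) = k i" "e (v i) = e i" "m (v i) = m i"
      using kpow(1) epow(1) invariant_funpow(1)[of w n m, OF w] mw by (auto simp: w_def v_def)
    have o: "fst x (- j) = - fst x j" for j using Rn_minus[OF Zn_Rn[OF grpD(1)[OF x]]] .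
    have 1: "fst x (\<theta> i) = of_int (e i) * fst x ((v ^^ k i) i)"
      using e(1)[of i] by (auto simp: \<theta>_def o)
    \<comment> \<open>Both sides are the translation part of the power with exponent
      \<open>k i + 1\<close>, split at its two ends.\<close>
    have 2: "orbit0 x (k i) i + fst x ((v ^^ k i) i) = fst x i + orbit0 x (k i) (v i)"
      using orbit0_Suc[of x "k i" i] orbit0_Suc'[of x "k i" i] by (simp add: v_def w_def)
    \<comment> \<open>Signs are changed only where \<open>x\<close> has no translation.\<close>
    have 3: "of_int (e i) * fst x i = fst x i" using e(1)[of i] fx[of i] by auto
    have "of_int (e i) * orbit0 x (k i) i + of_int (e i) * fst x ((v ^^ k i) i) =
        of_int (e i) * fst x i + of_int (e i) * orbit0 x (k i) (v i)"
      unfolding distrib_left[symmetric] 2 ..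
    thus "(\<eta> + act \<tau> (fst x)) i = (fst x + act w \<eta>) i"
      by (simp add: act_def \<tau>(2) v_def[symmetric] \<eta>_def kv 1 3)
  qed
  ultimately have "gmul g x = gmul x g" by (simp add: gmul_def g_def w_def)
  hence "gconj g x = gmul x (gmul g (ginv g))"
    unfolding gconj_def using gmul_assoc grp_bij[OF x] grp_bij[OF g] by metis
  hence c: "gconj g x = x" using ginv_right[OF grp_bij[OF g]] by (simp add: gmul_id)
  have "aff g U i = m i + of_int (e i) * (aff x ^^ k i) U i" if U: "U \<in> Rn n" for U i
  proof -
    have "U (\<theta> i) = of_int (e i) * U ((v ^^ k i) i)"
      using e(1)[of i] Rn_minus[OF U] by (auto simp: \<theta>_def)
    thus ?thesis
      by (simp add: aff_apply g_def \<tau>(2) \<eta>_def aff_funpow v_def w_def algebra_simps)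
  qed
  moreover have "iv (snd g) i = e i * (iv (snd x) ^^ k i) i" for i
    by (simp add: g_def \<tau>(2) \<theta>_def v_def w_def)
  ultimately show ?thesis using that g c by blast
qed

text \<open>If t is in the box, then k + t lies in the required range only for k = 0, whereas k - t
  would need 0 < k < 1. So neither a translation nor a sign can occur.\<close>

lemma box_translation_zero:
  assumes h: "inG T n h" and U: "U \<in> Rn n"
    and box: "\<And>i. i \<in> {1..int n} \<Longrightarrow> 0 \<le> U i \<and> U i < roof T \<and> (T \<noteq> Type_A \<longrightarrow> 0 < U i)"
    and hU: "aff h U \<in> alc (roof T) n" "T = Type_A \<Longrightarrow> aff h U 1 < 1"
  shows "h \<in> {0} \<times> sym_perms n"
proof -
  have hb: "0 \<le> aff h U i \<and> aff h U i \<le> roof T \<and> (T = Type_A \<longrightarrow> aff h U i < 1)" if i: "i \<in> {1..int n}" for i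
    using alc_bounds[OF hU(1) i] alc_mono[OF hU(1), of 1 i] i hU(2) by force
  have main: "fst h i = 0 \<and> 0 < iv (snd h) i" if i: "i \<in> {1..int n}" for i
  proof -
    let ?j = "iv (snd h) i"
    obtain k where k: "fst h i = of_int k" using inG_int[OF h, of i] by (auto elim: Ints_cases)
    have e: "aff h U i = of_int k + U ?j" by (simp add: aff_apply k)
    from inG_iv_idx[OF h i] show ?thesis
    proof (cases rule: idx_cases)
      case 1
      have "of_int (- 1) < real_of_int k" "real_of_int k < of_int 1"
        using hb[OF i] box[OF 1] e by (auto simp: roof_def split: if_splits)
      hence "k = 0" unfolding of_int_less_iff by simp
      thus ?thesis using k 1 by simp
    next
      case 2
      hence T: "T \<noteq> Type_A" using inG_iv_pos[of n h i] h i by auto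
      have "of_int 0 < real_of_int k" "real_of_int k < of_int 1"
        using hb[OF i] box[OF 2] e T Rn_minus[OF U, of ?j] by (auto simp: roof_def)
      thus ?thesis unfolding of_int_less_iff by simp
    qed
  qed
  have hG: "h \<in> grp n" by (rule inG_grp[OF h])
  have "fst h = 0" using main by (intro Rn_eqI[OF Zn_Rn[OF grpD(1)[OF hG]] Rn_zero]) simp
  moreover have "iv (snd h) \<in> sym_perms n" using main sp_iv[OF grpD(2)[OF hG]] by (simp add: sym_perms_def)
  hence "snd h \<in> sym_perms n" using sym_perms_iv[of "iv (snd h)" n] sp_iv_iv[OF grpD(2)[OF hG]] by simp
  ultimately show ?thesis by (simp add: mem_Times_iff)
qed

text \<open>The element \<open>gmul y (ginv g)\<close> carries the boxed point
  \<open>aff g U\<close> into the alcove, so it is a permutation; and it conjugates \<open>x\<close>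
  as \<open>y\<close> does, because \<open>g\<close> centralises \<open>x\<close>.\<close>

lemma orbitI:
  assumes y: "inG T n y" and x: "inG T n x" and g: "inG T n g" "gconj g x = x" and U: "U \<in> Rn n"
    and box: "\<And>i. i \<in> {1..int n} \<Longrightarrow> 0 \<le> aff g U i \<and> aff g U i < roof T \<and> (T \<noteq> Type_A \<longrightarrow> 0 < aff g U i)"
    and yU: "aff y U \<in> alc (roof T) n" "T = Type_A \<Longrightarrow> aff y U 1 < 1"
  shows "gconj y x \<in> Sn_orbit T n x"
proof -
  note yG = inG_grp[OF y] and gG = inG_grp[OF g(1)] and xG = inG_grp[OF x]
  define h where "h = gmul y (ginv g)"
  have hG: "inG T n h" unfolding h_def by (intro inG_gmul y inG_ginv g)
  have e: "aff h (aff g U) = aff y U"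
    unfolding h_def using aff_gmul[OF grp_bij[OF yG] ginv_bij[OF grp_bij[OF gG]]] aff_ginv[OF grp_bij[OF gG]] by simp
  have h: "h \<in> {0} \<times> sym_perms n"
    by (rule box_translation_zero[OF hG aff_Rn[OF gG U] box]) (use yU e in auto)
  have "gmul h g = gmul y (gmul (ginv g) g)"
    unfolding h_def using gmul_assoc[of y "ginv g" g] grp_bij[OF yG] ginv_bij[OF grp_bij[OF gG]] by simp
  hence "gmul h g = y" using ginv_left[OF grp_bij[OF gG]] by (simp add: gmul_id)
  hence "gconj y x = gconj h x" using gconj_gmul[OF inG_grp[OF hG] gG xG] g(2) by simp
  moreover have "m_inv (ext_group T n) h = ginv h"
    using hG m_inv_ext_group[of h n T] by (auto simp: inG_def)
  ultimately show ?thesis using h unfolding Sn_orbit_def conj_orbit_def gconj_def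
    by (intro CollectI exI[of _ h]) (simp add: ext_group_mult)
qed

section \<open>The finite part of the standard elements\<close>

lemma cycle_upto:
  assumes "a \<le> i" "i \<le> b" shows "cycle_of_list [a..b] i = (if i = b then a else i + 1)"
proof -
  have c: "distinct [a..b]" by simp
  have l: "length [a..b] = nat (b - a + 1)" by simp
  define k where "k = nat (i - a)"
  have k: "k < length [a..b]" "[a..b] ! k = i" using assms by (auto simp: k_def nth_upto)
  have "map (cycle_of_list [a..b]) [a..b] = rotate1 [a..b]"
    using cyclic_rotation[OF c, of 1] by (simp add: rotate1_rotate_swap)
  hence "cycle_of_list [a..b] i = rotate1 [a..b] ! k" using k by (metis nth_map)
  also have "\<dots> = [a..b] ! (Suc k mod length [a..b])" by (rule nth_rotate1[OF k(1)])
  also have "\<dots> = (if i = b then a else i + 1)"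
  proof (cases "i = b")
    case True
    hence "Suc k = length [a..b]" using assms by (simp add: k_def)
    thus ?thesis using True assms by (simp add: nth_upto)
  next
    case False
    hence "Suc k < length [a..b]" using assms by (simp add: k_def)
    hence "Suc k mod length [a..b] = Suc k" by simp
    thus ?thesis using False assms by (simp add: k_def nth_upto)
  qed
  finally show ?thesis .
qed

lemma cycle_outside: "i \<notin> set cs \<Longrightarrow> cycle_of_list cs i = i"
  by (rule id_outside_supp)

lemma cycle_uminus: "cycle_of_list (map uminus cs) (- i) = - cycle_of_list cs (i :: int)"
  by (induction cs arbitrary: i rule: cycle_of_list.induct) (auto simp: transpose_def)

lemma signed_cycle_upto:
  assumes a: "1 \<le> a"
  shows "signed_cycle [a..b] (- i) = - signed_cycle [a..b] i"
    and "a \<le> i \<Longrightarrow> i \<le> b \<Longrightarrow> signed_cycle [a..b] i = (if i = b then a else i + 1)"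
    and "1 \<le> i \<Longrightarrow> i < a \<or> b < i \<Longrightarrow> signed_cycle [a..b] i = i"
proof -
  let ?c = "cycle_of_list [a..b]"
  have pos: "signed_cycle [a..b] i = ?c i" if "0 \<le> i" for i
    using that a cycle_outside[of i "map uminus [a..b]"] by (force simp: signed_cycle_def)
  have neg: "signed_cycle [a..b] (- i) = - ?c i" if i: "0 \<le> i" for i
  proof -
    have "?c i \<ge> 0"
      using cycle_upto[of a i b] cycle_outside[of i "[a..b]"] a i by (cases "a \<le> i \<and> i \<le> b") (auto split: if_splits)
    hence "?c (- ?c i) = - ?c i" using a by (intro cycle_outside) auto
    thus ?thesis by (simp add: signed_cycle_def cycle_uminus)
  qed
  show "signed_cycle [a..b] (- i) = - signed_cycle [a..b] i"
    using pos[of i] neg[of i] pos[of "- i"] neg[of "- i"] by (cases "0 \<le> i") auto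
  show "a \<le> i \<Longrightarrow> i \<le> b \<Longrightarrow> signed_cycle [a..b] i = (if i = b then a else i + 1)"
    using pos[of i] a cycle_upto[of a i b] by simp
  show "1 \<le> i \<Longrightarrow> i < a \<or> b < i \<Longrightarrow> signed_cycle [a..b] i = i"
    using pos[of i] cycle_outside[of i "[a..b]"] by auto
qed

lemma signed_cycle_signed:
  assumes "1 \<le> a" "b \<le> int n" shows "signed_cycle [a..b] \<in> signed_perms n"
proof -
  have "cycle_of_list [a..b] permutes idx n"
    by (rule permutes_subset[OF cycle_permutes]) (use assms in \<open>auto simp: idx_def\<close>)
  moreover have "cycle_of_list (map uminus [a..b]) permutes idx n"
    by (rule permutes_subset[OF cycle_permutes]) (use assms in \<open>auto simp: idx_def\<close>)
  ultimately show ?thesis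
    unfolding signed_perms_iff using signed_cycle_upto(1)[OF assms(1)]
    by (auto simp: signed_cycle_def intro: permutes_compose)
qed

lemma sign_change_eq: "sign_change i j = (if \<bar>j\<bar> = \<bar>i\<bar> then - j else j)"
  by (auto simp: sign_change_def transpose_def abs_if split: if_splits)

lemma sign_change_signed:
  assumes "1 \<le> i" "i \<le> int n" shows "sign_change i \<in> signed_perms n"
proof (rule signed_perms_inverses(1)[where g = "sign_change i"])
  show "j \<notin> idx n \<Longrightarrow> sign_change i j = j" for j using assms by (auto simp: sign_change_eq idx_def)
qed (auto simp: sign_change_eq)

lemma compose_all_signed: "(\<And>f. f \<in> set fs \<Longrightarrow> f \<in> signed_perms n) \<Longrightarrow> compose_all fs \<in> signed_perms n"
proof (induction fs)
  case Nil
  have "compose_all [] = id" by (simp add: compose_all_def fun_eq_iff)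
  thus ?case using sp_id by metis
next
  case (Cons f fs)
  hence "f \<circ> compose_all fs \<in> signed_perms n" by (intro sp_comp) auto
  moreover have "compose_all (f # fs) = f \<circ> compose_all fs" by (simp add: compose_all_def fun_eq_iff)
  ultimately show ?case by metis
qed

text \<open>The factor of \<open>j0\<close> preserves \<open>A\<close> and all others fix it
  pointwise, so on \<open>A\<close> the product reduces to that factor.\<close>

lemma compose_all_block:
  assumes "distinct js" "\<And>j. j \<in> set js \<Longrightarrow> j \<noteq> j0 \<Longrightarrow> (\<forall>i \<in> A. f j i = i)" "\<And>i. i \<in> A \<Longrightarrow> f j0 i \<in> A" "i \<in> A"
  shows "compose_all (map f js) i = (if j0 \<in> set js then f j0 i else i)"
  using assms
proof (induction js)
  case (Cons j js)
  have IH: "compose_all (map f js) i = (if j0 \<in> set js then f j0 i else i)"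
    using Cons.prems by (intro Cons.IH) auto
  have c: "compose_all (map f (j # js)) i = f j (compose_all (map f js) i)" by (simp add: compose_all_def)
  show ?case
  proof (cases "j = j0")
    case True
    thus ?thesis using c IH Cons.prems(1) by simp
  next
    case False
    hence "compose_all (map f js) i \<in> A" using IH Cons.prems(3,4) by simp
    thus ?thesis using c IH False Cons.prems(2)[of j] by auto
  qed
qed (simp add: compose_all_def)

lemma psum_Suc: "j < length bs \<Longrightarrow> psum bs (Suc j) = psum bs j + bs ! j"
  by (simp add: psum_def take_Suc_conv_app_nth)

lemma psum_mono: "i \<le> j \<Longrightarrow> psum bs i \<le> psum bs j"
proof (induction j rule: dec_induct)
  case (step j)
  thus ?case using psum_Suc[of j bs] by (cases "j < length bs") (auto simp: psum_def)
qed simp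

lemma nth_concat_psum:
  "j < length xss \<Longrightarrow> i < length (xss ! j) \<Longrightarrow> concat xss ! (psum (map length xss) j + i) = xss ! j ! i"
proof (induction xss arbitrary: j)
  case (Cons xs xss)
  thus ?case by (cases j) (auto simp: psum_def nth_append)
qed simp

lemma vec_of_list_pos: "1 \<le> i \<Longrightarrow> i \<le> int (length xs) \<Longrightarrow> vec_of_list xs i = xs ! nat (i - 1)"
  by (simp add: vec_of_list_def)

lemma vec_of_list_Zn:
  assumes "length xs = n" "set xs \<subseteq> \<int>" shows "vec_of_list xs \<in> Zn n"
proof -
  have "vec_of_list xs \<in> Rn n"
    using assms(1) by (intro RnI) (auto simp: vec_of_list_def idx_def)
  moreover have "vec_of_list xs i \<in> \<int>" for i
    using assms by (auto simp: vec_of_list_def intro!: Ints_minus subsetD[OF assms(2) nth_mem])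
  ultimately show ?thesis by (simp add: Zn_def)
qed

definition ceil_step :: "nat \<Rightarrow> int \<Rightarrow> nat \<Rightarrow> int" where
  "ceil_step b c i = \<lceil>real i * of_int c / real b\<rceil> - \<lceil>(real i - 1) * of_int c / real b\<rceil>"

lemma chi'_eq: "chi' b c = map (\<lambda>i. of_int (ceil_step b c i)) (rev [1..<b + 1])"
  by (simp add: chi'_def ceil_step_def Let_def)

lemma length_chi': "length (chi' b c) = b"
  by (simp add: chi'_eq)

text \<open>The steps are listed in descending order, which accounts for the index b + 1 -
  t.\<close>

lemma nth_chi': "1 \<le> t \<Longrightarrow> t \<le> b \<Longrightarrow> chi' b c ! (t - 1) = of_int (ceil_step b c (b + 1 - t))"
proof -
  assume t: "1 \<le> t" "t \<le> b"
  have "rev [1..<b + 1] ! (t - 1) = [1..<b + 1] ! (length [1..<b + 1] - Suc (t - 1))"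
    by (rule rev_nth) (use t in simp)
  also have "\<dots> = b + 1 - t" using t by (subst nth_upt) auto
  finally have "rev [1..<b + 1] ! (t - 1) = b + 1 - t" .
  moreover have "t - 1 < length (rev [1..<b + 1])" using t by simp
  ultimately show "chi' b c ! (t - 1) = of_int (ceil_step b c (b + 1 - t))"
    unfolding chi'_eq by (simp only: nth_map)
qed

section \<open>The blocks of a pair of double partitions\<close>

locale dblocks =
  fixes n :: nat and p q :: dpart
  assumes DP: "(p, q) \<in> DP n"
begin

definition r :: dpart where "r = p @ q"

definition L :: nat where "L = length r"

definition bl :: "nat \<Rightarrow> nat" where "bl j = fst (r ! j)"

definition cl :: "nat \<Rightarrow> int" where "cl j = snd (r ! j)"

text \<open>Blocks are counted from 0; block \<open>j\<close> occupies the positions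
  \<open>st j + 1\<close> to \<open>st j + bl j\<close>.\<close>

definition st :: "nat \<Rightarrow> nat" where "st j = psum (map fst r) j"

definition neg :: "nat \<Rightarrow> bool" where "neg j \<longleftrightarrow> length p \<le> j"

lemma r_mem: "j < L \<Longrightarrow> (bl j, cl j) \<in> set p \<or> (bl j, cl j) \<in> set q"
  using nth_mem[of j r] by (auto simp: L_def bl_def cl_def r_def)

lemma bl_pos: "j < L \<Longrightarrow> 1 \<le> bl j"
  using r_mem[of j] DP by (auto simp: DP_def double_partition_def)

lemma neg_special: "j < L \<Longrightarrow> neg j \<Longrightarrow> cl j = 0 \<or> cl j = 1"
proof -
  assume j: "j < L" "neg j"
  have "r ! j = q ! (j - length p)" "j - length p < length q"
    using j by (auto simp: r_def L_def neg_def nth_append)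
  hence "(bl j, cl j) \<in> set q" by (simp add: bl_def cl_def)
  thus ?thesis using DP by (auto simp: DP_def special_def)
qed

lemma st_Suc: "j < L \<Longrightarrow> st (Suc j) = st j + bl j"
  by (simp add: st_def L_def psum_Suc bl_def)

lemma st_0: "st 0 = 0"
  by (simp add: st_def psum_def)

lemma st_L: "st L = n"
  using DP by (simp add: st_def L_def psum_def r_def DP_def)

lemma st_mono: "i \<le> j \<Longrightarrow> st i \<le> st j"
  by (simp add: st_def psum_mono)

lemma st_le: "j < L \<Longrightarrow> st j + bl j \<le> n"
  using st_mono[of "Suc j" L] st_Suc[of j] st_L by simp

text \<open>The sign of the index is dropped, since a negative cycle joins i with - i.\<close>

definition blk :: "int \<Rightarrow> nat" where
  "blk i = (LEAST j. nat \<bar>i\<bar> \<le> st (Suc j))"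

lemma blk_eq: "j < L \<Longrightarrow> 1 \<le> t \<Longrightarrow> t \<le> bl j \<Longrightarrow> \<bar>i\<bar> = int (st j + t) \<Longrightarrow> blk i = j"
  unfolding blk_def
proof (rule Least_equality)
  assume j: "j < L" "1 \<le> t" "t \<le> bl j" "\<bar>i\<bar> = int (st j + t)"
  show "nat \<bar>i\<bar> \<le> st (Suc j)" using j st_Suc[of j] by simp
  fix k assume k: "nat \<bar>i\<bar> \<le> st (Suc k)"
  show "j \<le> k"
  proof (rule ccontr)
    assume "\<not> j \<le> k"
    hence "st (Suc k) \<le> st j" by (intro st_mono) simp
    thus False using j k by simp
  qed
qed

lemma blk_exists:
  assumes "i \<in> {1..int n}"
  obtains j t where "j < L" "1 \<le> t" "t \<le> bl j" "i = int (st j + t)"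
proof -
  define k where "k = nat i"
  have k: "1 \<le> k" "k \<le> st L" "i = int k" using assms by (auto simp: k_def st_L)
  have "\<exists>j<m. st j < k \<and> k \<le> st (Suc j)" if "k \<le> st m" for m
    using that
  proof (induction m)
    case 0
    thus ?case using k(1) st_0 by simp
  next
    case (Suc m)
    thus ?case by (cases "k \<le> st m") (auto intro: less_SucI)
  qed
  from this[OF k(2)] obtain j where j: "j < L" "st j < k" "k \<le> st (Suc j)" by blast
  thus ?thesis using that[of j "k - st j"] k(3) st_Suc[OF j(1)] by simp
qed

lemma st_in: "j < L \<Longrightarrow> 1 \<le> t \<Longrightarrow> t \<le> bl j \<Longrightarrow> int (st j + t) \<in> {1..int n}"
  using st_le[of j] by simp

abbreviation (input) "W \<equiv> w_part (map fst p) (map fst q)"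

lemma st_r: "psum (map fst p @ map fst q) j = st j"
  by (simp add: st_def r_def)

lemma W_eq: "W = compose_all (map (\<lambda>j. sign_change (int (st j))) [length p + 1..<L + 1]) \<circ>
   compose_all (map (\<lambda>j. signed_cycle [int (st (j - 1)) + 1..int (st j)]) [1..<L + 1])"
  by (simp add: w_part_def Let_def st_r L_def r_def)

lemma st_strict: "i < j \<Longrightarrow> j \<le> L \<Longrightarrow> st i < st j"
  using st_mono[of "Suc i" j] st_Suc[of i] bl_pos[of i] by simp

lemma W_signed: "W \<in> signed_perms n"
  unfolding W_eq
proof (intro sp_comp compose_all_signed)
  fix f assume "f \<in> set (map (\<lambda>j. sign_change (int (st j))) [length p + 1..<L + 1])"
  then obtain j where j: "f = sign_change (int (st j))" "1 \<le> j" "j \<le> L" by auto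
  have "st 0 < st j" using j by (intro st_strict) auto
  thus "f \<in> signed_perms n" using j st_mono[of j L] st_L st_0
    by (auto intro!: sign_change_signed)
next
  fix f assume "f \<in> set (map (\<lambda>j. signed_cycle [int (st (j - 1)) + 1..int (st j)]) [1..<L + 1])"
  then obtain j where j: "f = signed_cycle [int (st (j - 1)) + 1..int (st j)]" "j \<le> L" by auto
  thus "f \<in> signed_perms n" using st_mono[of j L] st_L by (auto intro!: signed_cycle_signed)
qed

definition nxt :: "nat \<Rightarrow> nat \<Rightarrow> nat" where
  "nxt j t = (if t = bl j then 1 else t + 1)"

text \<open>The cycle acts before the sign change, so the sign falls on the step that arrives at the
  last position, not on the one that leaves it.\<close>

lemma W_block:
  assumes j: "j < L" and t: "1 \<le> t" "t \<le> bl j"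
  shows "W (int (st j + t)) = (if neg j \<and> nxt j t = bl j then - int (st j + bl j) else int (st j + nxt j t))"
proof -
  let ?A = "{i. int (st j) < \<bar>i\<bar> \<and> \<bar>i\<bar> \<le> int (st (Suc j))}"
  let ?f = "\<lambda>j. signed_cycle [int (st (j - 1)) + 1..int (st j)]" and ?g = "\<lambda>j. sign_change (int (st j))"
  have s: "st (Suc j) = st j + bl j" by (rule st_Suc[OF j])
  have f0: "?f (Suc j) (int (st j + t)) = int (st j + nxt j t)"
    using t s by (simp add: signed_cycle_upto(2) nxt_def)
  have fA: "\<bar>?f (Suc j) i\<bar> = (if \<bar>i\<bar> = int (st (Suc j)) then int (st j) + 1 else \<bar>i\<bar> + 1)" if i: "i \<in> ?A" for i
  proof (cases "0 \<le> i")
    case True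
    thus ?thesis using i signed_cycle_upto(2)[of "int (st j) + 1" i "int (st (Suc j))"] by simp
  next
    case False
    have "?f (Suc j) i = - ?f (Suc j) (- i)"
      using signed_cycle_upto(1)[of "int (st j) + 1" "int (st (Suc j))" "- i"] by simp
    thus ?thesis using False i signed_cycle_upto(2)[of "int (st j) + 1" "- i" "int (st (Suc j))"] by simp
  qed
  have fixf: "?f k i = i" if "k \<in> set [1..<L + 1]" "k \<noteq> Suc j" "i \<in> ?A" for k i
  proof -
    have "Suc j \<le> k - 1 \<or> k \<le> j" using that by auto
    hence o: "int (st k) < \<bar>i\<bar> \<or> \<bar>i\<bar> < int (st (k - 1)) + 1"
      using st_mono[of "Suc j" "k - 1"] st_mono[of k j] that by auto
    show ?thesis
    proof (cases "0 \<le> i")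
      case True
      thus ?thesis using o that signed_cycle_upto(3)[of "int (st (k - 1)) + 1" i "int (st k)"] by auto
    next
      case False
      thus ?thesis using o that signed_cycle_upto(3)[of "int (st (k - 1)) + 1" "- i" "int (st k)"]
        signed_cycle_upto(1)[of "int (st (k - 1)) + 1" "int (st k)" "- i"] by auto
    qed
  qed
  have c: "compose_all (map ?f [1..<L + 1]) (int (st j + t)) = int (st j + nxt j t)"
    using compose_all_block[of "[1..<L + 1]" "Suc j" ?A ?f "int (st j + t)"] fixf fA f0 j t s by auto
  have n: "1 \<le> nxt j t" "nxt j t \<le> bl j" using t by (auto simp: nxt_def)
  have fixg: "?g k i = i" if "k \<in> set [length p + 1..<L + 1]" "k \<noteq> Suc j" "i \<in> ?A" for k i
  proof -
    have "Suc j < k \<or> k \<le> j" using that by auto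
    hence "st (Suc j) < st k \<or> st k \<le> st j" using st_strict[of "Suc j" k] st_mono[of k j] that by auto
    thus ?thesis using that by (auto simp: sign_change_eq)
  qed
  have mem: "Suc j \<in> set [length p + 1..<L + 1] \<longleftrightarrow> neg j" using j by (auto simp: neg_def)
  have "compose_all (map ?g [length p + 1..<L + 1]) (int (st j + nxt j t)) =
      (if Suc j \<in> set [length p + 1..<L + 1] then ?g (Suc j) (int (st j + nxt j t)) else int (st j + nxt j t))"
  proof (rule compose_all_block[where A = ?A])
    show "\<forall>i \<in> ?A. ?g k i = i" if "k \<in> set [length p + 1..<L + 1]" "k \<noteq> Suc j" for k
      using fixg[OF that] by blast
  qed (use n s in \<open>auto simp: sign_change_eq\<close>)
  hence g: "compose_all (map ?g [length p + 1..<L + 1]) (int (st j + nxt j t)) =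
      (if neg j then ?g (Suc j) (int (st j + nxt j t)) else int (st j + nxt j t))"
    unfolding mem .
  show ?thesis unfolding W_eq o_apply c g using n s by (auto simp: sign_change_eq)
qed

lemma r_lengths: "map length (map (\<lambda>(b, c). chi' b c) r) = map fst r"
  by (auto simp: length_chi')

abbreviation (input) "X \<equiv> w_std p q"

lemma snd_X: "snd X = W"
  by (simp add: w_std_def)

lemma X_length: "length (concat (map (\<lambda>(b, c). chi' b c) r)) = n"
  using DP by (simp add: length_concat comp_def case_prod_unfold length_chi' r_def DP_def)

lemma X_grp: "X \<in> grp n"
proof (rule grpI)
  show "fst X \<in> Zn n"
    unfolding w_std_def fst_conv r_def[symmetric]
    by (rule vec_of_list_Zn[OF X_length]) (auto simp: chi'_eq)
  show "snd X \<in> signed_perms n" unfolding snd_X by (rule W_signed)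
qed

lemma X_block:
  assumes j: "j < L" and t: "1 \<le> t" "t \<le> bl j"
  shows "fst X (int (st j + t)) = of_int (ceil_step (bl j) (cl j) (bl j + 1 - t))"
proof -
  let ?xss = "map (\<lambda>(b, c). chi' b c) r"
  have rj: "?xss ! j = chi' (bl j) (cl j)" using j by (simp add: L_def bl_def cl_def case_prod_unfold)
  have "fst X (int (st j + t)) = concat ?xss ! (st j + (t - 1))"
    unfolding w_std_def fst_conv r_def[symmetric]
    using st_in[OF assms] t X_length by (subst vec_of_list_pos) (auto simp: nat_diff_distrib nat_int_add algebra_simps)
  also have "\<dots> = chi' (bl j) (cl j) ! (t - 1)"
  proof -
    have pj: "psum (map length ?xss) j = st j" by (simp only: r_lengths st_def)
    show ?thesis
      using nth_concat_psum[of j ?xss "t - 1", unfolded pj rj] j t by (simp add: L_def length_chi')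
  qed
  finally show ?thesis using nth_chi'[OF t] by simp
qed

definition blockvec :: "(nat \<Rightarrow> nat \<Rightarrow> real) \<Rightarrow> vec" where
  "blockvec F = (\<lambda>i. if i \<in> idx n then of_int (sgn i) * F (blk i) (nat \<bar>i\<bar> - st (blk i)) else 0)"

lemma blk_minus: "blk (- i) = blk i"
  by (simp add: blk_def)

lemma blockvec_Rn: "blockvec F \<in> Rn n"
  by (intro RnI) (auto simp: blockvec_def blk_minus sgn_minus)

lemma blockvec_block:
  assumes "j < L" "1 \<le> t" "t \<le> bl j" shows "blockvec F (int (st j + t)) = F j t"
proof -
  have "int (st j + t) \<in> idx n" using st_in[OF assms] by (intro idxI) auto
  thus ?thesis using blk_eq[OF assms, of "int (st j + t)"] assms by (simp add: blockvec_def sgn_if nat_int_add)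
qed

lemma block_eqI:
  assumes "u \<in> Rn n" "v \<in> Rn n" "\<And>j t. j < L \<Longrightarrow> 1 \<le> t \<Longrightarrow> t \<le> bl j \<Longrightarrow> u (int (st j + t)) = v (int (st j + t))"
  shows "u = v"
  by (rule Rn_eqI[OF assms(1,2)]) (metis assms(3) blk_exists)

lemma iv_W: "iv W i = k \<longleftrightarrow> W k = i"
  using sp_iv_eq[OF W_signed] sp_eq_iv[OF W_signed] by metis

lemma iv_W_block:
  assumes j: "j < L" and t: "1 \<le> t" "t \<le> bl j"
  shows "iv W (int (st j + nxt j t)) = (if neg j \<and> nxt j t = bl j then - int (st j + t) else int (st j + t))"
  unfolding iv_W using W_block[OF assms] sp_minus[OF W_signed, of "int (st j + t)"] by auto

lemma sum_vec_apply: "(\<Sum>j\<in>A. f j) (i::int) = (\<Sum>j\<in>A. (f j i :: real))"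
  by (induction A rule: infinite_finite_induct) auto

lemma w_tilde_block:
  assumes j: "j < L" and t: "1 \<le> t" "t \<le> bl j"
  shows "fst (w_tilde p q) (int (st j + t)) = (if t = bl j then of_int (cl j) else 0)"
proof -
  have "fst (w_tilde p q) = (\<Sum>k = 1..L. scale (of_int (cl (k - 1))) (basis_vec (int (st k))))"
    by (simp add: w_tilde_def Let_def r_def[symmetric] L_def cl_def st_def)
  hence "fst (w_tilde p q) (int (st j + t)) =
      (\<Sum>k = 1..L. if k = Suc j \<and> t = bl j then of_int (cl j) else 0)"
    unfolding sum_vec_apply
  proof (simp only:, intro sum.cong refl)
    fix k assume k: "k \<in> {1..L}"
    have "int (st k) = int (st j + t) \<longleftrightarrow> k = Suc j \<and> t = bl j"
    proof
      assume e: "int (st k) = int (st j + t)"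
      have "\<not> k \<le> j" using st_mono[of k j] e t by auto
      moreover have "\<not> Suc j < k" using st_strict[of "Suc j" k] k e t st_Suc[OF j] by auto
      ultimately have "k = Suc j" by simp
      thus "k = Suc j \<and> t = bl j" using e st_Suc[OF j] by simp
    qed (use st_Suc[OF j] in simp)
    thus "scale (of_int (cl (k - 1))) (basis_vec (int (st k))) (int (st j + t)) =
        (if k = Suc j \<and> t = bl j then of_int (cl j) else 0)"
      using t by (auto simp: scale_def basis_vec_def)
  qed
  also have "\<dots> = (if t = bl j then of_int (cl j) else 0)"
    using j by (simp add: if_distrib sum.If_cases Collect_conj_eq)
  finally show ?thesis .
qed

lemma w_tilde_grp: "w_tilde p q \<in> grp n"
proof (rule grpI)
  have "(\<Sum>k \<in> A. scale (of_int (f k)) (basis_vec (int (st k)))) \<in> Zn n" if "A \<subseteq> {1..L}" for A and f :: "nat \<Rightarrow> int"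
    using finite_subset[OF that finite_atLeastAtMost] that
  proof (induction A rule: finite_induct)
    case (insert k A)
    have "int (st k) \<in> idx n" using st_strict[of 0 k] st_mono[of k L] st_L st_0 insert.prems by (auto simp: idx_def)
    hence "scale (of_int (f k)) (basis_vec (int (st k))) \<in> Zn n"
      using basis_Zn[of "int (st k)" n] by (auto simp: Zn_def Rn_scale) (simp add: scale_def)
    thus ?case using insert unfolding sum.insert[OF insert.hyps(1,2)] by (intro Zn_add) auto
  qed (simp add: Zn_zero)
  thus "fst (w_tilde p q) \<in> Zn n"
    by (simp add: w_tilde_def Let_def r_def[symmetric] L_def st_def)
  show "snd (w_tilde p q) \<in> signed_perms n" using W_signed by (simp add: w_tilde_def Let_def)
qed

end

section \<open>The standard elements\<close>

text \<open>The partial sums of \<open>ceil_step\<close>, by telescoping.\<close>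

definition cei :: "nat \<Rightarrow> int \<Rightarrow> nat \<Rightarrow> int" where
  "cei b c i = \<lceil>real i * of_int c / real b\<rceil>"

lemma ceil_step_Suc: "ceil_step b c (Suc k) = cei b c (Suc k) - cei b c k"
  by (simp add: ceil_step_def cei_def)

lemma cei_0: "cei b c 0 = 0"
  by (simp add: cei_def)

lemma cei_self: "1 \<le> b \<Longrightarrow> cei b c b = c"
  by (simp add: cei_def)

lemma cei_zero: "cei b 0 i = 0"
  by (simp add: cei_def)

lemma cei_one: "1 \<le> i \<Longrightarrow> i \<le> b \<Longrightarrow> cei b 1 i = 1"
  unfolding cei_def by (rule ceiling_unique) (auto simp: field_simps)

lemma ceil_step_special:
  assumes "c = 0 \<or> c = 1" "k < b" shows "ceil_step b c (Suc k) = (if k = 0 then c else 0)"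
  using assms cei_one[of k b] cei_one[of "Suc k" b] by (cases k) (auto simp: ceil_step_Suc cei_zero cei_0)

text \<open>With \<open>d = gcd c b\<close>, the fractions \<open>k c / b + m\<close> run through the multiples of \<open>d / b\<close>, and
  \<open>ceil x - x \<le> 1 - d / b\<close> for \<open>x = i c / b\<close>.\<close>

lemma shift_exists:
  fixes a :: real and c :: int and b :: nat
  assumes b: "1 \<le> b"
  obtains k :: nat and m :: int where
    "\<And>i. 0 \<le> a + real k * (of_int c / real b) + of_int m - (of_int (cei b c i) - real i * (of_int c / real b))"
    "\<And>i. a + real k * (of_int c / real b) + of_int m - (of_int (cei b c i) - real i * (of_int c / real b)) < 1"
proof -
  define d where "d = gcd c (int b)"
  have "d \<noteq> 0" "0 \<le> d" using b by (simp_all add: d_def)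
  hence d: "1 \<le> d" by simp
  obtain e' where e': "c = d * e'" unfolding d_def by (meson dvd_def gcd_dvd1)
  obtain b' where b': "int b = d * b'" unfolding d_def by (meson dvd_def gcd_dvd2)
  have "0 < d * b'" using b unfolding b'[symmetric] by simp
  hence b'0: "0 < b'" using d by (simp add: zero_less_mult_iff)
  obtain x y where xy: "x * c + y * int b = d" unfolding d_def using bezout_int by blast
  \<comment> \<open>The least N for which a + N d / b is at least 1 - d / b; the sum is then still
    below 1.\<close>
  define N where "N = \<lceil>(1 - of_int d / real b - a) * (real b / of_int d)\<rceil>"
  define k0 where "k0 = x * N"
  \<comment> \<open>Reduction modulo b makes the exponent nonnegative; the quotient, multiplied by
    c, is absorbed by m.\<close>
  define k where "k = nat (k0 mod int b)"
  define m where "m = y * N + (k0 div int b) * c"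
  have br: "0 < real b" and dr: "0 < real_of_int d" using b d by auto
  have k: "int k = k0 mod int b" using b by (simp add: k_def)
  have "int k * c + m * int b = (k0 mod int b + (k0 div int b) * int b) * c + y * N * int b"
  proof -
    have "A * c + (y * N + D * c) * B = (A + D * B) * c + y * N * B" for A B D :: int by (simp add: algebra_simps)
    thus ?thesis unfolding k m_def .
  qed
  also have "\<dots> = k0 * c + y * N * int b" by (simp only: mod_div_mult_eq)
  also have "\<dots> = (x * c + y * int b) * N" by (simp add: k0_def algebra_simps)
  finally have kc: "int k * c + m * int b = d * N" using xy by simp
  have "real k * of_int c + of_int m * real b = of_int d * of_int N"
    using arg_cong[OF kc, of real_of_int] by simp
  hence r: "real k * (of_int c / real b) + of_int m = of_int N * (of_int d / real b)"
    using br by (simp add: field_simps)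
  have N: "(1 - of_int d / real b - a) * (real b / of_int d) \<le> of_int N"
    "of_int N < (1 - of_int d / real b - a) * (real b / of_int d) + 1"
    unfolding N_def by linarith+
  have lo: "1 - of_int d / real b \<le> a + of_int N * (of_int d / real b)"
  proof -
    have "(1 - of_int d / real b - a) * (real b / of_int d) * (of_int d / real b) \<le> of_int N * (of_int d / real b)"
      using N(1) br dr by (intro mult_right_mono) auto
    thus ?thesis using br dr by simp
  qed
  have hi: "a + of_int N * (of_int d / real b) < 1"
  proof -
    have "of_int N * (of_int d / real b) < ((1 - of_int d / real b - a) * (real b / of_int d) + 1) * (of_int d / real b)"
      using N(2) br dr by (intro mult_strict_right_mono) auto
    also have "\<dots> = 1 - a" using br dr by (simp add: field_simps)
    finally show ?thesis by simp
  qed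
  have D: "0 \<le> of_int (cei b c i) - real i * (of_int c / real b)"
    "of_int (cei b c i) - real i * (of_int c / real b) \<le> 1 - of_int d / real b" for i
  proof -
    show "0 \<le> of_int (cei b c i) - real i * (of_int c / real b)" unfolding cei_def by simp
    define C where "C = cei b c i"
    have bb: "real b = of_int d * of_int b'" using arg_cong[OF b', of real_of_int] by simp
    have b'r: "0 < real_of_int b'" using b'0 by simp
    have q: "real i * (of_int c / real b) = of_int (int i * e') / of_int b'"
      unfolding bb e' using dr b'r by (simp add: field_simps)
    have "of_int C - 1 < real i * (of_int c / real b)" unfolding C_def cei_def by simp linarith
    hence "(of_int C - 1) * of_int b' < real_of_int (int i * e')"
      unfolding q using b'r by (simp add: field_simps)
    hence "real_of_int ((C - 1) * b') < real_of_int (int i * e')" by simp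
    \<comment> \<open>A strict inequality between integers gains 1, which after division becomes 1 /
      b' = d / b.\<close>
    hence "(C - 1) * b' + 1 \<le> int i * e'" unfolding of_int_less_iff by simp
    hence "real_of_int ((C - 1) * b' + 1) \<le> of_int (int i * e')" unfolding of_int_le_iff .
    hence "real_of_int ((C - 1) * b' + 1) / of_int b' \<le> of_int (int i * e') / of_int b'"
      using b'r by (intro divide_right_mono) auto
    moreover have "real_of_int ((C - 1) * b' + 1) / of_int b' = of_int C - 1 + 1 / of_int b'"
      using b'r by (simp add: field_simps)
    ultimately have "of_int C - of_int (int i * e') / of_int b' \<le> 1 - 1 / real_of_int b'" by simp
    moreover have "of_int d / real b = 1 / real_of_int b'" unfolding bb using dr by simp
    ultimately show "of_int (cei b c i) - real i * (of_int c / real b) \<le> 1 - of_int d / real b"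
      unfolding q C_def by simp
  qed
  show ?thesis
  proof (rule that[of k m])
    fix i
    have e: "a + real k * (of_int c / real b) + of_int m = a + of_int N * (of_int d / real b)" using r by simp
    show "0 \<le> a + real k * (of_int c / real b) + of_int m - (of_int (cei b c i) - real i * (of_int c / real b))"
      unfolding e using lo D(2)[of i] by simp
    show "a + real k * (of_int c / real b) + of_int m - (of_int (cei b c i) - real i * (of_int c / real b)) < 1"
      unfolding e using hi D(1)[of i] by simp
  qed
qed

section \<open>Conjugacy with the standard element, and its centraliser block by block\<close>

context dblocks begin

lemma L_eq: "L = length p + length q"
  by (simp add: L_def r_def)

definition prv :: "nat \<Rightarrow> nat \<Rightarrow> nat" where
  "prv j t = (if t = 1 then bl j else t - 1)"

lemma prv_range: "1 \<le> t \<Longrightarrow> t \<le> bl j \<Longrightarrow> 1 \<le> prv j t \<and> prv j t \<le> bl j"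
  by (auto simp: prv_def)

lemma nxt_prv: "1 \<le> t \<Longrightarrow> t \<le> bl j \<Longrightarrow> nxt j (prv j t) = t"
  by (auto simp: nxt_def prv_def)

lemma iv_W_prv:
  assumes "j < L" "1 \<le> t" "t \<le> bl j"
  shows "iv W (int (st j + t)) = (if neg j \<and> t = bl j then - int (st j + prv j t) else int (st j + prv j t))"
  using iv_W_block[of j "prv j t"] prv_range[OF assms(2,3)] nxt_prv[OF assms(2,3)] assms(1) by simp

lemma X_block':
  assumes "j < L" "1 \<le> t" "t \<le> bl j"
  shows "fst X (int (st j + t)) = of_int (cei (bl j) (cl j) (Suc (bl j - t)) - cei (bl j) (cl j) (bl j - t))"
proof -
  have "bl j + 1 - t = Suc (bl j - t)" using assms by simp
  thus ?thesis using X_block[OF assms] by (simp add: ceil_step_Suc)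
qed

lemma X_block_neg:
  assumes "j < L" "1 \<le> t" "t \<le> bl j" "neg j"
  shows "fst X (int (st j + t)) = (if t = bl j then of_int (cl j) else 0)"
proof -
  have e: "bl j + 1 - t = Suc (bl j - t)" using assms by simp
  have "fst X (int (st j + t)) = of_int (ceil_step (bl j) (cl j) (Suc (bl j - t)))"
    using X_block[OF assms(1-3)] unfolding e .
  thus ?thesis using ceil_step_special[OF neg_special[OF assms(1,4)], of "bl j - t" "bl j"] assms by auto
qed

lemma X_zero_block:
  assumes "j < L" "1 \<le> t" "t \<le> bl j" "cl j = 0" shows "fst X (int (st j + t)) = 0"
  using X_block'[OF assms(1-3)] assms(4) by (simp add: cei_zero)

text \<open>Solves, along each positive cycle, the equation that turns the translation of
  \<open>w_tilde p q\<close> into that of \<open>w_std p q\<close>; at the last position c is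
  subtracted to absorb the entry of \<open>w_tilde p q\<close> there. On negative blocks the two
  translations agree, as c is 0 or 1.\<close>

definition zvec :: vec where
  "zvec = blockvec (\<lambda>j t. if neg j then 0 else - of_int (cei (bl j) (cl j) (if t = bl j then bl j else bl j - t)))"

lemma zvec_Zn: "zvec \<in> Zn n"
  using blockvec_Rn by (simp add: Zn_def zvec_def) (simp add: blockvec_def)

lemma std_conj: "gconj (zvec, id) (w_tilde p q) = X"
proof -
  let ?z = "(zvec, id) :: elt"
  have zG: "?z \<in> grp n" using zvec_Zn sp_id by (simp add: grp_def)
  have R: "zvec \<in> Rn n" by (rule Zn_Rn[OF zvec_Zn])
  have "zvec + fst (w_tilde p q) = fst X + act W zvec"
  proof (rule block_eqI)
    show "zvec + fst (w_tilde p q) \<in> Rn n"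
      by (intro Rn_add R Zn_Rn[OF grpD(1)[OF w_tilde_grp]])
    show "fst X + act W zvec \<in> Rn n"
      by (intro Rn_add act_Rn W_signed R Zn_Rn[OF grpD(1)[OF X_grp]])
    fix j t assume jt: "j < L" "1 \<le> t" "t \<le> bl j"
    note b = bl_pos[OF jt(1)]
    show "(zvec + fst (w_tilde p q)) (int (st j + t)) = (fst X + act W zvec) (int (st j + t))"
    proof (cases "neg j")
      case True
      have "zvec (int (st j + s)) = 0" if "1 \<le> s" "s \<le> bl j" for s
        unfolding zvec_def using blockvec_block[OF jt(1) that] True by simp
      hence "zvec (int (st j + t)) = 0" "zvec (int (st j + prv j t)) = 0"
        using jt prv_range[OF jt(2,3)] by auto
      moreover from this have "zvec (iv W (int (st j + t))) = 0"
        unfolding iv_W_prv[OF jt] using Rn_minus[OF R, of "int (st j + prv j t)"] by auto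
      ultimately have "zvec (int (st j + t)) = 0" "zvec (iv W (int (st j + t))) = 0" by blast+
      thus ?thesis using w_tilde_block[OF jt] X_block_neg[OF jt True] by (simp add: act_def)
    next
      case False
      have z: "zvec (int (st j + s)) = - of_int (cei (bl j) (cl j) (if s = bl j then bl j else bl j - s))"
        if "1 \<le> s" "s \<le> bl j" for s
        unfolding zvec_def using blockvec_block[OF jt(1) that] False by simp
      have v: "iv W (int (st j + t)) = int (st j + prv j t)" using iv_W_prv[OF jt] False by simp
      have pr: "(if prv j t = bl j then bl j else bl j - prv j t) = (if t = 1 then bl j else Suc (bl j - t))"
        using jt by (auto simp: prv_def)
      have zt: "zvec (int (st j + prv j t)) = - of_int (cei (bl j) (cl j) (if t = 1 then bl j else Suc (bl j - t)))"
        using z[of "prv j t"] prv_range[OF jt(2,3)] unfolding pr by simp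
      have s1: "t = 1 \<Longrightarrow> Suc (bl j - t) = bl j" using jt by simp
      have "zvec (int (st j + t)) + (if t = bl j then of_int (cl j) else 0) =
          fst X (int (st j + t)) + zvec (int (st j + prv j t))"
        using X_block'[OF jt] z[OF jt(2,3)] zt s1 cei_self[OF b] by (auto simp: cei_0)
      thus ?thesis using w_tilde_block[OF jt] v by (simp add: act_def)
    qed
  qed
  moreover have "snd (w_tilde p q) = W" by (simp add: w_tilde_def Let_def)
  ultimately have "gmul ?z (w_tilde p q) = gmul X ?z" by (simp add: gmul_def act_id snd_X)
  hence "gconj ?z (w_tilde p q) = gmul X (gmul ?z (ginv ?z))"
    unfolding gconj_def using gmul_assoc[OF grp_bij[OF X_grp] grp_bij[OF zG]] by simp
  thus ?thesis using ginv_right[OF grp_bij[OF zG]] by (simp add: gmul_id)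
qed

lemma blk_W: "i \<in> idx n \<Longrightarrow> blk (W i) = blk i"
proof -
  have pos: "blk (W i) = blk i" if i: "i \<in> {1..int n}" for i
  proof -
    obtain j t where jt: "j < L" "1 \<le> t" "t \<le> bl j" "i = int (st j + t)" using blk_exists[OF i] .
    have "1 \<le> nxt j t" "nxt j t \<le> bl j" using jt by (auto simp: nxt_def)
    moreover have "\<bar>W i\<bar> = int (st j + nxt j t)" using W_block[OF jt(1-3)] jt(4) by auto
    ultimately have "blk (W i) = j" using blk_eq[OF jt(1)] by blast
    moreover have "blk i = j" using blk_eq[OF jt(1-3)] jt(4) by simp
    ultimately show ?thesis by simp
  qed
  assume "i \<in> idx n"
  thus ?thesis
  proof (cases rule: idx_cases)
    case 2
    from pos[OF 2] show ?thesis using blk_minus[of i] blk_minus[of "W i"] by (simp add: sp_minus[OF W_signed])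
  qed (rule pos)
qed

text \<open>A negative cycle joins a position to its negative, so an odd invariant function must
  vanish on it; on a positive cycle any constant will do.\<close>

lemma blockvec_W:
  assumes "\<And>j t. j < L \<Longrightarrow> neg j \<Longrightarrow> F j = 0"
  shows "blockvec (\<lambda>j t. F j) (W i) = blockvec (\<lambda>j t. F j) i"
proof -
  let ?f = "blockvec (\<lambda>j t. F j)"
  have m: "?f (- i) = - ?f i" for i by (rule Rn_minus[OF blockvec_Rn])
  have pos: "?f (W i) = ?f i" if i: "i \<in> {1..int n}" for i
  proof -
    obtain j t where jt: "j < L" "1 \<le> t" "t \<le> bl j" "i = int (st j + t)" using blk_exists[OF i] .
    have nr: "1 \<le> nxt j t" "nxt j t \<le> bl j" using jt by (auto simp: nxt_def)
    show ?thesis unfolding jt(4) W_block[OF jt(1-3)]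
      using blockvec_block[OF jt(1-3), of "\<lambda>j t. F j"] blockvec_block[OF jt(1) nr, of "\<lambda>j t. F j"]
        blockvec_block[of j "bl j" "\<lambda>j t. F j"] bl_pos[OF jt(1)] jt(1) assms m[of "int (st j + bl j)"] by auto
  qed
  show ?thesis
  proof (cases "i \<in> idx n")
    case True
    thus ?thesis
    proof (cases rule: idx_cases)
      case 2
      from pos[OF 2] show ?thesis using m[of i] m[of "W i"] by (simp add: sp_minus[OF W_signed])
    qed (rule pos)
  qed (simp add: sp_outside[OF W_signed])
qed

text \<open>Glues powers k, signs e and integral shifts m, chosen block by block, into one
  centralising element. A shift has to vanish on negative blocks to be invariant, and a sign
  requires a block without translation. \<open>Q\<close> will express membership in the box, one
  coordinate at a time.\<close>

lemma block_centraliser: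
  assumes U: "U \<in> Rn n"
    and ex: "\<And>j. j < L \<Longrightarrow> \<exists>k e m. (e = 1 \<or> e = - 1) \<and> (e = - 1 \<longrightarrow> cl j = 0 \<and> T \<noteq> Type_A) \<and> (neg j \<longrightarrow> m = 0) \<and>
      (\<forall>t. 1 \<le> t \<and> t \<le> bl j \<longrightarrow> Q (of_int m + of_int e * (aff X ^^ k) U (int (st j + t))))"
    and A: "T = Type_A \<Longrightarrow> q = []"
  obtains g where "inG T n g" "gconj g X = X" "\<And>i. i \<in> {1..int n} \<Longrightarrow> Q (aff g U i)"
proof -
  obtain kk :: "nat \<Rightarrow> nat" and ee mm :: "nat \<Rightarrow> int" where
    R: "\<And>j. j < L \<Longrightarrow> (ee j = 1 \<or> ee j = - 1) \<and> (ee j = - 1 \<longrightarrow> cl j = 0 \<and> T \<noteq> Type_A) \<and> (neg j \<longrightarrow> mm j = 0) \<and>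
      (\<forall>t. 1 \<le> t \<and> t \<le> bl j \<longrightarrow> Q (of_int (mm j) + of_int (ee j) * (aff X ^^ kk j) U (int (st j + t))))"
    using ex by metis
  define k where "k i = (if i \<in> idx n then kk (blk i) else 0)" for i
  define e where "e i = (if i \<in> idx n then ee (blk i) else 1)" for i
  define m where "m = blockvec (\<lambda>j t. of_int (mm j))"
  have bi: "blk i < L" if "i \<in> idx n" for i
  proof -
    have "blk i < L" if i: "i \<in> {1..int n}" for i
      using blk_exists[OF i] blk_eq by (metis abs_of_nat)
    from this[of i] this[of "- i"] show ?thesis using that by (auto simp: blk_minus elim!: idx_cases)
  qed
  have mZ: "m \<in> Zn n" using blockvec_Rn by (simp add: Zn_def m_def) (simp add: blockvec_def)
  have fX: "fst X i = 0" if ei: "e i = - 1" for i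
  proof -
    have pos: "fst X i = 0" if i: "i \<in> {1..int n}" and "e i = - 1" for i
    proof -
      obtain j t where jt: "j < L" "1 \<le> t" "t \<le> bl j" "i = int (st j + t)" using blk_exists[OF i] .
      have "i \<in> idx n" using i by (auto intro: idxI)
      hence "ee j = - 1" using that(2) blk_eq[OF jt(1-3)] jt(4) by (simp add: e_def)
      thus ?thesis using X_zero_block[OF jt(1-3)] R[OF jt(1)] jt(4) by simp
    qed
    have "i \<in> idx n" by (rule ccontr) (use ei in \<open>simp add: e_def\<close>)
    thus ?thesis
    proof (cases rule: idx_cases)
      case 1 thus ?thesis using pos ei by blast
    next
      case 2
      have "e (- i) = e i" by (simp add: e_def blk_minus)
      hence "e (- i) = - 1" using ei by simp
      thus ?thesis using pos[OF 2] Rn_minus[OF Zn_Rn[OF grpD(1)[OF X_grp]], of i] by simp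
    qed
  qed
  obtain g where g: "g \<in> grp n" "gconj g X = X"
    "\<And>V i. V \<in> Rn n \<Longrightarrow> aff g V i = m i + of_int (e i) * (aff X ^^ k i) V i"
    "\<And>i. iv (snd g) i = e i * (iv (snd X) ^^ k i) i"
  proof (rule centraliser[OF X_grp mZ, of k e])
    fix i
    show "k (- i) = k i" "e (- i) = e i" by (simp_all add: k_def e_def blk_minus)
    show "k (snd X i) = k i" "e (snd X i) = e i"
      using blk_W[of i] sp_idx[OF W_signed, of i] by (auto simp: k_def e_def snd_X)
    show "e i = 1 \<or> e i = - 1" using R[OF bi[of i]] by (auto simp: e_def)
    show "i \<notin> idx n \<Longrightarrow> e i = 1" by (simp add: e_def)
    show "m (snd X i) = m i" unfolding m_def snd_X using R by (intro blockvec_W) auto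
    show "e i = - 1 \<Longrightarrow> fst X i = 0" by (rule fX)
  qed auto
  show ?thesis
  proof (rule that[OF _ g(2)])
    show "Q (aff g U i)" if i: "i \<in> {1..int n}" for i
    proof -
      obtain j t where jt: "j < L" "1 \<le> t" "t \<le> bl j" "i = int (st j + t)" using blk_exists[OF i] .
      have "i \<in> idx n" using i by (auto intro: idxI)
      hence "k i = kk j" "e i = ee j" using blk_eq[OF jt(1-3)] jt(4) by (simp_all add: k_def e_def)
      moreover have "m i = of_int (mm j)" unfolding m_def jt(4) by (rule blockvec_block[OF jt(1-3)])
      ultimately show ?thesis using g(3)[OF U, of i] R[OF jt(1)] jt by simp
    qed
    show "inG T n g"
    proof (cases "T = Type_A")
      case True
      have nn: "\<not> neg j" if "j < L" for j using that A[OF True] unfolding L_eq by (simp add: neg_def)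
      have vp: "(iv W ^^ l) i \<in> {1..int n}" if "i \<in> {1..int n}" for l i
      proof (induction l)
        case (Suc l)
        obtain j t where jt: "j < L" "1 \<le> t" "t \<le> bl j" "(iv W ^^ l) i = int (st j + t)" using blk_exists[OF Suc] .
        \<comment> \<open>Without negative blocks the powers of \<open>iv W\<close> preserve
          positivity, which puts the linear part of \<open>g\<close> into
          \<open>sym_perms n\<close>.\<close>
        have "iv W ((iv W ^^ l) i) = int (st j + prv j t)" unfolding jt(4) using iv_W_prv[OF jt(1-3)] nn[OF jt(1)] by simp
        thus ?case using st_in[OF jt(1)] prv_range[OF jt(2,3)] by simp
      qed (use that in simp)
      have "iv (snd g) i > 0" if i: "i \<in> {1..int n}" for i
      proof -
        have "i \<in> idx n" using i by (auto intro: idxI)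
        hence "e i = 1" using R[OF bi[of i]] True by (auto simp: e_def)
        thus ?thesis using g(4)[of i] vp[OF i, of "k i"] by (simp add: snd_X)
      qed
      hence "iv (snd g) \<in> sym_perms n" using sp_iv[OF grpD(2)[OF g(1)]] by (simp add: sym_perms_def)
      hence "snd g \<in> sym_perms n" using sym_perms_iv[of "iv (snd g)" n] sp_iv_iv[OF grpD(2)[OF g(1)]] by simp
      thus ?thesis using g(1) grpD(1)[OF g(1)] by (simp add: inG_def grpA_def mem_Times_iff)
    qed (use g in \<open>simp add: inG_def\<close>)
  qed
qed

lemma X_inG: "(T = Type_A \<Longrightarrow> q = []) \<Longrightarrow> inG T n X"
proof -
  assume A: "T = Type_A \<Longrightarrow> q = []"
  have "W i > 0" if T: "T = Type_A" and i: "i \<in> {1..int n}" for i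
  proof -
    obtain j t where jt: "j < L" "1 \<le> t" "t \<le> bl j" "i = int (st j + t)" using blk_exists[OF i] .
    have "\<not> neg j" using jt(1) A[OF T] unfolding L_eq by (simp add: neg_def)
    thus ?thesis using W_block[OF jt(1-3)] jt by (simp add: nxt_def)
  qed
  hence "T = Type_A \<Longrightarrow> W \<in> sym_perms n" using W_signed by (simp add: sym_perms_def)
  thus ?thesis using X_grp grpD(1)[OF X_grp] by (auto simp: inG_def grpA_def mem_Times_iff snd_X)
qed

end

section \<open>Translation points of the standard elements\<close>

lemma funpow_left_comm: "(f ^^ k) ((f ^^ l) a) = (f ^^ l) ((f ^^ k) a)"
proof -
  have "(f ^^ k) ((f ^^ l) a) = (f ^^ (k + l)) a" by (simp only: funpow_add o_apply)
  also have "\<dots> = (f ^^ (l + k)) a" by (simp only: add.commute)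
  finally show ?thesis by (simp only: funpow_add o_apply)
qed

context flat0 begin

lemma aff_pow_u: "(aff x0 ^^ k) u i = u i + real k * nu i"
proof (induction k arbitrary: i)
  case (Suc k)
  have "(aff x0 ^^ Suc k) u i = fst x0 i + (aff x0 ^^ k) u (v i)" by (simp add: aff_apply)
  also have "\<dots> = aff x0 u i + real k * nu i" by (simp add: Suc.IH nu_v aff_apply[of x0 u])
  finally show ?case by (simp add: aff_x0 algebra_simps)
qed simp

end

locale std0 = dblocks n p q + flat0 n T w0 "w_std p q" u
  for n p q T w0 u
begin

lemma u_rec: "u i + nu i = fst X i + u (iv W i)"
  using aff_x0[of i] by (simp add: aff_apply snd_X)

lemma nu_iv: "nu (iv W i) = nu i"
  using nu_v[of i] by (simp add: snd_X)

text \<open>The slope is constant along the cycle, and a full turn adds the ceiling steps up to c,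
  so b times the slope is c. On the way the coordinates deviate from their last one by i c / b minus
  its ceiling.\<close>

lemma pos_block:
  assumes j: "j < L" "\<not> neg j" and t: "1 \<le> t" "t \<le> bl j"
  shows "nu (int (st j + t)) = of_int (cl j) / real (bl j)"
    and "u (int (st j + t)) = u (int (st j + bl j)) -
       (of_int (cei (bl j) (cl j) (bl j - t)) - real (bl j - t) * (of_int (cl j) / real (bl j)))"
proof -
  define b where "b = bl j"
  \<comment> \<open>Counted backwards from the last position, since \<open>iv W\<close> lowers
    positions.\<close>
  define P where "P i = u (int (st j + (b - i)))" for i
  define N where "N i = nu (int (st j + (b - i)))" for i
  define s where "s = N 0"
  have b: "1 \<le> b" unfolding b_def by (rule bl_pos[OF j(1)])
  have v: "iv W (int (st j + (b - i))) = int (st j + (b - Suc i))" if "Suc i < b" for i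
    using iv_W_prv[of j "b - i"] j that by (auto simp: b_def prv_def)
  have v1: "iv W (int (st j + (b - (b - 1)))) = int (st j + b)"
    using iv_W_prv[of j 1] j b by (simp add: b_def prv_def)
  have N: "N i = s" if "i < b" for i
    using that
  proof (induction i)
    case (Suc i)
    thus ?case using nu_iv[of "int (st j + (b - i))"] v[of i] by (simp add: N_def)
  qed (simp add: s_def)
  have X: "fst X (int (st j + (b - i))) = of_int (cei b (cl j) (Suc i) - cei b (cl j) i)" if "i < b" for i
  proof -
    have "b - (b - i) = i" using that by simp
    thus ?thesis using X_block'[of j "b - i"] j that by (simp add: b_def)
  qed
  have P: "P i = P 0 + real i * s - of_int (cei b (cl j) i)" if "i < b" for i
    using that
  proof (induction i)
    case (Suc i)
    have "P i + N i = of_int (cei b (cl j) (Suc i) - cei b (cl j) i) + P (Suc i)"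
      using u_rec[of "int (st j + (b - i))"] v[OF Suc.prems] X[of i] Suc.prems by (simp add: P_def N_def)
    thus ?case using Suc N[of i] by (simp add: algebra_simps)
  qed (simp add: cei_0)
  have "P (b - 1) + N (b - 1) = of_int (cei b (cl j) (Suc (b - 1)) - cei b (cl j) (b - 1)) + P 0"
    using u_rec[of "int (st j + (b - (b - 1)))"] v1 X[of "b - 1"] b by (simp add: P_def N_def)
  hence "real (b - 1) * s + s = of_int (cei b (cl j) b)"
    using P[of "b - 1"] N[of "b - 1"] b by simp
  hence "real b * s = of_int (cl j)" using cei_self[OF b] b by (simp add: of_nat_diff algebra_simps)
  hence s: "s = of_int (cl j) / real b" using b by (simp add: field_simps)
  have bt: "b - t < b" "b - (b - t) = t" using t by (auto simp: b_def)
  show "nu (int (st j + t)) = of_int (cl j) / real (bl j)"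
    using N[OF bt(1)] s unfolding N_def bt(2) by (simp add: b_def)
  show "u (int (st j + t)) = u (int (st j + bl j)) -
       (of_int (cei (bl j) (cl j) (bl j - t)) - real (bl j - t) * (of_int (cl j) / real (bl j)))"
    using P[OF bt(1)] unfolding s P_def bt(2) by (simp add: b_def)
qed

lemma cyclic_const:
  assumes "\<And>t. 1 \<le> t \<Longrightarrow> t < bl j \<Longrightarrow> f t = f (prv j t)" "1 \<le> t" "t \<le> bl j"
  shows "f t = (f (bl j) :: real)"
proof -
  have "f t = f (bl j)" if "1 \<le> t" "t < bl j" for t
    using that
  proof (induction t rule: dec_induct)
    case base
    thus ?case using assms(1)[of 1] by (simp add: prv_def)
  next
    case (step t)
    thus ?case using assms(1)[of "Suc t"] by (simp add: prv_def)
  qed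
  thus ?thesis using assms(2,3) by (cases "t = bl j") auto
qed

text \<open>One turn around a negative cycle changes \<open>nu\<close> into its negative and the
  value t of \<open>u\<close> into c - t.\<close>

lemma neg_block:
  assumes j: "j < L" "neg j" and t: "1 \<le> t" "t \<le> bl j"
  shows "nu (int (st j + t)) = 0" and "u (int (st j + t)) = of_int (cl j) / 2"
proof -
  note b = bl_pos[OF j(1)]
  let ?N = "\<lambda>t. nu (int (st j + t))" and ?P = "\<lambda>t. u (int (st j + t))"
  have v: "iv W (int (st j + s)) = int (st j + prv j s)" if "1 \<le> s" "s < bl j" for s
    using iv_W_prv[of j s] j that by simp
  have vb: "iv W (int (st j + bl j)) = - int (st j + prv j (bl j))"
    using iv_W_prv[of j "bl j"] j b by simp
  have pb: "1 \<le> prv j (bl j)" "prv j (bl j) \<le> bl j" using prv_range[OF b] by auto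
  have Nc: "?N s = ?N (bl j)" if "1 \<le> s" "s \<le> bl j" for s
  proof (rule cyclic_const[where f = ?N])
    show "?N s = ?N (prv j s)" if "1 \<le> s" "s < bl j" for s
      using nu_iv[of "int (st j + s)"] v[OF that] by simp
  qed (use that in auto)
  have "?N (bl j) = - ?N (prv j (bl j))"
    using nu_iv[of "int (st j + bl j)"] Rn_minus[OF nu_Rn, of "int (st j + prv j (bl j))"] unfolding vb by simp
  hence N0: "?N (bl j) = 0" using Nc[OF pb] by simp
  show "nu (int (st j + t)) = 0" using Nc[OF t] N0 by simp
  have Pc: "?P s = ?P (bl j)" if "1 \<le> s" "s \<le> bl j" for s
  proof (rule cyclic_const[where f = ?P])
    show "?P s = ?P (prv j s)" if "1 \<le> s" "s < bl j" for s
      using u_rec[of "int (st j + s)"] v[OF that] Nc[of s] N0 X_block_neg[OF j(1) that(1) _ j(2)] that by simp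
  qed (use that in auto)
  have "?P (bl j) = of_int (cl j) - ?P (prv j (bl j))"
    using u_rec[of "int (st j + bl j)"] N0 X_block_neg[OF j(1) b _ j(2)] Rn_minus[OF u, of "int (st j + prv j (bl j))"]
    unfolding vb by simp
  hence "?P (bl j) = of_int (cl j) / 2" using Pc[OF pb] by simp
  thus "u (int (st j + t)) = of_int (cl j) / 2" using Pc[OF t] by simp
qed

lemma pos_block_shift:
  assumes j: "j < L" "\<not> neg j"
  obtains k :: nat and m :: int where
    "\<And>t. 1 \<le> t \<Longrightarrow> t \<le> bl j \<Longrightarrow>
       0 \<le> of_int m + (aff X ^^ k) u (int (st j + t)) \<and> of_int m + (aff X ^^ k) u (int (st j + t)) < 1"
proof -
  define a where "a = u (int (st j + bl j))"
  obtain k m where km: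
    "\<And>i. 0 \<le> a + real k * (of_int (cl j) / real (bl j)) + of_int m -
       (of_int (cei (bl j) (cl j) i) - real i * (of_int (cl j) / real (bl j)))"
    "\<And>i. a + real k * (of_int (cl j) / real (bl j)) + of_int m -
       (of_int (cei (bl j) (cl j) i) - real i * (of_int (cl j) / real (bl j))) < 1"
    using shift_exists[OF bl_pos[OF j(1)]] by metis
  show ?thesis
  proof (rule that[of m k])
    fix t assume t: "1 \<le> t" "t \<le> bl j"
    show "0 \<le> of_int m + (aff X ^^ k) u (int (st j + t)) \<and> of_int m + (aff X ^^ k) u (int (st j + t)) < 1"
      using km(1)[of "bl j - t"] km(2)[of "bl j - t"]
      unfolding aff_pow_u pos_block(1)[OF j t] pos_block(2)[OF j t] a_def[symmetric]
      by (simp only: ac_simps) (simp add: algebra_simps)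
  qed
qed

lemma reach_orbit_A:
  assumes T: "T = Type_A" and q: "q = []" and y: "y \<in> reachset T n w0 X"
    and K: "aff y u \<in> alc (roof T) n" "aff y u 1 < 1"
  shows "gconj y X \<in> Sn_orbit T n X"
proof -
  have nn: "\<not> neg j" if "j < L" for j using that q unfolding L_eq by (simp add: neg_def)
  obtain g where g: "inG T n g" "gconj g X = X" "\<And>i. i \<in> {1..int n} \<Longrightarrow> 0 \<le> aff g u i \<and> aff g u i < 1"
  proof (rule block_centraliser[OF u, of T "\<lambda>r. 0 \<le> r \<and> r < 1"])
    fix j assume j: "j < L"
    obtain k m where "\<And>t. 1 \<le> t \<Longrightarrow> t \<le> bl j \<Longrightarrow>
       0 \<le> of_int m + (aff X ^^ k) u (int (st j + t)) \<and> of_int m + (aff X ^^ k) u (int (st j + t)) < 1"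
      using pos_block_shift[OF j nn[OF j]] by metis
    thus "\<exists>k e m. (e = 1 \<or> e = - 1) \<and> (e = - 1 \<longrightarrow> cl j = 0 \<and> T \<noteq> Type_A) \<and> (neg j \<longrightarrow> m = 0) \<and>
      (\<forall>t. 1 \<le> t \<and> t \<le> bl j \<longrightarrow> 0 \<le> of_int m + of_int e * (aff X ^^ k) u (int (st j + t)) \<and>
         of_int m + of_int e * (aff X ^^ k) u (int (st j + t)) < 1)"
      using nn[OF j] by (intro exI[of _ k] exI[of _ 1] exI[of _ m]) auto
  qed (use q in auto)
  show ?thesis
    by (rule orbitI[OF reachset_inG[OF y] x0 g(1,2) u]) (use g(3) T K in \<open>auto simp: roof_def\<close>)
qed

end

section \<open>Types other than A: bringing every cycle into the box\<close>

locale std = dblocks n p q + flat n T w0 "w_std p q" u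
  for n p q T w0 u
begin

sublocale std0 ..

lemma vW: "iv (snd X) = iv W"
  by (simp add: snd_X)

lemma vpow_pos_block:
  assumes j: "j < L" "\<not> neg j"
  shows "i < bl j \<Longrightarrow> (iv W ^^ i) (int (st j + bl j)) = int (st j + (bl j - i))"
    and "(iv W ^^ bl j) (int (st j + bl j)) = int (st j + bl j)"
proof -
  show *: "(iv W ^^ i) (int (st j + bl j)) = int (st j + (bl j - i))" if "i < bl j" for i
    using that
  proof (induction i)
    case (Suc i)
    thus ?case using iv_W_prv[of j "bl j - i"] j by (auto simp: prv_def)
  qed simp
  have "iv W ((iv W ^^ (bl j - 1)) (int (st j + bl j))) = int (st j + bl j)"
    using *[of "bl j - 1"] iv_W_prv[of j 1] j bl_pos[OF j(1)] by (simp add: prv_def)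
  hence "(iv W ^^ Suc (bl j - 1)) (int (st j + bl j)) = int (st j + bl j)"
    by (simp only: funpow.simps o_apply)
  thus "(iv W ^^ bl j) (int (st j + bl j)) = int (st j + bl j)" using bl_pos[OF j(1)] by simp
qed

lemma vpow_neg_block:
  assumes j: "j < L" "neg j" and i: "1 \<le> i" "i \<le> bl j"
  shows "(iv W ^^ i) (int (st j + bl j)) = - int (st j + (if i = bl j then bl j else bl j - i))"
  using i
proof (induction i rule: dec_induct)
  case base
  thus ?case using iv_W_prv[of j "bl j"] j by (auto simp: prv_def)
next
  case (step i)
  have "(iv W ^^ Suc i) (int (st j + bl j)) = iv W (- int (st j + (bl j - i)))"
    using step by simp
  also have "\<dots> = - iv W (int (st j + (bl j - i)))" by (rule sp_minus[OF sp_iv[OF W_signed]])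
  also have "\<dots> = - int (st j + (if Suc i = bl j then bl j else bl j - Suc i))"
    using iv_W_prv[of j "bl j - i"] j step by (auto simp: prv_def)
  finally show ?case .
qed

text \<open>The contraction commutes with powers of the standard element on coordinates of positive
  slope, so the powers and shifts found for \<open>u\<close> serve the contracted point as
  well.\<close>

lemma q_pos:
  assumes z: "good z" and i: "0 < nu i"
  shows "(aff X ^^ k) (u1 + z) i = squash 1 ((aff X ^^ k) u i)"
proof -
  have nk: "nu ((iv (snd X) ^^ k) i) = nu i"
    by (rule invariant_funpow(3)[OF w]) (rule nu_w)
  hence "(iv (snd X) ^^ k) i \<notin> Z0" using i by (simp add: Z0_def)
  hence "(u1 + z) ((iv (snd X) ^^ k) i) = squash 1 (u ((iv (snd X) ^^ k) i))"
    using goodD(2)[OF z] nk i by (simp add: u1_eq ssquash_def)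
  thus ?thesis
    using squash_add[OF Zn_int[OF orbit0_Zn[OF x0_grp, of k]], of 1 "u ((iv (snd X) ^^ k) i)" i]
    by (simp add: aff_funpow add.commute)
qed

lemma q_zero:
  assumes "nu i = 0"
  shows "(aff X ^^ k) (u1 + z) i = u i + z ((iv W ^^ k) i)"
proof -
  have nk: "nu ((iv (snd X) ^^ k) i) = nu i"
    by (rule invariant_funpow(3)[OF w]) (rule nu_w)
  have "(aff X ^^ k) (u1 + z) i = (aff X ^^ k) u i + z ((iv W ^^ k) i)"
    using nk assms unfolding aff_funpow by (simp add: u1_eq ssquash_def snd_X)
  thus ?thesis using assms by (simp add: aff_pow_u)
qed

text \<open>A positive cycle returns without a sign, so alignment makes z constant on it when it
  lies in \<open>Z0\<close>. The constant is nonzero and small, which moves the value off the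
  multiples of 1/2; outside \<open>Z0\<close> the value of \<open>u\<close> already avoids
  them.\<close>

lemma zero_block_const:
  assumes z: "good z" "aligned z Z0" and j: "j < L" "\<not> neg j" "cl j = 0"
  obtains a where "2 * a \<notin> \<int>" "\<And>t. 1 \<le> t \<Longrightarrow> t \<le> bl j \<Longrightarrow> (u1 + z) (int (st j + t)) = a"
proof -
  note b = bl_pos[OF j(1)]
  define h where "h = int (st j + bl j)"
  have nu0: "nu (int (st j + t)) = 0" and ut: "u (int (st j + t)) = u h" if "1 \<le> t" "t \<le> bl j" for t
    using pos_block[OF j(1,2) that] j(3) by (simp_all add: cei_zero h_def)
  have hi: "h \<in> idx n" unfolding h_def using st_in[OF j(1) b] by (intro idxI) auto
  have nh: "nu h = 0" using nu0[OF b] by (simp add: h_def)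
  have orb: "int (st j + t) = (iv W ^^ (bl j - t)) h" if "1 \<le> t" "t \<le> bl j" for t
    using vpow_pos_block(1)[OF j(1,2), of "bl j - t"] that by (simp add: h_def)
  have val: "(u1 + z) (int (st j + t)) = u h + z ((iv W ^^ (bl j - t)) h)" if "1 \<le> t" "t \<le> bl j" for t
    using q_zero[OF nu0[OF that], of 0 z] ut[OF that] orb[OF that] by simp
  show ?thesis
  proof (cases "h \<in> Z0")
    case False
    have "2 * u h \<notin> \<int>" using False hi nh by (simp add: Z0_def)
    moreover have "z ((iv W ^^ k) h) = 0" for k
    proof -
      have "(iv W ^^ k) h \<notin> Z0"
        using invariant_funpow(3)[OF w, of "\<lambda>i. i \<in> Z0" k h] Z0_w False by (simp add: snd_X)
      thus ?thesis by (rule goodD(2)[OF z(1)])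
    qed
    ultimately show ?thesis using that[of "u h"] val by simp
  next
    case True
    obtain i c l where i: "cyc z i c" "l < c" "h = (iv W ^^ l) i \<or> h = - (iv W ^^ l) i"
      using z(2) True unfolding aligned_def vW by blast
    have pm: "(iv W ^^ k) (- a) = - (iv W ^^ k) a" for k a using vpow_minus[of k a] by (simp add: vW)
    have comm: "(iv W ^^ k) ((iv W ^^ k') a) = (iv W ^^ k') ((iv W ^^ k) a)" for k k' a
      by (rule funpow_left_comm)
    have c: "1 \<le> c" "(iv W ^^ c) i = i \<or> (iv W ^^ c) i = - i" "0 < z i" "\<And>k. k < c \<Longrightarrow> z ((iv W ^^ k) i) = z i"
      using i(1) by (auto simp: cyc_def vW)
    \<comment> \<open>A return with a sign would carry over to the last position of the block,
      whereas on a positive block all powers of \<open>iv W\<close> stay positive.\<close>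
    have "(iv W ^^ c) i = i"
    proof (rule ccontr)
      assume "(iv W ^^ c) i \<noteq> i"
      hence "(iv W ^^ c) i = - i" using c(2) by simp
      hence "(iv W ^^ c) h = - h" using i(3) comm[of c l i] pm by auto
      moreover have pos: "0 < (iv W ^^ k) h" for k
      proof -
        have "(iv W ^^ k) h = (iv W ^^ (k mod bl j)) h"
          using funpow_mod_eq[of "bl j" "iv W" h k] vpow_pos_block(2)[OF j(1,2)] by (simp add: h_def)
        moreover have "k mod bl j < bl j" using b by simp
        ultimately show ?thesis using vpow_pos_block(1)[OF j(1,2), of "k mod bl j"] by (simp add: h_def)
      qed
      ultimately show False using pos[of c] pos[of 0] by simp
    qed
    hence zi: "z ((iv W ^^ k) i) = z i" for k
      using funpow_mod_eq[of c "iv W" i k] c(4)[of "k mod c"] c(1) by simp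
    have zm: "z (- a) = - z a" for a by (rule goodD(4)[OF z(1)])
    have zh: "z ((iv W ^^ k) h) = z h" for k
      using i(3) zi[of l] zi[of "k + l"] pm[of k "(iv W ^^ l) i"] zm by (auto simp: funpow_add)
    have z0: "z h \<noteq> 0" using i(3) zi[of l] zm c(3) by auto
    have z8: "\<bar>z h\<bar> < 1/8" using goodD(3)[OF z(1), of h] gap(2) by simp
    have "2 * z h \<notin> \<int>"
    proof
      assume "2 * z h \<in> \<int>"
      then obtain m where m: "2 * z h = of_int m" by (auto elim: Ints_cases)
      have "\<bar>2 * z h\<bar> < of_int 1" using z8 by simp
      hence "\<bar>m\<bar> < 1" unfolding m of_int_abs[symmetric] of_int_less_iff .
      thus False using m z0 by simp
    qed
    moreover have "2 * u h \<in> \<int>" using True by (simp add: Z0_def)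
    ultimately have "2 * (u h + z h) \<notin> \<int>" unfolding distrib_left by (metis Ints_diff add_diff_cancel_left')
    thus ?thesis using that[of "u h + z h"] val zh by simp
  qed
qed

text \<open>Alignment leaves a single change of sign on the block's cycle up to sign. Some power of
  the cycle moves it to the end of the block, and a further power with exponent \<open>bl j\<close>
  negates all values if the other sign is wanted.\<close>

lemma neg_block_align:
  assumes z: "good z" "aligned z Z0" and j: "j < L" "neg j" and s: "s = 1 \<or> s = (- 1 :: int)"
  obtains k where "\<And>t. 1 \<le> t \<Longrightarrow> t \<le> bl j \<Longrightarrow> 0 < of_int s * z ((iv W ^^ k) (int (st j + t)))"
proof -
  note b = bl_pos[OF j(1)]
  define b' where "b' = bl j"
  define h where "h = int (st j + bl j)"
  \<comment> \<open>From here the powers of \<open>iv W\<close> with exponents below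
    \<open>bl j\<close> run through the block without meeting a sign.\<close>
  define e where "e = - iv W h"
  have pm: "(iv W ^^ k) (- a) = - (iv W ^^ k) a" for k a using vpow_minus[of k a] by (simp add: vW)
  have comm: "(iv W ^^ k) ((iv W ^^ k') a) = (iv W ^^ k') ((iv W ^^ k) a)" for k k' a
    by (rule funpow_left_comm)
  have zm: "z (- a) = - z a" for a by (rule goodD(4)[OF z(1)])
  have inj: "(iv W ^^ k) a = (iv W ^^ k) a' \<Longrightarrow> a = a'" for k a a' using vpow_inj[of k a a'] by (simp add: vW)
  have vh: "(iv W ^^ bl j) h = - h" using vpow_neg_block[OF j b order_refl] by (simp add: h_def)
  have "2 * u h = of_int (cl j)" using neg_block(2)[OF j b order_refl] by (simp add: h_def)
  hence "2 * u h \<in> \<int>" by (metis Ints_of_int)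
  hence hZ: "h \<in> Z0"
    using neg_block(1)[OF j b order_refl] st_in[OF j(1) b order_refl] by (auto simp: Z0_def h_def intro: idxI)
  hence eZ: "e \<in> Z0" unfolding e_def using Z0_v[of h] Z0_minus by (simp add: vW)
  have ve: "(iv W ^^ k) e = - (iv W ^^ Suc k) h" for k by (simp add: e_def pm funpow_swap1)
  obtain i c l where i: "cyc z i c" "l < c" "e = (iv W ^^ l) i \<or> e = - (iv W ^^ l) i"
    using z(2) eZ unfolding aligned_def vW by blast
  have c: "1 \<le> c" "(iv W ^^ c) i = i \<or> (iv W ^^ c) i = - i" "0 < z i" "\<And>k. k < c \<Longrightarrow> z ((iv W ^^ k) i) = z i"
    using i(1) by (auto simp: cyc_def vW)
  have retneg: "(iv W ^^ k) i = - i \<longleftrightarrow> (iv W ^^ k) h = - h" for k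
  proof -
    have "(iv W ^^ k) i = - i \<longleftrightarrow> (iv W ^^ l) ((iv W ^^ k) i) = (iv W ^^ l) (- i)"
      by (auto dest: inj)
    also have "\<dots> \<longleftrightarrow> (iv W ^^ k) ((iv W ^^ l) i) = - (iv W ^^ l) i" by (simp only: comm[of l k i] pm)
    also have "\<dots> \<longleftrightarrow> (iv W ^^ k) e = - e" using i(3) pm by auto
    also have "\<dots> \<longleftrightarrow> (iv W ^^ 1) ((iv W ^^ k) h) = (iv W ^^ 1) (- h)"
      unfolding ve by (simp add: e_def sp_minus[OF sp_iv[OF W_signed]]) linarith
    also have "\<dots> \<longleftrightarrow> (iv W ^^ k) h = - h" by (auto dest: inj simp del: funpow.simps)
    finally show ?thesis .
  qed
  have vi: "(iv W ^^ bl j) i = - i" using retneg vh by blast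
  have "(iv W ^^ c) i \<noteq> i"
  proof
    assume "(iv W ^^ c) i = i"
    hence "z ((iv W ^^ bl j) i) = z i"
      using funpow_mod_eq[of c "iv W" i "bl j"] c(4)[of "bl j mod c"] c(1) by simp
    thus False using vi zm c(3) by simp
  qed
  hence "(iv W ^^ c) h = - h" using c(2) retneg by blast
  \<comment> \<open>So the stretch on which z is constant covers the whole block.\<close>
  hence bc: "bl j \<le> c" 
  proof -
    assume r: "(iv W ^^ c) h = - h"
    show ?thesis
    proof (rule ccontr)
      assume "\<not> bl j \<le> c"
      thus False using vpow_neg_block[OF j c(1)] r c(1) by (simp add: h_def)
    qed
  qed
  have v2: "(iv W ^^ (2 * bl j * k)) i = i" for k
  proof -
    have "(iv W ^^ (2 * bl j)) i = i" using vi by (simp add: mult_2 funpow_add pm)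
    thus ?thesis using funpow_mod_eq[of "2 * bl j" "iv W" i "2 * bl j * k"] by simp
  qed
  \<comment> \<open>A nonnegative exponent congruent to - l modulo the period 2 b.\<close>
  define K where "K = 2 * bl j * (l + 1) - l"
  have Kl: "K + l = 2 * bl j * (l + 1)"
  proof -
    have "1 * l \<le> (2 * bl j) * (l + 1)" using b by (intro mult_mono) auto
    thus ?thesis by (simp add: K_def)
  qed
  have "(iv W ^^ K) ((iv W ^^ l) i) = i" using v2[of "l + 1"] unfolding Kl[symmetric] by (simp add: funpow_add)
  hence K1: "(iv W ^^ K) e = i \<or> (iv W ^^ K) e = - i" using i(3) pm by auto
  have K2: "(iv W ^^ (K + bl j)) e = - (iv W ^^ K) e"
    using K1 vi comm[of K "bl j" e] pm by (auto simp: funpow_add)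
  have "\<exists>k. (iv W ^^ k) e = i" "\<exists>k. (iv W ^^ k) e = - i"
    using K1 K2 by (auto intro: exI[of _ K] exI[of _ "K + bl j"])
  then obtain k where k: "(iv W ^^ k) e = s * i" using s by auto
  show ?thesis
  proof (rule that[of k])
    fix t assume t: "1 \<le> t" "t \<le> bl j"
    \<comment> \<open>For b > 1 the powers start at position b - 1, descend to 1 and end at
      b.\<close>
    define d where "d = (if t = bl j then bl j - 1 else bl j - 1 - t)"
    have d: "d < bl j" using b by (auto simp: d_def)
    have d1: "(iv W ^^ Suc d) h = - int (st j + (if Suc d = bl j then bl j else bl j - Suc d))"
      unfolding h_def by (rule vpow_neg_block[OF j]) (use d in auto)
    have d2: "(if Suc d = bl j then bl j else bl j - Suc d) = t" using t b by (auto simp: d_def)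
    have "(iv W ^^ d) e = int (st j + t)" unfolding ve d1 d2 by simp
    hence "(iv W ^^ k) (int (st j + t)) = (iv W ^^ d) (s * i)" using comm k by metis
    hence "z ((iv W ^^ k) (int (st j + t))) = of_int s * z i"
      using s c(4)[of d] d bc pm zm by auto
    thus "0 < of_int s * z ((iv W ^^ k) (int (st j + t)))" using s c(3) by auto
  qed
qed

text \<open>A negative cycle sits at c/2 and is brought to the right side by a power. A positive
  cycle of slope zero admits a shift combined with a reflection. A cycle of positive slope is placed
  in [0, 1) as before the contraction, which then leaves it in the first half.\<close>

lemma reach_orbit:
  assumes pos: "positive p" and z: "good z" "aligned z Z0"
    and y: "y \<in> reachset T n w0 X" "aff y (u1 + z) \<in> alc (roof T) n"
  shows "gconj y X \<in> Sn_orbit T n X"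
proof -
  have qR: "u1 + z \<in> Rn n" by (intro Rn_add u1_Rn goodD(1)[OF z(1)])
  obtain g where g: "inG T n g" "gconj g X = X"
    "\<And>i. i \<in> {1..int n} \<Longrightarrow> 0 < aff g (u1 + z) i \<and> aff g (u1 + z) i < 1/2"
  proof (rule block_centraliser[OF qR, of T "\<lambda>r. 0 < r \<and> r < 1/2"])
    fix j assume j: "j < L"
    note b = bl_pos[OF j]
    consider "neg j" | "\<not> neg j" "cl j = 0" | "\<not> neg j" "0 < cl j"
    proof -
      have "0 \<le> cl j" if "\<not> neg j"
      proof -
        have "r ! j = p ! j" "j < length p" using that by (auto simp: neg_def r_def nth_append)
        hence "(bl j, cl j) \<in> set p" using nth_mem[of j p] by (simp add: bl_def cl_def)
        thus ?thesis using pos by (auto simp: positive_def)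
      qed
      thus ?thesis using that by (cases "neg j") force+
    qed
    thus "\<exists>k e m. (e = 1 \<or> e = - 1) \<and> (e = - 1 \<longrightarrow> cl j = 0 \<and> T \<noteq> Type_A) \<and> (neg j \<longrightarrow> m = 0) \<and>
      (\<forall>t. 1 \<le> t \<and> t \<le> bl j \<longrightarrow> 0 < of_int m + of_int e * (aff X ^^ k) (u1 + z) (int (st j + t)) \<and>
         of_int m + of_int e * (aff X ^^ k) (u1 + z) (int (st j + t)) < 1/2)"
    proof cases
      case 1
      \<comment> \<open>Values at 0 must be perturbed upwards and values at 1/2 downwards.\<close>
      define s :: int where "s = (if cl j = 0 then 1 else - 1)"
      obtain k where k: "\<And>t. 1 \<le> t \<Longrightarrow> t \<le> bl j \<Longrightarrow> 0 < of_int s * z ((iv W ^^ k) (int (st j + t)))"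
        using neg_block_align[OF z j 1, of s] by (metis s_def)
      have "0 < (aff X ^^ k) (u1 + z) (int (st j + t)) \<and> (aff X ^^ k) (u1 + z) (int (st j + t)) < 1/2"
        if t: "1 \<le> t" "t \<le> bl j" for t
        unfolding q_zero[OF neg_block(1)[OF j 1 t]] neg_block(2)[OF j 1 t]
        using k[OF t] goodD(3)[OF z(1), of "(iv W ^^ k) (int (st j + t))"] gap(2) neg_special[OF j 1]
        by (auto simp: s_def abs_le_iff)
      thus ?thesis by (intro exI[of _ k] exI[of _ 1] exI[of _ 0]) auto
    next
      case 2
      obtain a where a: "2 * a \<notin> \<int>" "\<And>t. 1 \<le> t \<Longrightarrow> t \<le> bl j \<Longrightarrow> (u1 + z) (int (st j + t)) = a"
        using zero_block_const[OF z j 2] by metis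
      have f: "frac a \<noteq> 0" "frac a \<noteq> 1/2"
      proof -
        show "frac a \<noteq> 0" using a(1) by auto
        show "frac a \<noteq> 1/2"
        proof
          assume "frac a = 1/2"
          hence "2 * a = of_int (2 * \<lfloor>a\<rfloor> + 1)" by (simp add: frac_def)
          thus False using a(1) by (metis Ints_of_int)
        qed
      qed
      have f': "0 < frac a" "frac a < 1" using f(1) frac_ge_0[of a] frac_lt_1[of a] by auto
      show ?thesis
      proof (cases "frac a < 1/2")
        case True
        have "0 < of_int (- \<lfloor>a\<rfloor>) + of_int 1 * a \<and> of_int (- \<lfloor>a\<rfloor>) + of_int 1 * a < 1/2"
          using True f' by (simp add: frac_def)
        thus ?thesis using a(2) 2
          by (intro exI[of _ 0] exI[of _ 1] exI[of _ "- \<lfloor>a\<rfloor>"]) simp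
      next
        case False
        \<comment> \<open>In the upper half of the unit interval 1 - \<open>frac a\<close> is used
          instead; the block has no translation, so the sign is allowed.\<close>
        have "0 < of_int (\<lfloor>a\<rfloor> + 1) + of_int (- 1) * a \<and> of_int (\<lfloor>a\<rfloor> + 1) + of_int (- 1) * a < 1/2"
          using False f f' by (simp add: frac_def)
        thus ?thesis using a(2) 2 T
          by (intro exI[of _ 0] exI[of _ "- 1"] exI[of _ "\<lfloor>a\<rfloor> + 1"]) simp
      qed
    next
      case 3
      obtain k m where km: "\<And>t. 1 \<le> t \<Longrightarrow> t \<le> bl j \<Longrightarrow>
         0 \<le> of_int m + (aff X ^^ k) u (int (st j + t)) \<and> of_int m + (aff X ^^ k) u (int (st j + t)) < 1"
        using pos_block_shift[OF j 3(1)] by metis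
      have "0 < of_int m + (aff X ^^ k) (u1 + z) (int (st j + t)) \<and> of_int m + (aff X ^^ k) (u1 + z) (int (st j + t)) < 1/2"
        if t: "1 \<le> t" "t \<le> bl j" for t
      proof -
        define r where "r = of_int m + (aff X ^^ k) u (int (st j + t))"
        have r01: "0 \<le> r \<and> r < 1" unfolding r_def by (rule km[OF t])
        have "0 < nu (int (st j + t))" using pos_block(1)[OF j 3(1) t] 3(2) b by simp
        hence "of_int m + (aff X ^^ k) (u1 + z) (int (st j + t)) = squash 1 r"
          using q_pos[OF z(1)] squash_add[of "of_int m" 1 "(aff X ^^ k) u (int (st j + t))"]
          by (simp add: r_def add.commute)
        also have "\<dots> = 1/8 + r / 4"
        proof -
          have "\<lfloor>r\<rfloor> = 0" using r01 by (simp add: floor_eq_iff)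
          thus ?thesis by (simp add: squash_one frac_def)
        qed
        finally have e: "of_int m + (aff X ^^ k) (u1 + z) (int (st j + t)) = 1/8 + r / 4" .
        show ?thesis unfolding e using r01 by simp
      qed
      thus ?thesis using 3 by (intro exI[of _ k] exI[of _ 1] exI[of _ m]) auto
    qed
  qed (use T in auto)
  show ?thesis
  proof (rule orbitI[OF reachset_inG[OF y(1)] x0 g(1,2) qR _ y(2)])
    show "0 \<le> aff g (u1 + z) i \<and> aff g (u1 + z) i < roof T \<and> (T \<noteq> Type_A \<longrightarrow> 0 < aff g (u1 + z) i)"
      if "i \<in> {1..int n}" for i using g(3)[OF that] T by (auto simp: roof_def)
  qed (use T in auto)
qed

end

section \<open>From conjugacy classes to conjugators\<close>

lemma conj_orbit_semidirect:
  assumes "w \<in> conj_orbit (semidirect (Zn n) S) (carrier (semidirect (Zn n) S)) x"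
    and "S = sym_perms n \<or> S = signed_perms n"
  obtains h where "h \<in> Zn n \<times> S" "w = gconj h x"
proof -
  obtain h where h: "h \<in> carrier (semidirect (Zn n) S)"
    "w = h \<otimes>\<^bsub>semidirect (Zn n) S\<^esub> x \<otimes>\<^bsub>semidirect (Zn n) S\<^esub> inv\<^bsub>semidirect (Zn n) S\<^esub> h"
    using assms(1) by (auto simp: conj_orbit_def)
  have hS: "h \<in> Zn n \<times> S" using h(1) by (simp add: semidirect_def)
  have "m_inv (semidirect (Zn n) S) h = ginv h"
  proof (rule m_inv_semidirect[OF hS])
    show "ginv h \<in> Zn n \<times> S"
      using assms(2)
    proof
      assume "S = sym_perms n" thus ?thesis using hS ginv_grpA[of h n] by (simp add: grpA_def)
    next
      assume "S = signed_perms n" thus ?thesis using hS ginv_grp[of h n] by (simp add: grp_def)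
    qed
    show "bij w" if "w \<in> S" for w using that assms(2) sp_bij sym_perms_signed by blast
  qed
  hence "w = gconj h x" using h(2) by (simp add: gconj_def semidirect_mult)
  thus ?thesis using that hS by blast
qed

text \<open>The standard element takes the role of \<open>x0\<close>. It is conjugate to
  \<open>w_tilde p q\<close> by an integral translation g, so \<open>gmul h (ginv g)\<close> is the
  conjugator to start from.\<close>

lemma reach_standard:
  assumes n: "1 \<le> n" and DP: "(p, q) \<in> DP n" and h: "inG T n h"
    and A: "T = Type_A \<Longrightarrow> q = []" and pos: "T \<noteq> Type_A \<Longrightarrow> positive p"
  shows "\<exists>w' \<in> Sn_orbit T n (w_std p q). reaches T n (gconj h (w_tilde p q)) w'"
proof -
  interpret dblocks n p q by unfold_locales (rule DP)
  define w0 where "w0 = gconj h (w_tilde p q)"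
  define g where "g = ((zvec, id) :: elt)"
  have gG: "inG T n g" using zvec_Zn sp_id sym_perms_id by (simp add: g_def inG_def grp_def grpA_def)
  have XG: "inG T n X" by (rule X_inG[OF A])
  have c: "gconj (ginv g) X = w_tilde p q"
  proof -
    have "X = gconj g (w_tilde p q)" using std_conj by (simp add: g_def)
    hence "gconj (ginv g) X = gconj (gmul (ginv g) g) (w_tilde p q)"
      using gconj_gmul[OF ginv_grp[OF inG_grp[OF gG]] inG_grp[OF gG] w_tilde_grp] by simp
    thus ?thesis using ginv_left[OF grp_bij[OF inG_grp[OF gG]]]
      by (simp add: gconj_def gmul_id ginv_def act_zero)
  qed
  have "gconj (gmul h (ginv g)) X = w0"
    using gconj_gmul[OF inG_grp[OF h] ginv_grp[OF inG_grp[OF gG]] X_grp] c by (simp add: w0_def)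
  hence "gmul h (ginv g) \<in> reachset T n w0 X"
    using h gG by (simp add: reachset_def inG_gmul inG_ginv reaches_def)
  then obtain y u where y: "y \<in> reachset T n w0 X" "u \<in> Rn n" "aff y u \<in> alc (roof T) n" "lap X u = 0"
    "T = Type_A \<Longrightarrow> aff y u 1 < 1"
    using reach_translation_point[OF n _ XG] by metis
  have "\<exists>y \<in> reachset T n w0 X. gconj y X \<in> Sn_orbit T n X"
  proof (cases "T = Type_A")
    case True
    interpret std0 n p q T w0 u using n XG y by unfold_locales auto
    show ?thesis using reach_orbit_A[OF True A[OF True] y(1,3) y(5)[OF True]] y(1) by blast
  next
    case False
    interpret std n p q T w0 u using n XG y False by unfold_locales auto
    obtain y1 where y1: "y1 \<in> reachset T n w0 X" "aff y1 u1 \<in> alc (roof T) n" using reach_u1[OF y(1,3)] .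
    obtain z where z: "good z" "aligned z Z0" using reach_aligned[OF y1] .
    then obtain y2 where "y2 \<in> reachset T n w0 X" "aff y2 (u1 + z) \<in> alc (roof T) n"
      unfolding good_def by blast
    thus ?thesis using reach_orbit[OF pos[OF False] z] by blast
  qed
  thus ?thesis unfolding w0_def[symmetric] by (auto simp: reachset_def)
qed

theorem theorem6p1:
  fixes n :: nat
  assumes "1 \<le> n"
  shows "(\<forall>p w. (p, []) \<in> DP n \<and> w \<in> class_A n p \<longrightarrow>
            (\<exists>w' \<in> Sn_orbit Type_A n (w_std p []). reaches Type_A n w w')) \<and>
         (\<forall>T p q w. T \<in> {Type_B, Type_C, Type_D} \<and> (p, q) \<in> DP_pos n \<and> w \<in> class_B n p q \<longrightarrow>
            (\<exists>w' \<in> Sn_orbit T n (w_std p q). reaches T n w w'))"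
proof (intro conjI allI impI; elim conjE)
  fix p w assume DP: "(p, []) \<in> DP n" and w: "w \<in> class_A n p"
  obtain h where h: "h \<in> Zn n \<times> sym_perms n" "w = gconj h (w_tilde p [])"
    using w conj_orbit_semidirect unfolding class_A_def Let_def by metis
  have "inG Type_A n h" using h(1) grpA_grp by (simp add: inG_def grpA_def)
  thus "\<exists>w' \<in> Sn_orbit Type_A n (w_std p []). reaches Type_A n w w'"
    unfolding h(2) by (rule reach_standard[OF assms DP]) auto
next
  fix T p q w assume T: "T \<in> {Type_B, Type_C, Type_D}" and DP: "(p, q) \<in> DP_pos n" and w: "w \<in> class_B n p q"
  obtain h where h: "h \<in> Zn n \<times> signed_perms n" "w = gconj h (w_tilde p q)"
    using w conj_orbit_semidirect unfolding class_B_def Let_def by metis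
  have "inG T n h" using h(1) T by (auto simp: inG_def grp_def)
  thus "\<exists>w' \<in> Sn_orbit T n (w_std p q). reaches T n w w'"
    unfolding h(2) by (intro reach_standard[OF assms]) (use DP T in \<open>auto simp: DP_pos_def\<close>)
qed

end
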